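(* Let $M$ be a quaternionic Kähler manifold of dimension $4n$ (for $n=1$: a half conformally flat Einstein manifold) and let $k\ge0$ be even. For $0\le r\le n$, $r\le q\le 2n-r$, $q\equiv r\pmod 2$, set $l:=\frac{q-r}2$ and identify $\mathrm{Sym}^{k+q}H\otimes\Lambda^r_\circ E^*$ with subspaces of both $\mathrm{Sym}^{k+q}H\otimes\Lambda^qE^*$ and $\mathrm{Sym}^{k+q}H\otimes\Lambda^{2n,2n-q}E^*$ via $$\psi\mapsto\tfrac1{l!}(\sigma_E\wedge)^l\psi\in\Lambda^qE^*,\qquad \psi\mapsto\tfrac1{n!}\sigma_E^n\otimes\tfrac1{(n-r-l)!}(\sigma_E\wedge)^{n-r-l}\psi\in\Lambda^{2n,2n-q}E^*\qquad(\psi\in\Lambda^r_\circ E^* ).$$ Consider the $\mathbf{Sp}(1)\cdot\mathbf{Sp}(n)$-equivariant isomorphism $$\gamma:\ \mathrm{Sym}^{k+q}H\otimes\Lambda^qE^*\longrightarrow\mathrm{Sym}^{k+q}H\otimes\Lambda^{2n,2n-q}E^*$$ which on each of these subspaces is multiplication by $$(-1)^{l}\ \frac{(k+q-l)!\,(k+n+l+1)!}{(k+q+1)!}.$$ Then the differential operator $$D_{\mathrm{Sym}^{k+n}H}:=\sqrt2\,(d+\gamma^{-1}\circ\delta\circ\gamma)$$ is the twisted Dirac operator on $S\otimes\mathrm{Sym}^{k+n}H\cong\bigoplus_{q=0}^{2n}\mathrm{Sym}^{k+q}H\otimes\Lambda^qE^*$, where $S$ is the spinor bundle and the Clifford multiplication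 is the one specified in the context.
   Context: $M$ is quaternionic Kähler: the holonomy group is contained in $\mathbf{Sp}(1)\cdot\mathbf{Sp}(n)$, and $TM\otimes_{\mathbf R}\mathbf C\cong H\otimes E$ with $H$ ($\dim_{\mathbf C}=2$) and $E$ ($\dim_{\mathbf C}=2n$) the (in general only locally defined) bundles associated to the standard representations of $\mathbf{Sp}(1)$ and $\mathbf{Sp}(n)$; $\sigma_H,\sigma_E$ are the parallel symplectic forms, with Riemannian metric $\sigma_H\otimes\sigma_E$ and Levi-Civita connection $\nabla$. Musical isomorphisms: $h^\sharp=\sigma_H(h,\cdot)$, $e^\sharp=\sigma_E(e,\cdot)$, with inverses $\flat$. $h\cdot$ is the symmetric product and $\alpha\lrcorner$ ($\alpha\in H^*$) the contraction on $\mathrm{Sym}\,H$; $e\lrcorner$ is contraction on $\Lambda E^*$. $\Lambda^r_\circ E^*\subset\Lambda^rE^*$ is the kernel of contraction with the dual of $\sigma_E$ (trace-free forms) and $\eta\wedge_\circ$ is $\eta\wedge$ followed by the equivariant projection onto $\Lambda^{r+1}_\circ E^*$. $\Lambda^{2n,2n-q}E^*=\Lambda^{2n}E^*\otimes\Lambda^{2n-q}E^*$. The line bundles $L^{\pm s}$ (powers of $\det E$) which twist the operators on a general quaternionic manifold are trivialized by the parallel section $\frac1{n!}\sigma_E^n$. The first order operators $$d:\mathrm{Sym}^{k+q}H\otimes\Lambda^qE^*\to\mathrm{Sym}^{k+q+1}H\otimes\Lambda^{q+1}E^*,\qquad \delta:\mathrm{Sym}^{k+q}H\otimes\Lambda^{2n,2n-q}E^*\to\mathrm{Sym}^{k+q-1}H\otimes\Lambda^{2n,2n-q+1}E^*$$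 are the compositions of $\nabla$ with the symbols, for $\alpha\otimes\eta\in H^*\otimes E^*=T^*M\otimes\mathbf C$, $$\sigma_d[\alpha\otimes\eta]=\tfrac1{k+q+1}\,\alpha^\flat\cdot\otimes\eta\wedge,\qquad\sigma_\delta[\alpha\otimes\eta]=(-1)^q\,\alpha\lrcorner\otimes\mathrm{id}\otimes\eta\wedge .$$ The spinor bundle is $S=\bigoplus_{r=0}^n\mathrm{Sym}^{n-r}H\otimes\Lambda^r_\circ E^*$. There is an isomorphism $\bigoplus_{q}\mathrm{Sym}^{k+q}H\otimes\Lambda^qE^*\cong\bigoplus_{r}\bigoplus_{q}\mathrm{Sym}^{k+q}H\otimes\Lambda^r_\circ E^*\cong S\otimes\mathrm{Sym}^{k+n}H$ (sum over $0\le r\le n$, $r\le q\le 2n-r$, $q\equiv r$ mod $2$; the first identification by the embeddings $\frac1{l!}(\sigma_E\wedge)^l$) under which Clifford multiplication by $h\otimes e$ on the summand $\mathrm{Sym}^{k+q}H\otimes\Lambda^r_\circ E^*$ is $$\tfrac1{\sqrt2}(h\otimes e)\bullet=\tfrac1{k+q+1}h\cdot\otimes e^\sharp\wedge_\circ-\tfrac1{k+q+1}\tfrac{l+1}{n-r+1}h\cdot\otimes e\lrcorner+\tfrac{k+n+l+1}{k+q+1}h^\sharp\lrcorner\otimes e^\sharp\wedge_\circ+\tfrac{k+q-l}{k+q+1}\tfrac{n-r-l+1}{n-r+1}h^\sharp\lrcorner\otimes e\lrcorner,$$ where $h\cdot\otimes e^\sharp\wedge_\circ$, $h\cdot\otimes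 e\lrcorner$, $h^\sharp\lrcorner\otimes e^\sharp\wedge_\circ$, $h^\sharp\lrcorner\otimes e\lrcorner$ map to the summands with indices $(q+1,r+1)$, $(q+1,r-1)$, $(q-1,r+1)$, $(q-1,r-1)$ respectively, and a term is read as $0$ if its target summand does not occur. The twisted Dirac operator is $\nabla$ followed by this Clifford multiplication (tangent and cotangent vectors identified by $h\otimes e\leftrightarrow h^\sharp\otimes e^\sharp$).
   Formalization: The coefficient of γ in degree q is multiplied by the extra sign (-1)^{q(q-1)/2}; with the stated coefficient and the sign (-1)^q in the symbol of δ, the degree-lowering part from even q≥2 is the negative of the Clifford multiplication (e.g. n=1, k=0, q=2, r=0). *)

theory Defs
  imports "HOL-Analysis.Analysis"
begin

section \<open>Smooth manifolds, metrics and Levi-Civita parallel transport\<close>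

text \<open>For open \<open>S\<close> this is \<open>C\<^sup>k\<close> on \<open>S\<close>; it is only used on open sets.\<close>

primrec Ck_on :: "nat \<Rightarrow> 'a::euclidean_space set \<Rightarrow> ('a \<Rightarrow> 'b::real_normed_vector) \<Rightarrow> bool" where
  "Ck_on 0 S f = continuous_on S f"
| "Ck_on (Suc k) S f =
     ((\<forall>x\<in>S. f differentiable (at x)) \<and> (\<forall>v. Ck_on k S (\<lambda>x. frechet_derivative f (at x) v)))"

definition smooth_on :: "'a::euclidean_space set \<Rightarrow> ('a \<Rightarrow> 'b::real_normed_vector) \<Rightarrow> bool" where
  "smooth_on S f \<longleftrightarrow> (\<forall>k. Ck_on k S f)"

text \<open>A chart is a pair of its domain and its coordinate map (a total function, of which only
  the values on the domain matter).\<close>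

type_synonym ('m, 'd) chart = "'m set \<times> ('m \<Rightarrow> real^'d)"

definition chart_inv :: "('m, 'd::finite) chart \<Rightarrow> real^'d \<Rightarrow> 'm" where
  "chart_inv C = inv_into (fst C) (snd C)"

definition charts_at :: "('m, 'd::finite) chart set \<Rightarrow> 'm \<Rightarrow> ('m, 'd) chart set" where
  "charts_at A p = {C \<in> A. p \<in> fst C}"

definition smooth_manifold :: "'m topology \<Rightarrow> ('m, 'd::finite) chart set \<Rightarrow> bool" where
  "smooth_manifold X A \<longleftrightarrow>
     Hausdorff_space X \<and> second_countable X \<and> (\<Union>C\<in>A. fst C) = topspace X \<and>
     (\<forall>C\<in>A. openin X (fst C) \<and> open (snd C ` fst C) \<and>
        homeomorphic_map (subtopology X (fst C)) (top_of_set (snd C ` fst C)) (snd C)) \<and>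
     (\<forall>C\<in>A. \<forall>C'\<in>A. smooth_on (snd C ` (fst C \<inter> fst C')) (snd C' \<circ> chart_inv C))"

definition jacobian :: "('m, 'd::finite) chart \<Rightarrow> ('m, 'd) chart \<Rightarrow> 'm \<Rightarrow> real^'d^'d" where
  "jacobian C C' p = matrix (frechet_derivative (snd C' \<circ> chart_inv C) (at (snd C p)))"

text \<open>Tensor fields are given by their components in each chart.  \<open>g C x\<close> is the matrix of
  components of the metric in the chart \<open>C\<close> at the point with coordinates \<open>x\<close>.\<close>

type_synonym ('m, 'd) metric = "('m, 'd) chart \<Rightarrow> real^'d \<Rightarrow> real^'d^'d"

definition riemannian_manifold ::
    "'m topology \<Rightarrow> ('m, 'd::finite) chart set \<Rightarrow> ('m, 'd) metric \<Rightarrow> bool" where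
  "riemannian_manifold X A g \<longleftrightarrow> smooth_manifold X A \<and>
     (\<forall>C\<in>A. smooth_on (snd C ` fst C) (g C)) \<and>
     (\<forall>C\<in>A. \<forall>x\<in>snd C ` fst C. transpose (g C x) = g C x \<and> (\<forall>v. v \<noteq> 0 \<longrightarrow> 0 < v \<bullet> (g C x *v v))) \<and>
     (\<forall>C\<in>A. \<forall>C'\<in>A. \<forall>p\<in>fst C \<inter> fst C'.
        transpose (jacobian C C' p) ** g C' (snd C' p) ** jacobian C C' p = g C (snd C p))"

definition partial_deriv :: "(real^'d::finite \<Rightarrow> real) \<Rightarrow> 'd \<Rightarrow> real^'d \<Rightarrow> real" where
  "partial_deriv f j x = frechet_derivative f (at x) (axis j 1)"

text \<open>\<open>christoffel g C x i j k\<close> is the Christoffel symbol with upper index \<open>i\<close> and lower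
  indices \<open>j\<close>, \<open>k\<close>.\<close>

definition christoffel ::
    "('m, 'd::finite) metric \<Rightarrow> ('m, 'd) chart \<Rightarrow> real^'d \<Rightarrow> 'd \<Rightarrow> 'd \<Rightarrow> 'd \<Rightarrow> real" where
  "christoffel g C x i j k = (1/2) * (\<Sum>l\<in>UNIV. matrix_inv (g C x) $ i $ l *
     (partial_deriv (\<lambda>y. g C y $ l $ k) j x + partial_deriv (\<lambda>y. g C y $ l $ j) k x
      - partial_deriv (\<lambda>y. g C y $ j $ k) l x))"

section \<open>The model representations\<close>

text \<open>The standard representation of \<open>Sp(m)\<close> is \<open>complex^('a+'a)\<close> with \<open>m = CARD('a)\<close>, with
  its complex symplectic form and its quaternionic structure; \<open>H\<close> is the case \<open>m = 1\<close>, and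
  \<open>E\<close> is the case \<open>m = n = CARD('n)\<close>.  Elements of the dual space are represented by their
  coordinates with respect to the dual basis.\<close>

type_synonym H = "complex^(unit+unit)"
type_synonym 'n E = "complex^('n+'n)"

definition symp :: "complex^('a::finite+'a) \<Rightarrow> complex^('a+'a) \<Rightarrow> complex" where
  "symp v w = (\<Sum>i\<in>UNIV. v $ Inl i * w $ Inr i - v $ Inr i * w $ Inl i)"

definition quat_J :: "complex^('a::finite+'a) \<Rightarrow> complex^('a+'a)" where
  "quat_J v = (\<chi> i. case i of Inl j \<Rightarrow> - cnj (v $ Inr j) | Inr j \<Rightarrow> cnj (v $ Inl j))"

definition Sp :: "(complex^('a::finite+'a)^('a+'a)) set" where
  "Sp = {a. (\<forall>v w. symp (a *v v) (a *v w) = symp v w) \<and> (\<forall>v. a *v quat_J v = quat_J (a *v v))}"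

definition pairing :: "complex^'i::finite \<Rightarrow> complex^'i \<Rightarrow> complex" where
  "pairing \<alpha> v = (\<Sum>i\<in>UNIV. \<alpha> $ i * v $ i)"

definition sharp :: "complex^('a::finite+'a) \<Rightarrow> complex^('a+'a)" where
  "sharp v = (\<chi> i. symp v (axis i 1))"

definition flat :: "complex^('a::finite+'a) \<Rightarrow> complex^('a+'a)" where
  "flat = inv sharp"

section \<open>Adapted frames and quaternionic Kaehler manifolds\<close>

text \<open>The coordinates in a chart of an (arbitrary) complex linear map from \<open>H \<otimes> E\<close> to the
  complexified tangent space at a point, and its value on \<open>h \<otimes> e\<close>.\<close>

type_synonym ('n, 'd) frame_coords = "complex^('n+'n)^(unit+unit)^'d"

definition frame_eval :: "('n::finite, 'd::finite) frame_coords \<Rightarrow> H \<Rightarrow> 'n E \<Rightarrow> complex^'d" where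
  "frame_eval U h e = (\<chi> i. \<Sum>B\<in>UNIV. \<Sum>b\<in>UNIV. U $ i $ B $ b * h $ B * e $ b)"

definition frame_act :: "complex^(unit+unit)^(unit+unit) \<Rightarrow> complex^('n::finite+'n)^('n+'n)
    \<Rightarrow> ('n, 'd::finite) frame_coords \<Rightarrow> ('n, 'd) frame_coords" where
  \<comment> \<open>precomposition with \<open>a \<otimes> b\<close>\<close>
  "frame_act a b U = (\<chi> i. transpose a ** (U $ i) ** b)"

definition coord_change :: "real^'d^'d \<Rightarrow> ('n::finite, 'd::finite) frame_coords \<Rightarrow> ('n, 'd) frame_coords" where
  "coord_change J U = (\<chi> i. \<Sum>j\<in>UNIV. J $ i $ j *\<^sub>R U $ j)"

text \<open>A point of the frame bundle consists of a base point \<open>p\<close> and the family of coordinates of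
  the frame in all charts at \<open>p\<close> (normalised to be \<open>0\<close> for all other charts).\<close>

type_synonym ('m, 'n, 'd) frame = "'m \<times> (('m, 'd) chart \<Rightarrow> ('n, 'd) frame_coords)"

definition is_frame :: "('m, 'd::finite) chart set \<Rightarrow> ('m, 'n::finite, 'd) frame \<Rightarrow> bool" where
  "is_frame A u \<longleftrightarrow> (\<forall>C. C \<notin> charts_at A (fst u) \<longrightarrow> snd u C = 0) \<and>
     (\<forall>C\<in>charts_at A (fst u). \<forall>C'\<in>charts_at A (fst u).
        snd u C' = coord_change (jacobian C C' (fst u)) (snd u C))"

definition frame_at ::
    "('m, 'd::finite) chart set \<Rightarrow> ('m, 'd) chart \<Rightarrow> real^'d \<Rightarrow> ('n::finite, 'd) frame_coords \<Rightarrow> ('m, 'n, 'd) frame" where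
  "frame_at A C x U = (let p = chart_inv C x in
     (p, \<lambda>C'. if C' \<in> charts_at A p then coord_change (jacobian C C' p) U else 0))"

definition frame_right :: "complex^(unit+unit)^(unit+unit) \<Rightarrow> complex^('n::finite+'n)^('n+'n)
    \<Rightarrow> ('m, 'n, 'd::finite) frame \<Rightarrow> ('m, 'n, 'd) frame" where
  "frame_right a b u = (fst u, \<lambda>C. frame_act a b (snd u C))"

text \<open>An adapted frame is compatible with the real structures and maps \<open>\<sigma>\<^sub>H \<otimes> \<sigma>\<^sub>E\<close> to the
  (complex bilinearly extended) metric.\<close>

definition adapted_frame ::
    "('m, 'd::finite) chart set \<Rightarrow> ('m, 'd) metric \<Rightarrow> ('m, 'n::finite, 'd) frame \<Rightarrow> bool" where
  "adapted_frame A g u \<longleftrightarrow> is_frame A u \<and>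
     (\<forall>C\<in>charts_at A (fst u). \<forall>h e.
        frame_eval (snd u C) (quat_J h) (quat_J e) = (\<chi> i. cnj (frame_eval (snd u C) h e $ i)) \<and>
        (\<forall>h' e'. (\<Sum>i\<in>UNIV. \<Sum>j\<in>UNIV. of_real (g C (snd C (fst u)) $ i $ j) *
                    frame_eval (snd u C) h e $ i * frame_eval (snd u C) h' e' $ j)
                 = symp h h' * symp e e'))"

text \<open>A \<open>C\<^sup>1\<close> curve in the domain of a single chart together with a parallel frame along it.\<close>

definition horizontal_curve :: "('m, 'd::finite) metric \<Rightarrow> ('m, 'd) chart
    \<Rightarrow> (real \<Rightarrow> real^'d) \<Rightarrow> (real \<Rightarrow> ('n::finite, 'd) frame_coords) \<Rightarrow> bool" where
  "horizontal_curve g C x U \<longleftrightarrow> (\<exists>x'. continuous_on {0..1} x' \<and>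
     (\<forall>t\<in>{0..1}. x t \<in> snd C ` fst C \<and>
        (x has_vector_derivative x' t) (at t within {0..1}) \<and>
        (U has_vector_derivative
           (\<chi> i. - (\<Sum>j\<in>UNIV. \<Sum>k\<in>UNIV. (christoffel g C (x t) i j k * x' t $ j) *\<^sub>R U t $ k)))
          (at t within {0..1})))"

definition transport_step :: "('m, 'd::finite) chart set \<Rightarrow> ('m, 'd) metric
    \<Rightarrow> ('m, 'n::finite, 'd) frame \<Rightarrow> ('m, 'n, 'd) frame \<Rightarrow> bool" where
  "transport_step A g u v \<longleftrightarrow> is_frame A u \<and> is_frame A v \<and>
     (\<exists>C\<in>A. \<exists>x U. fst u \<in> fst C \<and> fst v \<in> fst C \<and> horizontal_curve g C x U \<and>
        x 0 = snd C (fst u) \<and> U 0 = snd u C \<and> x 1 = snd C (fst v) \<and> U 1 = snd v C)"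

text \<open>Parallel transport along piecewise \<open>C\<^sup>1\<close> curves: every such curve is a finite
  concatenation of \<open>C\<^sup>1\<close> curves lying in chart domains.\<close>

definition parallel_transport :: "('m, 'd::finite) chart set \<Rightarrow> ('m, 'd) metric
    \<Rightarrow> ('m, 'n::finite, 'd) frame \<Rightarrow> ('m, 'n, 'd) frame \<Rightarrow> bool" where
  "parallel_transport A g = (transport_step A g)\<^sup>*\<^sup>*"

text \<open>The holonomy group at the base point of \<open>u\<close>, referred to the frame \<open>u\<close>, is contained in
  \<open>Sp(1)\<cdot>Sp(n)\<close>.\<close>

definition holonomy_in_Sp1_Spn ::
    "('m, 'd::finite) chart set \<Rightarrow> ('m, 'd) metric \<Rightarrow> ('m, 'n::finite, 'd) frame \<Rightarrow> bool" where
  "holonomy_in_Sp1_Spn A g u \<longleftrightarrow>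
     (\<forall>v. parallel_transport A g u v \<and> fst v = fst u \<longrightarrow> (\<exists>a\<in>Sp. \<exists>b\<in>Sp. v = frame_right a b u))"

text \<open>The reduction of the frame bundle to \<open>Sp(1)\<cdot>Sp(n)\<close> generated by \<open>u\<close>.\<close>

definition frame_reduction ::
    "('m, 'd::finite) chart set \<Rightarrow> ('m, 'd) metric \<Rightarrow> ('m, 'n::finite, 'd) frame \<Rightarrow> ('m, 'n, 'd) frame set" where
  "frame_reduction A g u = {v. \<exists>a\<in>Sp. \<exists>b\<in>Sp. parallel_transport A g (frame_right a b u) v}"

text \<open>Curvature, with the conventions that \<open>riemann_up g C x i j k l\<close> is the \<open>i\<close>-th component of
  \<open>R(\<partial>\<^sub>k, \<partial>\<^sub>l) \<partial>\<^sub>j\<close> and that round spheres have positive Ricci curvature.\<close>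

definition riemann_up ::
    "('m, 'd::finite) metric \<Rightarrow> ('m, 'd) chart \<Rightarrow> real^'d \<Rightarrow> 'd \<Rightarrow> 'd \<Rightarrow> 'd \<Rightarrow> 'd \<Rightarrow> real" where
  "riemann_up g C x i j k l =
     partial_deriv (\<lambda>y. christoffel g C y i l j) k x - partial_deriv (\<lambda>y. christoffel g C y i k j) l x
     + (\<Sum>m\<in>UNIV. christoffel g C x i k m * christoffel g C x m l j
                 - christoffel g C x i l m * christoffel g C x m k j)"

definition ricci :: "('m, 'd::finite) metric \<Rightarrow> ('m, 'd) chart \<Rightarrow> real^'d \<Rightarrow> 'd \<Rightarrow> 'd \<Rightarrow> real" where
  "ricci g C x j l = (\<Sum>i\<in>UNIV. riemann_up g C x i j i l)"

definition scalar_curvature :: "('m, 'd::finite) metric \<Rightarrow> ('m, 'd) chart \<Rightarrow> real^'d \<Rightarrow> real" where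
  "scalar_curvature g C x = (\<Sum>j\<in>UNIV. \<Sum>l\<in>UNIV. matrix_inv (g C x) $ j $ l * ricci g C x j l)"

definition weyl4 ::
    "('m, 'd::finite) metric \<Rightarrow> ('m, 'd) chart \<Rightarrow> real^'d \<Rightarrow> 'd \<Rightarrow> 'd \<Rightarrow> 'd \<Rightarrow> 'd \<Rightarrow> real" where
  \<comment> \<open>the Weyl tensor in dimension four\<close>
  "weyl4 g C x i j k l = (let G = g C x; R = ricci g C x in
     (\<Sum>m\<in>UNIV. G $ i $ m * riemann_up g C x m j k l)
     - (1/2) * (G $ i $ k * R j l - G $ i $ l * R j k + G $ j $ l * R i k - G $ j $ k * R i l)
     + scalar_curvature g C x / 6 * (G $ i $ k * G $ j $ l - G $ i $ l * G $ j $ k))"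

definition weyl4_eval :: "('m, 'd::finite) metric \<Rightarrow> ('m, 'd) chart \<Rightarrow> real^'d
    \<Rightarrow> complex^'d \<Rightarrow> complex^'d \<Rightarrow> complex^'d \<Rightarrow> complex^'d \<Rightarrow> complex" where
  "weyl4_eval g C x V W Y Z = (\<Sum>i\<in>UNIV. \<Sum>j\<in>UNIV. \<Sum>k\<in>UNIV. \<Sum>l\<in>UNIV.
     of_real (weyl4 g C x i j k l) * V $ i * W $ j * Y $ k * Z $ l)"

definition einstein :: "('m, 'd::finite) chart set \<Rightarrow> ('m, 'd) metric \<Rightarrow> bool" where
  "einstein A g \<longleftrightarrow>
     (\<exists>c. \<forall>C\<in>A. \<forall>x\<in>snd C ` fst C. \<forall>i j. ricci g C x i j = c * g C x $ i $ j)"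

text \<open>For \<open>n = 1\<close> the two eigenspaces of the Hodge star on bivectors are \<open>Sym\<^sup>2 H \<otimes> \<sigma>\<^sub>E\<close> and
  \<open>\<sigma>\<^sub>H \<otimes> Sym\<^sup>2 E\<close>, where \<open>\<sigma>\<^sub>E\<close>, \<open>\<sigma>\<^sub>H\<close> stand for the dual bivectors; the Weyl tensor vanishes on
  one of them.\<close>

definition half_conformally_flat :: "('m, 'd::finite) metric \<Rightarrow> ('m, 'd) chart set
    \<Rightarrow> ('m, 'n::finite, 'd) frame set \<Rightarrow> bool" where
  "half_conformally_flat g A P \<longleftrightarrow>
     (\<forall>u\<in>P. \<forall>C\<in>charts_at A (fst u). \<forall>h h' Y Z. (\<Sum>i\<in>UNIV.
          weyl4_eval g C (snd C (fst u)) (frame_eval (snd u C) h (axis (Inl i) 1)) (frame_eval (snd u C) h' (axis (Inr i) 1)) Y Z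
        - weyl4_eval g C (snd C (fst u)) (frame_eval (snd u C) h (axis (Inr i) 1)) (frame_eval (snd u C) h' (axis (Inl i) 1)) Y Z) = 0)
   \<or> (\<forall>u\<in>P. \<forall>C\<in>charts_at A (fst u). \<forall>e e' Y Z. (\<Sum>i\<in>UNIV.
          weyl4_eval g C (snd C (fst u)) (frame_eval (snd u C) (axis (Inl i) 1) e) (frame_eval (snd u C) (axis (Inr i) 1) e') Y Z
        - weyl4_eval g C (snd C (fst u)) (frame_eval (snd u C) (axis (Inr i) 1) e) (frame_eval (snd u C) (axis (Inl i) 1) e') Y Z) = 0)"

text \<open>\<open>u\<close> is a reference frame with respect to which the holonomy lies in \<open>Sp(1)\<cdot>Sp(n)\<close>; its
  choice fixes the (locally defined) bundles \<open>H\<close> and \<open>E\<close>.\<close>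

definition quaternionic_kaehler :: "'m topology \<Rightarrow> ('m, 'd::finite) chart set \<Rightarrow> ('m, 'd) metric
    \<Rightarrow> ('m, 'n::finite, 'd) frame \<Rightarrow> bool" where
  "quaternionic_kaehler X A g u \<longleftrightarrow>
     riemannian_manifold X A g \<and> connected_space X \<and> CARD('d) = 4 * CARD('n) \<and>
     fst u \<in> topspace X \<and> adapted_frame A g u \<and> holonomy_in_Sp1_Spn A g u \<and>
     (CARD('n) = 1 \<longrightarrow> einstein A g \<and> half_conformally_flat g A (frame_reduction A g u))"

section \<open>Symmetric and exterior powers, tensor products and direct sums\<close>

text \<open>Elements of the \<open>m\<close>-th tensor power of a dual space are functions on lists, supported on
  lists of length \<open>m\<close>.  \<open>Sym m\<close> is the \<open>m\<close>-th symmetric power of \<open>H\<close>, realised as symmetric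
  multilinear forms on the dual of \<open>H\<close> in such a way that \<open>h\<^sub>1\<cdot>\<dots>\<cdot>h\<^sub>m\<close> is the sum over all
  permutations \<open>\<pi>\<close> of the products \<open>\<Prod>\<^sub>i \<alpha>\<^sub>i(h\<^sub>\<pi>\<^sub>i)\<close>; \<open>Alt m\<close> is the \<open>m\<close>-th exterior power of the dual
  of \<open>E\<close>.\<close>

definition multilinear :: "nat \<Rightarrow> ((complex^'i::finite) list \<Rightarrow> complex) set" where
  "multilinear m = {s. (\<forall>xs. length xs \<noteq> m \<longrightarrow> s xs = 0) \<and>
     (\<forall>xs i v w. i < length xs \<longrightarrow> s (xs[i := v + w]) = s (xs[i := v]) + s (xs[i := w])) \<and>
     (\<forall>xs i c v. i < length xs \<longrightarrow> s (xs[i := c *s v]) = c * s (xs[i := v]))}"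

definition Sym :: "nat \<Rightarrow> (H list \<Rightarrow> complex) set" where
  "Sym m = {s \<in> multilinear m. \<forall>xs ys. mset xs = mset ys \<longrightarrow> s xs = s ys}"

definition Alt :: "nat \<Rightarrow> ('n::finite E list \<Rightarrow> complex) set" where
  "Alt m = {\<omega> \<in> multilinear m. \<forall>es. \<not> distinct es \<longrightarrow> \<omega> es = 0}"

definition del :: "nat \<Rightarrow> 'x list \<Rightarrow> 'x list" where
  "del i xs = take i xs @ drop (Suc i) xs"

definition sym_mult :: "H \<Rightarrow> (H list \<Rightarrow> complex) \<Rightarrow> H list \<Rightarrow> complex" where
  "sym_mult h s \<alpha>s = (\<Sum>i<length \<alpha>s. pairing (\<alpha>s ! i) h * s (del i \<alpha>s))"

definition sym_contr :: "H \<Rightarrow> (H list \<Rightarrow> complex) \<Rightarrow> H list \<Rightarrow> complex" where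
  "sym_contr \<alpha> s \<alpha>s = s (\<alpha> # \<alpha>s)"

definition wedge :: "'n::finite E \<Rightarrow> ('n E list \<Rightarrow> complex) \<Rightarrow> 'n E list \<Rightarrow> complex" where
  "wedge \<eta> \<omega> es = (\<Sum>i<length es. (-1)^i * pairing \<eta> (es ! i) * \<omega> (del i es))"

definition contr :: "'n::finite E \<Rightarrow> ('n E list \<Rightarrow> complex) \<Rightarrow> 'n E list \<Rightarrow> complex" where
  "contr e \<omega> es = \<omega> (e # es)"

definition sigma_wedge :: "('n::finite E list \<Rightarrow> complex) \<Rightarrow> 'n E list \<Rightarrow> complex" where
  "sigma_wedge \<omega> es = (\<Sum>j<length es. \<Sum>i<j.
     (-1)^(i+j+1) * symp (es ! i) (es ! j) * \<omega> (del i (del j es)))"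

definition sigma_wedge_div :: "nat \<Rightarrow> ('n::finite E list \<Rightarrow> complex) \<Rightarrow> 'n E list \<Rightarrow> complex" where
  "sigma_wedge_div l \<omega> = (\<lambda>es. (sigma_wedge ^^ l) \<omega> es / fact l)"

definition sigma_contr :: "('n::finite E list \<Rightarrow> complex) \<Rightarrow> 'n E list \<Rightarrow> complex" where
  "sigma_contr \<omega> es = (\<Sum>i\<in>UNIV. \<omega> (axis (Inl i) 1 # axis (Inr i) 1 # es))"

definition Alt0 :: "nat \<Rightarrow> ('n::finite E list \<Rightarrow> complex) set" where
  "Alt0 r = {\<omega> \<in> Alt r. sigma_contr \<omega> = (\<lambda>_. 0)}"

text \<open>The equivariant projection onto the trace-free forms: its kernel is the invariant
  complement \<open>\<sigma>\<^sub>E \<and> Alt (m - 2)\<close> of \<open>Alt0 m\<close> in \<open>Alt m\<close> (which is \<open>0\<close> for \<open>m < 2\<close>).\<close>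

definition tracefree_part :: "nat \<Rightarrow> ('n::finite E list \<Rightarrow> complex) \<Rightarrow> 'n E list \<Rightarrow> complex" where
  "tracefree_part m \<omega> = (THE \<psi>. \<psi> \<in> Alt0 m \<and>
     (\<lambda>es. \<omega> es - \<psi> es) \<in> insert (\<lambda>_. 0) {sigma_wedge \<theta> | \<theta> j. \<theta> \<in> Alt j \<and> j + 2 = m})"

definition wedge0 :: "nat \<Rightarrow> 'n::finite E \<Rightarrow> ('n E list \<Rightarrow> complex) \<Rightarrow> 'n E list \<Rightarrow> complex" where
  "wedge0 r \<eta> \<omega> = tracefree_part (r + 1) (wedge \<eta> \<omega>)"

definition vol :: "'n::finite E list \<Rightarrow> complex" where
  "vol = sigma_wedge_div CARD('n) (\<lambda>es. if es = [] then 1 else 0)"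

definition vol_tensor :: "('n::finite E list \<Rightarrow> complex) \<Rightarrow> 'n E list \<times> 'n E list \<Rightarrow> complex" where
  "vol_tensor \<omega> = (\<lambda>(es, es'). vol es * \<omega> es')"

text \<open>For finite dimensional spaces \<open>V\<close>, \<open>W\<close> of functions, \<open>V \<otimes> W\<close> is the space of functions of
  two variables which are in \<open>V\<close> and \<open>W\<close> separately, and \<open>\<Oplus>\<^sub>q V q\<close> is a space of functions on
  pairs \<open>(q, i)\<close>.\<close>

definition tensor_space ::
    "('x \<Rightarrow> complex) set \<Rightarrow> ('y \<Rightarrow> complex) set \<Rightarrow> ('x \<times> 'y \<Rightarrow> complex) set" where
  "tensor_space V W = {\<phi>. (\<forall>y. (\<lambda>x. \<phi> (x, y)) \<in> V) \<and> (\<forall>x. (\<lambda>y. \<phi> (x, y)) \<in> W)}"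

definition tensor_op :: "(('x \<Rightarrow> complex) \<Rightarrow> 'x' \<Rightarrow> complex) \<Rightarrow> (('y \<Rightarrow> complex) \<Rightarrow> 'y' \<Rightarrow> complex)
    \<Rightarrow> ('x \<times> 'y \<Rightarrow> complex) \<Rightarrow> 'x' \<times> 'y' \<Rightarrow> complex" where
  "tensor_op F G \<phi> = (\<lambda>(x', y'). F (\<lambda>x. G (\<lambda>y. \<phi> (x, y)) y') x')"

definition direct_sum :: "'q set \<Rightarrow> ('q \<Rightarrow> ('i \<Rightarrow> complex) set) \<Rightarrow> ('q \<times> 'i \<Rightarrow> complex) set" where
  "direct_sum I V = {\<phi>. \<forall>q. (\<lambda>i. \<phi> (q, i)) \<in> (if q \<in> I then V q else {\<lambda>_. 0})}"

definition sum_op :: "(('i \<Rightarrow> complex) \<Rightarrow> 'j \<Rightarrow> complex) \<Rightarrow> ('q \<times> 'i \<Rightarrow> complex) \<Rightarrow> 'q \<times> 'j \<Rightarrow> complex" where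
  "sum_op F \<phi> = (\<lambda>(q, j). F (\<lambda>i. \<phi> (q, i)) j)"

definition linear_between ::
    "('x \<Rightarrow> complex) set \<Rightarrow> ('y \<Rightarrow> complex) set \<Rightarrow> (('x \<Rightarrow> complex) \<Rightarrow> 'y \<Rightarrow> complex) \<Rightarrow> bool" where
  "linear_between V W F \<longleftrightarrow> (\<forall>\<phi>\<in>V. F \<phi> \<in> W) \<and>
     (\<forall>\<phi>\<in>V. \<forall>\<psi>\<in>V. \<forall>c. F (\<lambda>x. \<phi> x + c * \<psi> x) = (\<lambda>y. F \<phi> y + c * F \<psi> y))"

definition sym_act :: "complex^(unit+unit)^(unit+unit) \<Rightarrow> (H list \<Rightarrow> complex) \<Rightarrow> H list \<Rightarrow> complex" where
  "sym_act a s = (\<lambda>\<alpha>s. s (map (\<lambda>\<alpha>. \<alpha> v* a) \<alpha>s))"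

definition alt_act :: "complex^('n::finite+'n)^('n+'n) \<Rightarrow> ('n E list \<Rightarrow> complex) \<Rightarrow> 'n E list \<Rightarrow> complex" where
  "alt_act b \<omega> = (\<lambda>es. \<omega> (map (\<lambda>e. matrix_inv b *v e) es))"

section \<open>The fibres of the bundles\<close>

type_synonym 'n form = "H list \<times> 'n E list \<Rightarrow> complex"
type_synonym 'n dual_form = "H list \<times> ('n E list \<times> 'n E list) \<Rightarrow> complex"
type_synonym 'n forms = "nat \<times> (H list \<times> 'n E list) \<Rightarrow> complex"
type_synonym 'n spinor = "nat \<times> (H list \<times> 'n E list) \<Rightarrow> complex"
type_synonym 'n twisted_spinor = "(nat \<times> (H list \<times> 'n E list)) \<times> H list \<Rightarrow> complex"

definition form_space :: "nat \<Rightarrow> nat \<Rightarrow> 'n::finite form set" where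
  "form_space k q = tensor_space (Sym (k + q)) (Alt q)"

definition dual_form_space :: "nat \<Rightarrow> nat \<Rightarrow> 'n::finite dual_form set" where
  "dual_form_space k q = tensor_space (Sym (k + q))
     (tensor_space (Alt (2 * CARD('n))) (Alt (2 * CARD('n) - q)))"

definition forms_space :: "nat \<Rightarrow> 'n::finite forms set" where
  "forms_space k = direct_sum {0..2 * CARD('n)} (form_space k)"

definition spinor_space :: "'n::finite spinor set" where
  "spinor_space = direct_sum {0..CARD('n)} (\<lambda>r. tensor_space (Sym (CARD('n) - r)) (Alt0 r))"

definition twisted_spinor_space :: "nat \<Rightarrow> 'n::finite twisted_spinor set" where
  "twisted_spinor_space k = tensor_space spinor_space (Sym (k + CARD('n)))"

abbreviation form_act :: "_ \<Rightarrow> _ \<Rightarrow> 'n::finite form \<Rightarrow> 'n form" where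
  "form_act a b \<equiv> tensor_op (sym_act a) (alt_act b)"

abbreviation dual_form_act :: "_ \<Rightarrow> _ \<Rightarrow> 'n::finite dual_form \<Rightarrow> 'n dual_form" where
  "dual_form_act a b \<equiv> tensor_op (sym_act a) (tensor_op (alt_act b) (alt_act b))"

abbreviation forms_act :: "_ \<Rightarrow> _ \<Rightarrow> 'n::finite forms \<Rightarrow> 'n forms" where
  "forms_act a b \<equiv> sum_op (form_act a b)"

abbreviation twisted_spinor_act :: "_ \<Rightarrow> _ \<Rightarrow> 'n::finite twisted_spinor \<Rightarrow> 'n twisted_spinor" where
  "twisted_spinor_act a b \<equiv> tensor_op (sum_op (form_act a b)) (sym_act a)"

section \<open>The isomorphism \<gamma>\<close>

text \<open>Relative to the coefficient
  \<open>(-1)\<^sup>l (k+q-l)! (k+n+l+1)! / (k+q+1)!\<close>, the isomorphism in degree \<open>q\<close> is normalised by the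
  additional constant sign \<open>(-1) ^ (q choose 2)\<close>.  The sign \<open>(-1)\<^sup>q\<close> in the symbol of \<open>\<delta>\<close> makes it
  necessary: without it, the part of \<open>\<gamma>\<^sup>-\<^sup>1 \<circ> \<delta> \<circ> \<gamma>\<close> starting in even degree \<open>q \<ge> 2\<close> is the
  negative of the corresponding part of the Clifford multiplication \<open>cliff\<close> below, as can be seen
  already for \<open>n = 1\<close>, \<open>k = 0\<close>, \<open>q = 2\<close>, \<open>r = 0\<close>.\<close>

definition gamma_coeff :: "nat \<Rightarrow> nat \<Rightarrow> nat \<Rightarrow> nat \<Rightarrow> complex" where
  "gamma_coeff n k q l = (-1) ^ (q choose 2) *
     ((-1)^l * (fact (k + q - l) * fact (k + n + l + 1) / fact (k + q + 1)))"

definition is_gamma :: "nat \<Rightarrow> (nat \<Rightarrow> 'n::finite form \<Rightarrow> 'n dual_form) \<Rightarrow> bool" where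
  "is_gamma k \<gamma> \<longleftrightarrow> (\<forall>q\<le>2 * CARD('n).
     bij_betw (\<gamma> q) (form_space k q) (dual_form_space k q) \<and>
     linear_between (form_space k q) (dual_form_space k q) (\<gamma> q) \<and>
     (\<forall>a\<in>Sp. \<forall>b\<in>Sp. \<forall>\<phi>\<in>form_space k q. \<gamma> q (form_act a b \<phi>) = dual_form_act a b (\<gamma> q \<phi>)) \<and>
     (\<forall>r l. r \<le> CARD('n) \<and> r + 2 * l = q \<and> q \<le> 2 * CARD('n) - r \<longrightarrow>
        (\<forall>\<psi>\<in>tensor_space (Sym (k + q)) (Alt0 r).
           \<gamma> q (tensor_op id (sigma_wedge_div l) \<psi>) =
             (\<lambda>x. gamma_coeff CARD('n) k q l *
                  tensor_op id (vol_tensor \<circ> sigma_wedge_div (CARD('n) - r - l)) \<psi> x))))"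

section \<open>Clifford multiplication\<close>

definition lefschetz_indices :: "nat \<Rightarrow> (nat \<times> nat) set" where
  "lefschetz_indices n = {(q, r). r \<le> n \<and> r \<le> q \<and> q \<le> 2 * n - r \<and> even (q - r)}"

text \<open>\<open>\<Oplus>\<^sub>r \<Oplus>\<^sub>q Sym (k + q) \<otimes> Alt0 r\<close>, as functions on pairs \<open>((q, r), i)\<close>, and its identification
  with \<open>forms_space k\<close>.\<close>

type_synonym 'n lefschetz_family = "(nat \<times> nat) \<times> (H list \<times> 'n E list) \<Rightarrow> complex"

definition lefschetz_space :: "nat \<Rightarrow> 'n::finite lefschetz_family set" where
  "lefschetz_space k =
     direct_sum (lefschetz_indices CARD('n)) (\<lambda>(q, r). tensor_space (Sym (k + q)) (Alt0 r))"

definition lefschetz_sum :: "'n::finite lefschetz_family \<Rightarrow> 'n forms" where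
  "lefschetz_sum \<Phi> = (\<lambda>(q, i). \<Sum>(q', r) \<in> {qr \<in> lefschetz_indices CARD('n). fst qr = q}.
     tensor_op id (sigma_wedge_div ((q - r) div 2)) (\<lambda>j. \<Phi> ((q, r), j)) i)"

definition cliff_lefschetz ::
    "nat \<Rightarrow> H \<Rightarrow> 'n::finite E \<Rightarrow> 'n lefschetz_family \<Rightarrow> 'n lefschetz_family" where
  "cliff_lefschetz k h e \<Phi> = (\<lambda>(t, i). if t \<in> lefschetz_indices CARD('n) then
     of_real (sqrt 2) * (\<Sum>(q, r) \<in> lefschetz_indices CARD('n).
       let n = CARD('n); l = (q - r) div 2; \<phi> = (\<lambda>j. \<Phi> ((q, r), j)) in
         (if t = (q + 1, r + 1)
          then 1 / of_nat (k + q + 1)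
               * tensor_op (sym_mult h) (wedge0 r (sharp e)) \<phi> i else 0)
       - (if r \<ge> 1 \<and> t = (q + 1, r - 1)
          then 1 / of_nat (k + q + 1) * (of_nat (l + 1) / of_nat (n - r + 1))
               * tensor_op (sym_mult h) (contr e) \<phi> i else 0)
       + (if q \<ge> 1 \<and> t = (q - 1, r + 1)
          then of_nat (k + n + l + 1) / of_nat (k + q + 1)
               * tensor_op (sym_contr (sharp h)) (wedge0 r (sharp e)) \<phi> i else 0)
       + (if q \<ge> 1 \<and> r \<ge> 1 \<and> t = (q - 1, r - 1)
          then of_nat (k + q - l) / of_nat (k + q + 1) * (of_nat (n - r - l + 1) / of_nat (n - r + 1))
               * tensor_op (sym_contr (sharp h)) (contr e) \<phi> i else 0))
     else 0)"

definition cliff :: "nat \<Rightarrow> H \<Rightarrow> 'n::finite E \<Rightarrow> 'n forms \<Rightarrow> 'n forms" where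
  "cliff k h e \<phi> = lefschetz_sum (cliff_lefschetz k h e (inv_into (lefschetz_space k) lefschetz_sum \<phi>))"

definition spinor_clifford :: "(H \<Rightarrow> 'n::finite E \<Rightarrow> 'n spinor \<Rightarrow> 'n spinor) \<Rightarrow> bool" where
  "spinor_clifford c \<longleftrightarrow>
     (\<forall>h e. linear_between spinor_space spinor_space (c h e)) \<and>
     (\<forall>s\<in>spinor_space. \<forall>h h' e e' z.
        c (h + z *s h') e s = (\<lambda>i. c h e s i + z * c h' e s i) \<and>
        c h (e + z *s e') s = (\<lambda>i. c h e s i + z * c h e' s i) \<and>
        (\<lambda>i. c h e (c h' e' s) i + c h' e' (c h e s) i) = (\<lambda>i. - 2 * (symp h h' * symp e e') * s i)) \<and>
     (\<forall>a\<in>Sp. \<forall>b\<in>Sp. \<forall>s\<in>spinor_space. \<forall>h e.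
        sum_op (form_act a b) (c h e s) = c (a *v h) (b *v e) (sum_op (form_act a b) s))"

text \<open>\<open>\<Psi>\<close> is an equivariant isomorphism from \<open>\<Oplus>\<^sub>q Sym (k + q) \<otimes> Alt q\<close> to \<open>S \<otimes> Sym (k + n)\<close> under
  which the Clifford multiplication \<open>c\<close> on \<open>S\<close> is given by the formula in \<open>cliff\<close>.\<close>

definition is_spinor_iso :: "nat \<Rightarrow> (H \<Rightarrow> 'n::finite E \<Rightarrow> 'n spinor \<Rightarrow> 'n spinor)
    \<Rightarrow> ('n forms \<Rightarrow> 'n twisted_spinor) \<Rightarrow> bool" where
  "is_spinor_iso k c \<Psi> \<longleftrightarrow>
     bij_betw \<Psi> (forms_space k) (twisted_spinor_space k) \<and>
     linear_between (forms_space k) (twisted_spinor_space k) \<Psi> \<and>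
     (\<forall>a\<in>Sp. \<forall>b\<in>Sp. \<forall>\<phi>\<in>forms_space k. \<Psi> (forms_act a b \<phi>) = twisted_spinor_act a b (\<Psi> \<phi>)) \<and>
     (\<forall>h e. \<forall>\<phi>\<in>forms_space k. \<Psi> (cliff k h e \<phi>) = tensor_op (c h e) id (\<Psi> \<phi>))"

section \<open>Sections and first order operators\<close>

text \<open>Sections of an associated bundle are functions on the reduced frame bundle \<open>P\<close> with values
  in the fibre.  Smoothness on \<open>P\<close> is the local existence of smooth extensions to the bundle of
  all frames, in which \<open>P\<close> is an embedded submanifold.\<close>

definition smooth_on_frames ::
    "('m, 'd::finite) chart set \<Rightarrow> ('m, 'n::finite, 'd) frame set \<Rightarrow> (('m, 'n, 'd) frame \<Rightarrow> complex) \<Rightarrow> bool" where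
  "smooth_on_frames A P f \<longleftrightarrow> (\<forall>u\<in>P. \<forall>C\<in>charts_at A (fst u).
     \<exists>W F. open W \<and> (snd C (fst u), snd u C) \<in> W \<and> smooth_on W F \<and>
       (\<forall>v\<in>P. fst v \<in> fst C \<and> (snd C (fst v), snd v C) \<in> W \<longrightarrow> F (snd C (fst v), snd v C) = f v))"

text \<open>Smooth sections of \<open>\<Oplus>\<^sub>q Sym (k + q) \<otimes> Alt q\<close>.\<close>

definition smooth_section :: "('m, 'd::finite) chart set \<Rightarrow> ('m, 'n::finite, 'd) frame set \<Rightarrow> nat
    \<Rightarrow> (('m, 'n, 'd) frame \<Rightarrow> 'n forms) \<Rightarrow> bool" where
  "smooth_section A P k f \<longleftrightarrow>
     (\<forall>u\<in>P. f u \<in> forms_space k) \<and>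
     (\<forall>u\<in>P. \<forall>a\<in>Sp. \<forall>b\<in>Sp. forms_act a b (f (frame_right a b u)) = f u) \<and>
     (\<forall>i. smooth_on_frames A P (\<lambda>u. f u i))"

text \<open>The covariant derivative at the frame \<open>u\<close> is the derivative along the horizontal lift of a
  curve through the base point.  The chart and the curve are chosen independently of the function
  to be differentiated; for smooth sections the result does not depend on these choices.\<close>

definition cov_deriv_in_chart :: "('m, 'd::finite) chart set \<Rightarrow> ('m, 'd) metric
    \<Rightarrow> (('m, 'n::finite, 'd) frame \<Rightarrow> complex) \<Rightarrow> ('m, 'n, 'd) frame \<Rightarrow> ('m, 'd) chart \<Rightarrow> real^'d \<Rightarrow> complex" where
  "cov_deriv_in_chart A g f u C w =
     (let (x, U) = (SOME (x, U). horizontal_curve g C x U \<and> x 0 = snd C (fst u) \<and> U 0 = snd u C \<and>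
                       (x has_vector_derivative w) (at 0 within {0..1}))
      in vector_derivative (\<lambda>t. f (frame_at A C (x t) (U t))) (at 0 within {0..1}))"

text \<open>\<open>nabla A g f u h e\<close> is the derivative in the direction of the complex tangent vector
  \<open>u(h \<otimes> e)\<close>.\<close>

definition nabla :: "('m, 'd::finite) chart set \<Rightarrow> ('m, 'd) metric
    \<Rightarrow> (('m, 'n::finite, 'd) frame \<Rightarrow> 'i \<Rightarrow> complex) \<Rightarrow> ('m, 'n, 'd) frame \<Rightarrow> H \<Rightarrow> 'n E \<Rightarrow> 'i \<Rightarrow> complex" where
  "nabla A g f u h e = (\<lambda>i.
     let C = (SOME C. C \<in> charts_at A (fst u)); w = frame_eval (snd u C) h e in
       cov_deriv_in_chart A g (\<lambda>v. f v i) u C (\<chi> j. Re (w $ j))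
       + \<i> * cov_deriv_in_chart A g (\<lambda>v. f v i) u C (\<chi> j. Im (w $ j)))"

text \<open>The composition of \<open>\<nabla>\<close> with a symbol \<open>s\<close>, i.e. the sum over the dual bases of \<open>H\<close> and \<open>E\<close>.\<close>

definition first_order_op :: "('m, 'd::finite) chart set \<Rightarrow> ('m, 'd) metric
    \<Rightarrow> (H \<Rightarrow> 'n::finite E \<Rightarrow> ('i \<Rightarrow> complex) \<Rightarrow> 'j \<Rightarrow> complex)
    \<Rightarrow> (('m, 'n, 'd) frame \<Rightarrow> 'i \<Rightarrow> complex) \<Rightarrow> ('m, 'n, 'd) frame \<Rightarrow> 'j \<Rightarrow> complex" where
  "first_order_op A g s f u = (\<lambda>j. \<Sum>B\<in>UNIV. \<Sum>b\<in>UNIV.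
     s (axis B 1) (axis b 1) (nabla A g f u (axis B 1) (axis b 1)) j)"

definition symbol_d :: "nat \<Rightarrow> nat \<Rightarrow> H \<Rightarrow> 'n::finite E \<Rightarrow> 'n form \<Rightarrow> 'n form" where
  "symbol_d k q \<alpha> \<eta> \<phi> = (\<lambda>i. 1 / of_nat (k + q + 1) * tensor_op (sym_mult (flat \<alpha>)) (wedge \<eta>) \<phi> i)"

definition symbol_delta :: "nat \<Rightarrow> H \<Rightarrow> 'n::finite E \<Rightarrow> 'n dual_form \<Rightarrow> 'n dual_form" where
  "symbol_delta q \<alpha> \<eta> \<phi> = (\<lambda>i. (-1)^q * tensor_op (sym_contr \<alpha>) (tensor_op id (wedge \<eta>)) \<phi> i)"

definition degree_part :: "nat \<Rightarrow> 'n::finite forms \<Rightarrow> 'n form" where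
  "degree_part q \<phi> = (\<lambda>i. \<phi> (q, i))"

definition D_op :: "('m, 'd::finite) chart set \<Rightarrow> ('m, 'd) metric \<Rightarrow> nat
    \<Rightarrow> (nat \<Rightarrow> 'n::finite form \<Rightarrow> 'n dual_form)
    \<Rightarrow> (('m, 'n, 'd) frame \<Rightarrow> 'n forms) \<Rightarrow> ('m, 'n, 'd) frame \<Rightarrow> 'n forms" where
  \<comment> \<open>\<open>sqrt 2 (d + \<gamma>\<^sup>-\<^sup>1 \<circ> \<delta> \<circ> \<gamma>)\<close>, by the degree of the result\<close>
  "D_op A g k \<gamma> f u = (\<lambda>(q, i). of_real (sqrt 2) *
     ((if 1 \<le> q \<and> q \<le> 2 * CARD('n)
       then first_order_op A g (symbol_d k (q - 1)) (\<lambda>v. degree_part (q - 1) (f v)) u i else 0)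
    + (if q + 1 \<le> 2 * CARD('n)
       then inv_into (form_space k q) (\<gamma> q)
              (first_order_op A g (symbol_delta (q + 1)) (\<lambda>v. \<gamma> (q + 1) (degree_part (q + 1) (f v))) u) i
       else 0)))"

text \<open>The cotangent vector \<open>\<alpha> \<otimes> \<eta>\<close> corresponds to the tangent vector \<open>flat \<alpha> \<otimes> flat \<eta>\<close>.\<close>

definition dirac_op :: "('m, 'd::finite) chart set \<Rightarrow> ('m, 'd) metric \<Rightarrow> nat
    \<Rightarrow> (('m, 'n::finite, 'd) frame \<Rightarrow> 'n forms) \<Rightarrow> ('m, 'n, 'd) frame \<Rightarrow> 'n forms" where
  "dirac_op A g k = first_order_op A g (\<lambda>\<alpha> \<eta>. cliff k (flat \<alpha>) (flat \<eta>))"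

definition twisted_dirac_op :: "('m, 'd::finite) chart set \<Rightarrow> ('m, 'd) metric
    \<Rightarrow> (H \<Rightarrow> 'n::finite E \<Rightarrow> 'n spinor \<Rightarrow> 'n spinor)
    \<Rightarrow> (('m, 'n, 'd) frame \<Rightarrow> 'n twisted_spinor) \<Rightarrow> ('m, 'n, 'd) frame \<Rightarrow> 'n twisted_spinor" where
  "twisted_dirac_op A g c = first_order_op A g (\<lambda>\<alpha> \<eta>. tensor_op (c (flat \<alpha>) (flat \<eta>)) id)"

end

theory Submission
  imports Defs "HOL-Library.Function_Algebras"
begin

text \<open>Both operators are \<open>\<nabla>\<close> followed by a symbol, so the claim reduces to an identity of symbols on the
  fibres, once \<open>\<nabla>\<close> is known to preserve the fibres and to commute with fibrewise linear maps such as
  \<open>\<gamma>\<close>.  For the latter one needs a horizontal curve in every direction, which exists by Picard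
  iteration and stays in the reduced frame bundle.

  The symbol identity is checked on the summands of the Lefschetz decomposition.  With
  \<open>\<eta> = e\<^sup>#\<close> and \<open>\<psi>\<close> trace-free of degree \<open>r\<close>, the commutator of \<open>\<eta>\<and>\<close> with the contraction by \<open>\<sigma>\<^sub>E\<close>
  gives \<open>\<eta>\<and>\<psi> = \<eta>\<and>\<^sub>\<circ>\<psi> - 1/(n-r+1) \<sigma>\<^sub>E\<and>(e\<lrcorner>\<psi>)\<close>.  Multiplying by \<open>\<sigma>\<^sub>E\<^sup>l/l!\<close> yields the two terms of
  Clifford multiplication which raise \<open>q\<close>; multiplying by \<open>\<sigma>\<^sub>E\<^sup>m/m!\<close> with \<open>m = n-r-l\<close> and
  conjugating by \<open>\<gamma>\<close> yields the two terms which lower \<open>q\<close>.  The Lefschetz decomposition itself is a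
  statement about finite dimensional sl(2)-modules.\<close>

section \<open>Function spaces\<close>

text \<open>A tensor product is encoded as functions lying in each factor separately, and an
  operator acts on one variable slice by slice. The result is in the tensor product only if each
  value of the operator is a finite combination of values of its argument. Operators given by
  formulas have this property on all functions; for operators that are meaningful only on a fibre it
  comes from the fibre being determined by finitely many values. The same finiteness lets \<nabla>
  commute with fibrewise linear maps, since the curve that defines \<nabla> is chosen before the
  section. The coefficient G(q,l) of \<gamma> is dictated by \<delta>. Wedging with \<eta> keeps m =
  n-r-l for the target (q-1,r+1), which has l-1, and raises it to m+1 for (q-1,r-1), which has l.
  The Clifford coefficients therefore require (-1)^q G(q,l)/G(q-1,l-1) = (k+n+l+1)/(k+q+1) and
  -(-1)^q G(q,l)/G(q-1,l) = (k+q-l)/(k+q+1); the remaining factor (n-r-l+1)/(n-r+1) is the trace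
  correction. The factorials solve these recurrences up to sign, (-1)^l accounts for the relative
  sign, and (-1)^(q choose 2) absorbs (-1)^q.\<close>

definition function_subspace :: "('x \<Rightarrow> complex) set \<Rightarrow> bool" where
  "function_subspace V \<longleftrightarrow> (\<lambda>_. 0) \<in> V \<and> (\<forall>\<phi>\<in>V. \<forall>\<psi>\<in>V. \<forall>c. (\<lambda>x. \<phi> x + c * \<psi> x) \<in> V)"

definition finitely_determined :: "('x \<Rightarrow> complex) set \<Rightarrow> bool" where
  "finitely_determined V \<longleftrightarrow> (\<exists>Z. finite Z \<and> (\<forall>\<phi>\<in>V. (\<forall>z\<in>Z. \<phi> z = 0) \<longrightarrow> \<phi> = (\<lambda>_. 0)))"

lemma function_subspaceI:
  assumes "(\<lambda>_. 0) \<in> V" "\<And>\<phi> \<psi> c. \<phi> \<in> V \<Longrightarrow> \<psi> \<in> V \<Longrightarrow> (\<lambda>x. \<phi> x + c * \<psi> x) \<in> V"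
  shows "function_subspace V"
  using assms by (auto simp: function_subspace_def)

lemma function_subspace_0: "function_subspace V \<Longrightarrow> (\<lambda>_. 0) \<in> V"
  and function_subspace_combination:
    "function_subspace V \<Longrightarrow> \<phi> \<in> V \<Longrightarrow> \<psi> \<in> V \<Longrightarrow> (\<lambda>x. \<phi> x + c * \<psi> x) \<in> V"
  by (auto simp: function_subspace_def)

lemma function_subspace_scale:
  assumes "function_subspace V" "\<psi> \<in> V"
  shows "(\<lambda>x. c * \<psi> x) \<in> V"
  using function_subspace_combination[OF assms(1) function_subspace_0[OF assms(1)] assms(2)] by simp

lemma function_subspace_add:
  assumes "function_subspace V" "\<phi> \<in> V" "\<psi> \<in> V"
  shows "(\<lambda>x. \<phi> x + \<psi> x) \<in> V"
  using function_subspace_combination[OF assms, of 1] by simp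

lemma function_subspace_diff:
  assumes "function_subspace V" "\<phi> \<in> V" "\<psi> \<in> V"
  shows "(\<lambda>x. \<phi> x - \<psi> x) \<in> V"
  using function_subspace_combination[OF assms, of "-1"] by simp

lemma function_subspace_sum:
  assumes "function_subspace V" "\<And>i. i \<in> I \<Longrightarrow> \<phi> i \<in> V"
  shows "(\<lambda>x. \<Sum>i\<in>I. c i * \<phi> i x) \<in> V"
proof (cases "finite I")
  case True
  then show ?thesis using assms(2)
  proof (induction I rule: finite_induct)
    case empty
    then show ?case using function_subspace_0[OF assms(1)] by simp
  next
    case (insert i I)
    then have "(\<lambda>x. (\<Sum>i\<in>I. c i * \<phi> i x) + c i * \<phi> i x) \<in> V"
      by (intro function_subspace_combination[OF assms(1)]) auto
    with insert show ?case by (simp add: add.commute)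
  qed
next
  case False
  then show ?thesis using function_subspace_0[OF assms(1)] by simp
qed

lemma function_subspace_sum_plain:
  assumes "function_subspace V" "\<And>i. i \<in> I \<Longrightarrow> \<phi> i \<in> V"
  shows "(\<lambda>x. \<Sum>i\<in>I. \<phi> i x) \<in> V"
  using function_subspace_sum[OF assms, where c = "\<lambda>_. 1"] by simp

section \<open>Linear maps between subspaces of functions\<close>

lemma linear_betweenD:
  assumes "linear_between V W F"
  shows "\<phi> \<in> V \<Longrightarrow> F \<phi> \<in> W"
    and "\<phi> \<in> V \<Longrightarrow> \<psi> \<in> V \<Longrightarrow> F (\<lambda>x. \<phi> x + c * \<psi> x) = (\<lambda>y. F \<phi> y + c * F \<psi> y)"
  using assms by (auto simp: linear_between_def)

lemma linear_between_0:
  assumes "linear_between V W F" "function_subspace V"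
  shows "F (\<lambda>_. 0) = (\<lambda>_. 0)"
  using linear_betweenD(2)[OF assms(1) function_subspace_0[OF assms(2)] function_subspace_0[OF assms(2)], of "-1"]
  by simp

lemma linear_between_scale:
  assumes "linear_between V W F" "function_subspace V" "\<psi> \<in> V"
  shows "F (\<lambda>x. c * \<psi> x) = (\<lambda>y. c * F \<psi> y)"
  using linear_betweenD(2)[OF assms(1) function_subspace_0[OF assms(2)] assms(3), of c]
    linear_between_0[OF assms(1,2)] by simp

lemma linear_between_sum:
  assumes "linear_between V W F" "function_subspace V" "finite I" "\<And>i. i \<in> I \<Longrightarrow> \<phi> i \<in> V"
  shows "F (\<lambda>x. \<Sum>i\<in>I. c i * \<phi> i x) = (\<lambda>y. \<Sum>i\<in>I. c i * F (\<phi> i) y)"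
  using assms(3,4)
proof (induction I rule: finite_induct)
  case empty
  then show ?case using linear_between_0[OF assms(1,2)] by simp
next
  case (insert i I)
  have "F (\<lambda>x. (\<Sum>i\<in>I. c i * \<phi> i x) + c i * \<phi> i x) = (\<lambda>y. F (\<lambda>x. \<Sum>i\<in>I. c i * \<phi> i x) y + c i * F (\<phi> i) y)"
    using insert by (intro linear_betweenD(2)[OF assms(1)] function_subspace_sum[OF assms(2)]) auto
  with insert show ?case by (simp add: add.commute)
qed

lemma linear_between_sum_plain:
  assumes "linear_between V W F" "function_subspace V" "finite I" "\<And>i. i \<in> I \<Longrightarrow> \<phi> i \<in> V"
  shows "F (\<lambda>x. \<Sum>i\<in>I. \<phi> i x) = (\<lambda>y. \<Sum>i\<in>I. F (\<phi> i) y)"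
  using linear_between_sum[OF assms, where c = "\<lambda>_. 1"] by simp

lemma linear_between_inv_into:
  assumes "linear_between V W F" "function_subspace V" "bij_betw F V W"
  shows "linear_between W V (inv_into V F)"
proof -
  have *: "inv_into V F \<phi> \<in> V" "F (inv_into V F \<phi>) = \<phi>" if "\<phi> \<in> W" for \<phi>
    using that bij_betw_imp_surj_on[OF assms(3)] by (metis inv_into_into, metis f_inv_into_f)
  show ?thesis unfolding linear_between_def
  proof (intro conjI ballI allI)
    fix \<phi> \<psi> c assume W: "\<phi> \<in> W" "\<psi> \<in> W"
    let ?x = "\<lambda>x. inv_into V F \<phi> x + c * inv_into V F \<psi> x"
    have mem: "?x \<in> V" using W * by (intro function_subspace_combination[OF assms(2)]) auto
    have eq: "F ?x = (\<lambda>x. \<phi> x + c * \<psi> x)"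
      using linear_betweenD(2)[OF assms(1) *(1)[OF W(1)] *(1)[OF W(2)]] W * by simp
    show "inv_into V F (\<lambda>x. \<phi> x + c * \<psi> x) = ?x"
      using inv_into_f_f[OF bij_betw_imp_inj_on[OF assms(3)] mem] by (simp only: eq)
  qed (use * in auto)
qed

text \<open>Gaussian elimination, one evaluation point at a time: the elements vanishing at the new
  point form a subspace covered by the induction hypothesis. If some element does not vanish there,
  its normalised remainder is the new vector; otherwise the new vector is 0. The coefficients of the
  expansion are the values themselves, so it is linear in \<phi>.\<close>

lemma dual_basis_of_evaluations:
  assumes "finite Z" "function_subspace V" "\<And>\<phi>. \<phi> \<in> V \<Longrightarrow> (\<forall>z\<in>Z. \<phi> z = 0) \<Longrightarrow> \<phi> = (\<lambda>_. 0)"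
  shows "\<exists>b. (\<forall>z\<in>Z. b z \<in> V) \<and> (\<forall>\<phi>\<in>V. \<phi> = (\<lambda>x. \<Sum>z\<in>Z. \<phi> z * b z x))"
  using assms
proof (induction Z arbitrary: V rule: finite_induct)
  case empty
  then show ?case by auto
next
  case (insert z0 Z)
  let ?V = "{\<phi>\<in>V. \<phi> z0 = 0}"
  have "function_subspace ?V"
    using insert.prems(1) by (auto simp: function_subspace_def)
  then have "\<exists>b. (\<forall>z\<in>Z. b z \<in> ?V) \<and> (\<forall>\<phi>\<in>?V. \<phi> = (\<lambda>x. \<Sum>z\<in>Z. \<phi> z * b z x))"
    by (rule insert.IH) (use insert.prems(2) in auto)
  then obtain b where b: "\<And>z. z \<in> Z \<Longrightarrow> b z \<in> V"
      "\<And>\<phi>. \<phi> \<in> V \<Longrightarrow> \<phi> z0 = 0 \<Longrightarrow> \<phi> = (\<lambda>x. \<Sum>z\<in>Z. \<phi> z * b z x)" by auto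
  have if_sum: "(\<Sum>z\<in>Z. \<phi> z * (if z = z0 then c else b z) x) = (\<Sum>z\<in>Z. \<phi> z * b z x)" for c \<phi> x
    using insert(2) by (intro sum.cong) auto
  show ?case
  proof (cases "\<exists>\<phi>\<in>V. \<phi> z0 \<noteq> 0")
    case False
    have "\<phi> = (\<lambda>x. \<Sum>z\<in>insert z0 Z. \<phi> z * (if z = z0 then (\<lambda>_. 0) else b z) x)" if "\<phi> \<in> V" for \<phi>
      using b(2)[OF that] False that insert(1,2) by (simp add: if_sum)
    then show ?thesis using b(1) function_subspace_0[OF insert.prems(1)]
      by (intro exI[of _ "\<lambda>z. if z = z0 then (\<lambda>_. 0) else b z"]) auto
  next
    case True
    then obtain \<phi>0 where \<phi>0: "\<phi>0 \<in> V" "\<phi>0 z0 \<noteq> 0" by auto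
    define b0 where "b0 x = inverse (\<phi>0 z0) * (\<phi>0 x - (\<Sum>z\<in>Z. \<phi>0 z * b z x))" for x
    have "b0 \<in> V"
      unfolding b0_def using insert.prems(1) \<phi>0 b(1)
      by (intro function_subspace_scale function_subspace_diff function_subspace_sum) auto
    moreover have "\<phi> = (\<lambda>x. \<Sum>z\<in>insert z0 Z. \<phi> z * (if z = z0 then b0 else b z) x)" if "\<phi> \<in> V" for \<phi>
    proof
      fix x
      \<comment> \<open>Adding this multiple of \<phi>0 makes the value at z0 vanish, so the
        induction hypothesis expands the combination.\<close>
      define c where "c = - (\<phi> z0 / \<phi>0 z0)"
      let ?\<psi> = "\<lambda>x. \<phi> x + c * \<phi>0 x"
      have "?\<psi> \<in> V" using function_subspace_combination[OF insert.prems(1) that \<phi>0(1)] .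
      then have "?\<psi> = (\<lambda>x. \<Sum>z\<in>Z. ?\<psi> z * b z x)" by (rule b(2)) (simp add: c_def \<phi>0(2))
      from fun_cong[OF this, of x]
      have "\<phi> x + c * \<phi>0 x = (\<Sum>z\<in>Z. \<phi> z * b z x) + c * (\<Sum>z\<in>Z. \<phi>0 z * b z x)"
        by (simp add: distrib_right sum.distrib mult.assoc flip: sum_distrib_left)
      then have "\<phi> x = (\<Sum>z\<in>Z. \<phi> z * b z x) - c * (\<phi>0 x - (\<Sum>z\<in>Z. \<phi>0 z * b z x))"
        by (simp add: algebra_simps)
      also have "- c * (\<phi>0 x - (\<Sum>z\<in>Z. \<phi>0 z * b z x)) = \<phi> z0 * b0 x"
        by (simp add: b0_def c_def divide_inverse mult.assoc)
      then have "(\<Sum>z\<in>Z. \<phi> z * b z x) - c * (\<phi>0 x - (\<Sum>z\<in>Z. \<phi>0 z * b z x)) = (\<Sum>z\<in>Z. \<phi> z * b z x) + \<phi> z0 * b0 x"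
        by simp
      finally show "\<phi> x = (\<Sum>z\<in>insert z0 Z. \<phi> z * (if z = z0 then b0 else b z) x)"
        using insert(1,2) by (simp add: if_sum add.commute)
    qed
    ultimately show ?thesis using b(1)
      by (intro exI[of _ "\<lambda>z. if z = z0 then b0 else b z"]) auto
  qed
qed

lemma finitely_determined_basis:
  assumes "function_subspace V" "finitely_determined V"
  obtains Z b where "finite Z" "\<And>z. z \<in> Z \<Longrightarrow> b z \<in> V" "\<And>\<phi>. \<phi> \<in> V \<Longrightarrow> \<phi> = (\<lambda>x. \<Sum>z\<in>Z. \<phi> z * b z x)"
proof -
  obtain Z where Z: "finite Z" "\<And>\<phi>. \<phi> \<in> V \<Longrightarrow> (\<forall>z\<in>Z. \<phi> z = 0) \<Longrightarrow> \<phi> = (\<lambda>_. 0)"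
    using assms(2) unfolding finitely_determined_def by metis
  from dual_basis_of_evaluations[OF Z(1) assms(1) Z(2)]
  obtain b where "\<forall>z\<in>Z. b z \<in> V" "\<forall>\<phi>\<in>V. \<phi> = (\<lambda>x. \<Sum>z\<in>Z. \<phi> z * b z x)" by blast
  then show thesis using that[OF Z(1)] by blast
qed

text \<open>The matrix of F: its entries are the values of F on the vectors dual to the evaluations.
  The point set Z depends neither on the argument nor on the place of evaluation.\<close>

lemma linear_between_expansion:
  assumes "linear_between V W F" "function_subspace V" "finitely_determined V"
  shows "\<exists>Z a. finite Z \<and> (\<forall>\<phi>\<in>V. \<forall>y. F \<phi> y = (\<Sum>z\<in>Z. a y z * \<phi> z))"
proof -
  obtain Z b where Z: "finite Z" "\<And>z. z \<in> Z \<Longrightarrow> b z \<in> V" "\<And>\<phi>. \<phi> \<in> V \<Longrightarrow> \<phi> = (\<lambda>x. \<Sum>z\<in>Z. \<phi> z * b z x)"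
    using finitely_determined_basis[OF assms(2,3)] by blast
  have *: "F \<phi> y = (\<Sum>z\<in>Z. F (b z) y * \<phi> z)" if "\<phi> \<in> V" for \<phi> y
  proof -
    have "F \<phi> = F (\<lambda>x. \<Sum>z\<in>Z. \<phi> z * b z x)" by (rule arg_cong[OF Z(3)[OF that]])
    also have "\<dots> = (\<lambda>y. \<Sum>z\<in>Z. \<phi> z * F (b z) y)" by (rule linear_between_sum[OF assms(1,2) Z(1,2)])
    finally have "F \<phi> y = (\<Sum>z\<in>Z. \<phi> z * F (b z) y)" by (rule fun_cong)
    also have "\<dots> = (\<Sum>z\<in>Z. F (b z) y * \<phi> z)" by (intro sum.cong refl mult.commute)
    finally show ?thesis .
  qed
  show ?thesis
  proof (intro exI conjI ballI allI)
    show "F \<phi> y = (\<Sum>z\<in>Z. F (b z) y * \<phi> z)" if "\<phi> \<in> V" for \<phi> y by (rule *[OF that])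
  qed (rule Z(1))
qed

lemma finitely_determined_mono: "finitely_determined W \<Longrightarrow> V \<subseteq> W \<Longrightarrow> finitely_determined V"
  unfolding finitely_determined_def by blast

lemma function_subspace_tensor_space:
  assumes "function_subspace V" "function_subspace W"
  shows "function_subspace (tensor_space V W)"
  using assms by (auto simp: function_subspace_def tensor_space_def)

lemma finitely_determined_tensor_space:
  assumes "finitely_determined V" "finitely_determined W"
  shows "finitely_determined (tensor_space V W)"
proof -
  obtain Y where Y: "finite Y" "\<And>\<phi>. \<phi> \<in> V \<Longrightarrow> (\<forall>z\<in>Y. \<phi> z = 0) \<Longrightarrow> \<phi> = (\<lambda>_. 0)"
    using assms(1) unfolding finitely_determined_def by metis
  obtain Z where Z: "finite Z" "\<And>\<phi>. \<phi> \<in> W \<Longrightarrow> (\<forall>z\<in>Z. \<phi> z = 0) \<Longrightarrow> \<phi> = (\<lambda>_. 0)"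
    using assms(2) unfolding finitely_determined_def by metis
  have "\<phi> = (\<lambda>_. 0)" if "\<phi> \<in> tensor_space V W" "\<forall>z\<in>Y \<times> Z. \<phi> z = 0" for \<phi>
  proof -
    have V: "(\<lambda>x. \<phi> (x, y)) \<in> V" and W: "(\<lambda>y. \<phi> (x, y)) \<in> W" for x y
      using that(1) by (auto simp: tensor_space_def)
    have "\<phi> (x, y) = 0" if "x \<in> Y" for x y
      using Z(2)[OF W[of x]] that \<open>\<forall>z\<in>Y \<times> Z. \<phi> z = 0\<close> by (metis SigmaI)
    then have "\<phi> (x, y) = 0" for x y
      using Y(2)[OF V[of y]] by metis
    then show ?thesis by (auto intro!: ext)
  qed
  with Y(1) Z(1) show ?thesis unfolding finitely_determined_def
    by (intro exI[of _ "Y \<times> Z"]) auto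
qed

lemma function_subspace_direct_sum:
  assumes "\<And>q. q \<in> I \<Longrightarrow> function_subspace (V q)"
  shows "function_subspace (direct_sum I V)"
proof (rule function_subspaceI)
  show "(\<lambda>_. 0) \<in> direct_sum I V"
    using function_subspace_0[OF assms] by (simp add: direct_sum_def)
next
  fix \<phi> \<psi> :: "'a \<times> 'b \<Rightarrow> complex" and c assume *: "\<phi> \<in> direct_sum I V" "\<psi> \<in> direct_sum I V"
  have "(\<lambda>i. \<phi> (q, i) + c * \<psi> (q, i)) \<in> (if q \<in> I then V q else {\<lambda>_. 0})" for q
  proof (cases "q \<in> I")
    case True
    then have "(\<lambda>i. \<phi> (q, i)) \<in> V q" "(\<lambda>i. \<psi> (q, i)) \<in> V q"
      using * by (auto simp: direct_sum_def dest: spec[of _ q])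
    with True show ?thesis by (simp add: function_subspace_combination[OF assms])
  next
    case False
    then have "(\<lambda>i. \<phi> (q, i)) = (\<lambda>_. 0)" "(\<lambda>i. \<psi> (q, i)) = (\<lambda>_. 0)"
      using * by (auto simp: direct_sum_def dest: spec[of _ q])
    then have "\<phi> (q, i) + c * \<psi> (q, i) = 0" for i by (metis add.right_neutral mult_zero_right)
    with False show ?thesis by simp
  qed
  then show "(\<lambda>x. \<phi> x + c * \<psi> x) \<in> direct_sum I V" by (simp add: direct_sum_def)
qed

lemma finitely_determined_direct_sum:
  assumes "finite I" "\<And>q. q \<in> I \<Longrightarrow> finitely_determined (V q)"
  shows "finitely_determined (direct_sum I V)"
proof -
  obtain Z where Z: "\<And>q. q \<in> I \<Longrightarrow> finite (Z q)"
      "\<And>q \<phi>. q \<in> I \<Longrightarrow> \<phi> \<in> V q \<Longrightarrow> (\<forall>z\<in>Z q. \<phi> z = 0) \<Longrightarrow> \<phi> = (\<lambda>_. 0)"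
    using assms(2) unfolding finitely_determined_def by metis
  have "\<phi> = (\<lambda>_. 0)" if "\<phi> \<in> direct_sum I V" "\<forall>z\<in>Sigma I Z. \<phi> z = 0" for \<phi>
  proof -
    have "\<phi> (q, i) = 0" for q i
    proof (cases "q \<in> I")
      case True
      then have "(\<lambda>i. \<phi> (q, i)) \<in> V q" using that(1) by (auto simp: direct_sum_def dest: spec[of _ q])
      then have "(\<lambda>i. \<phi> (q, i)) = (\<lambda>_. 0)" using Z(2) True that(2) by (metis SigmaI)
      then show ?thesis by metis
    next
      case False
      then have "(\<lambda>i. \<phi> (q, i)) = (\<lambda>_. 0)" using that(1) by (auto simp: direct_sum_def dest: spec[of _ q])
      then show ?thesis by metis
    qed
    then show ?thesis by (auto intro!: ext)
  qed
  with assms(1) Z(1) show ?thesis unfolding finitely_determined_def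
    by (intro exI[of _ "Sigma I Z"]) auto
qed

lemma tensor_op_id_eq: "tensor_op id F \<phi> = (\<lambda>(x, y). F (\<lambda>y. \<phi> (x, y)) y)"
  by (simp add: tensor_op_def)

text \<open>In the second variable each slice is a value of F. In the first variable the matrix of F
  writes the result as a fixed finite combination of slices of \<phi>, and these stay in the
  subspace S.\<close>

lemma tensor_op_id_in:
  assumes S: "function_subspace S" and V: "function_subspace V" "finitely_determined V"
    and F: "linear_between V W F" and \<phi>: "\<phi> \<in> tensor_space S V"
  shows "tensor_op id F \<phi> \<in> tensor_space S W"
proof -
  obtain Z a where Z: "finite Z" "\<And>\<phi> y. \<phi> \<in> V \<Longrightarrow> F \<phi> y = (\<Sum>z\<in>Z. a y z * \<phi> z)"
    using linear_between_expansion[OF F V] by blast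
  have \<phi>V: "(\<lambda>y. \<phi> (x, y)) \<in> V" and \<phi>S: "(\<lambda>x. \<phi> (x, y)) \<in> S" for x y
    using \<phi> by (auto simp: tensor_space_def)
  have "(\<lambda>x. F (\<lambda>y. \<phi> (x, y)) y') \<in> S" for y'
    using \<phi>S by (subst Z(2)[OF \<phi>V]) (rule function_subspace_sum[OF S])
  then show ?thesis
    using linear_betweenD(1)[OF F \<phi>V] by (simp add: tensor_space_def tensor_op_id_eq)
qed

lemma linear_between_tensor_op_id:
  assumes S: "function_subspace S" and V: "function_subspace V" "finitely_determined V"
    and F: "linear_between V W F"
  shows "linear_between (tensor_space S V) (tensor_space S W) (tensor_op id F)"
  unfolding linear_between_def
proof (intro conjI ballI allI)
  fix \<phi> \<psi> c assume "\<phi> \<in> tensor_space S V" "\<psi> \<in> tensor_space S V"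
  then have "(\<lambda>y. \<phi> (x, y)) \<in> V" "(\<lambda>y. \<psi> (x, y)) \<in> V" for x
    by (auto simp: tensor_space_def)
  then show "tensor_op id F (\<lambda>x. \<phi> x + c * \<psi> x) = (\<lambda>y. tensor_op id F \<phi> y + c * tensor_op id F \<psi> y)"
    by (simp add: tensor_op_id_eq linear_betweenD(2)[OF F] fun_eq_iff)
qed (use tensor_op_id_in[OF assms] in auto)

lemma bij_betw_tensor_op_id:
  assumes S: "function_subspace S" and V: "function_subspace V" "finitely_determined V"
    and W: "function_subspace W" "finitely_determined W"
    and F: "linear_between V W F" "bij_betw F V W"
  shows "bij_betw (tensor_op id F) (tensor_space S V) (tensor_space S W)"
proof (rule bij_betw_byWitness[where f' = "tensor_op id (inv_into V F)"])
  have G: "linear_between W V (inv_into V F)" by (rule linear_between_inv_into[OF F(1) V(1) F(2)])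
  show "tensor_op id F ` tensor_space S V \<subseteq> tensor_space S W"
    using tensor_op_id_in[OF S V F(1)] by auto
  show "tensor_op id (inv_into V F) ` tensor_space S W \<subseteq> tensor_space S V"
    using tensor_op_id_in[OF S W G] by auto
  show "\<forall>\<phi>\<in>tensor_space S V. tensor_op id (inv_into V F) (tensor_op id F \<phi>) = \<phi>"
    using bij_betw_inv_into_left[OF F(2)]
    by (auto simp: tensor_op_id_eq tensor_space_def fun_eq_iff)
  show "\<forall>\<phi>\<in>tensor_space S W. tensor_op id F (tensor_op id (inv_into V F) \<phi>) = \<phi>"
    using bij_betw_inv_into_right[OF F(2)]
    by (auto simp: tensor_op_id_eq tensor_space_def fun_eq_iff)
qed

section \<open>Symmetric and alternating multilinear forms\<close>

lemma multilinear_0: "multilinear 0 = {s. \<forall>xs. xs \<noteq> [] \<longrightarrow> s xs = 0}"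
proof (intro set_eqI iffI)
  fix s :: "(complex^'a) list \<Rightarrow> complex"
  assume s: "s \<in> {s. \<forall>xs. xs \<noteq> [] \<longrightarrow> s xs = 0}"
  then have "s (xs[i := v]) = 0" if "i < length xs" for xs i v
    using that by (cases xs) (auto split: nat.split)
  with s show "s \<in> multilinear 0" by (simp add: multilinear_def)
qed (simp add: multilinear_def)

text \<open>Trades conditions at every position for conditions at the head and an inductive
  condition on the tail, which opens the way to induction on the degree.\<close>

lemma multilinear_Suc_iff:
  "s \<in> multilinear (Suc m) \<longleftrightarrow> s [] = 0 \<and> (\<forall>v. (\<lambda>xs. s (v # xs)) \<in> multilinear m) \<and>
     (\<forall>v w xs. s ((v + w) # xs) = s (v # xs) + s (w # xs)) \<and>
     (\<forall>c v xs. s ((c *s v) # xs) = c * s (v # xs))" (is "_ \<longleftrightarrow> ?R")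
proof
  assume s: "s \<in> multilinear (Suc m)"
  then have len: "\<And>xs. length xs \<noteq> Suc m \<Longrightarrow> s xs = 0"
    and add: "\<And>xs i v w. i < length xs \<Longrightarrow> s (xs[i := v + w]) = s (xs[i := v]) + s (xs[i := w])"
    and scale: "\<And>xs i c v. i < length xs \<Longrightarrow> s (xs[i := c *s v]) = c * s (xs[i := v])"
    by (auto simp: multilinear_def)
  have "s ((v + w) # xs) = s (v # xs) + s (w # xs)" for v w xs
    using add[of 0 "v # xs" v w] by simp
  moreover have "s ((c *s v) # xs) = c * s (v # xs)" for c v xs
    using scale[of 0 "v # xs" c v] by simp
  moreover have "(\<lambda>xs. s (v # xs)) \<in> multilinear m" for v
    using len[of "v # _"] add[of "Suc _" "v # _"] scale[of "Suc _" "v # _"]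
    by (auto simp: multilinear_def)
  ultimately show ?R using len by auto
next
  assume R: ?R
  then have s: "(\<lambda>xs. s (v # xs)) \<in> multilinear m" for v by blast
  show "s \<in> multilinear (Suc m)"
    unfolding multilinear_def
  proof (intro CollectI conjI allI impI)
    fix xs :: "(complex^'a) list" assume "length xs \<noteq> Suc m"
    then show "s xs = 0" using R s by (cases xs) (auto simp: multilinear_def)
  next
    fix xs :: "(complex^'a) list" and i v w assume "i < length xs"
    then show "s (xs[i := v + w]) = s (xs[i := v]) + s (xs[i := w])"
      using R s by (cases xs; cases i) (auto simp: multilinear_def)
  next
    fix xs :: "(complex^'a) list" and i c v assume "i < length xs"
    then show "s (xs[i := c *s v]) = c * s (xs[i := v])"
      using R s by (cases xs; cases i) (auto simp: multilinear_def)
  qed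
qed

lemma multilinear_ConsD:
  assumes "s \<in> multilinear m"
  shows "s ((v + w) # xs) = s (v # xs) + s (w # xs)" "s ((c *s v) # xs) = c * s (v # xs)"
    "s ((- v) # xs) = - s (v # xs)" "s ((\<Sum>i\<in>I. g i *s f i) # xs) = (\<Sum>i\<in>I. g i * s (f i # xs))"
    "s (0 # xs) = 0"
proof -
  have l: "s ((v + w) # xs) = s (v # xs) + s (w # xs)" "s ((c *s v) # xs) = c * s (v # xs)" for v w c
    using assms by (cases m; simp add: multilinear_0 multilinear_Suc_iff)+
  show "s ((v + w) # xs) = s (v # xs) + s (w # xs)" "s ((c *s v) # xs) = c * s (v # xs)"
    using l by auto
  show "s ((- v) # xs) = - s (v # xs)" using l(2)[of "-1" v] by simp
  show 0: "s (0 # xs) = 0" using l(2)[of 0 v] by simp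
  show "s ((\<Sum>i\<in>I. g i *s f i) # xs) = (\<Sum>i\<in>I. g i * s (f i # xs))"
    by (induction I rule: infinite_finite_induct) (auto simp: 0 l)
qed

lemma vec_basis_expansion: "v = (\<Sum>a\<in>UNIV. v $ a *s axis a (1::complex))"
  by (simp add: basis_expansion)

lemma multilinear_basis_Cons:
  assumes "s \<in> multilinear m"
  shows "s (v # xs) = (\<Sum>a\<in>UNIV. v $ a * s (axis a 1 # xs))"
  by (subst vec_basis_expansion) (rule multilinear_ConsD(4)[OF assms])

lemma function_subspace_multilinear: "function_subspace (multilinear m)"
proof (rule function_subspaceI)
  fix \<phi> \<psi> :: "(complex^'a) list \<Rightarrow> complex" and c assume "\<phi> \<in> multilinear m" "\<psi> \<in> multilinear m"
  then show "(\<lambda>x. \<phi> x + c * \<psi> x) \<in> multilinear m"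
    unfolding multilinear_def by (simp add: distrib_left mult.left_commute)
qed (simp add: multilinear_def)

lemma finite_basis_lists:
  "finite {xs. length xs = m \<and> set xs \<subseteq> range (\<lambda>a::'i::finite. axis a (1::complex))}"
  using finite_lists_length_eq[of "range (\<lambda>a::'i. axis a (1::complex))" m] by (simp add: conj_commute)

text \<open>Each argument in turn is expanded in the standard basis. The finitely many lists of
  basis vectors thereby serve as the determining evaluations.\<close>

lemma multilinear_eq_0I:
  assumes "s \<in> multilinear m"
    "\<And>xs. length xs = m \<Longrightarrow> set xs \<subseteq> range (\<lambda>a::'i::finite. axis a (1::complex)) \<Longrightarrow> s xs = 0"
  shows "s = (\<lambda>_. 0)"
  using assms
proof (induction m arbitrary: s)
  case 0
  then show ?case by (metis (mono_tags, lifting) empty_set empty_subsetI ext list.size(3) mem_Collect_eq multilinear_0)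
next
  case (Suc m)
  have "(\<lambda>xs. s (axis a 1 # xs)) = (\<lambda>_. 0)" for a
    using Suc.prems by (intro Suc.IH) (auto simp: multilinear_Suc_iff)
  then have "s (axis a 1 # xs) = 0" for a xs by metis
  then have "s (v # xs) = 0" for v xs
    by (subst multilinear_basis_Cons[OF Suc.prems(1)]) simp
  moreover have "s [] = 0" using Suc.prems(1) by (simp add: multilinear_Suc_iff)
  ultimately show ?case by (metis (full_types) ext neq_Nil_conv)
qed

lemma finitely_determined_multilinear: "finitely_determined (multilinear m)"
  unfolding finitely_determined_def
  by (intro exI[of _ "{xs. length xs = m \<and> set xs \<subseteq> range (\<lambda>a. axis a 1)}"])
    (auto simp: finite_basis_lists intro: multilinear_eq_0I)

lemma Alt_multilinear: "\<omega> \<in> Alt m \<Longrightarrow> \<omega> \<in> multilinear m"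
  and Sym_multilinear: "s \<in> Sym m \<Longrightarrow> s \<in> multilinear m"
  by (auto simp: Alt_def Sym_def)

lemma function_subspace_Alt: "function_subspace (Alt m)"
proof (rule function_subspaceI)
  fix \<phi> \<psi> :: "(complex^('a+'a)) list \<Rightarrow> complex" and c assume "\<phi> \<in> Alt m" "\<psi> \<in> Alt m"
  then show "(\<lambda>x. \<phi> x + c * \<psi> x) \<in> Alt m"
    by (auto simp: Alt_def intro!: function_subspace_combination[OF function_subspace_multilinear])
qed (use function_subspace_0[OF function_subspace_multilinear] in \<open>simp add: Alt_def\<close>)

lemma SymI: "s \<in> multilinear m \<Longrightarrow> (\<And>xs ys. mset xs = mset ys \<Longrightarrow> s xs = s ys) \<Longrightarrow> s \<in> Sym m"
  unfolding Sym_def by blast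

lemma Sym_permute: "s \<in> Sym m \<Longrightarrow> mset xs = mset ys \<Longrightarrow> s xs = s ys"
  unfolding Sym_def by blast

lemma function_subspace_Sym: "function_subspace (Sym m)"
proof (rule function_subspaceI)
  fix \<phi> \<psi> :: "H list \<Rightarrow> complex" and c assume *: "\<phi> \<in> Sym m" "\<psi> \<in> Sym m"
  show "(\<lambda>x. \<phi> x + c * \<psi> x) \<in> Sym m"
  proof (rule SymI)
    show "\<phi> xs + c * \<psi> xs = \<phi> ys + c * \<psi> ys" if "mset xs = mset ys" for xs ys
      using Sym_permute[OF *(1) that] Sym_permute[OF *(2) that] by simp
  qed (rule function_subspace_combination[OF function_subspace_multilinear *[THEN Sym_multilinear]])
qed (rule SymI[OF function_subspace_0[OF function_subspace_multilinear]], simp)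

lemma finitely_determined_Alt: "finitely_determined (Alt m)"
  and finitely_determined_Sym: "finitely_determined (Sym m)"
  by (rule finitely_determined_mono[OF finitely_determined_multilinear]; auto simp: Alt_def Sym_def)+

lemma Alt_0: "Alt 0 = {\<omega>. \<forall>xs. xs \<noteq> [] \<longrightarrow> \<omega> xs = 0}"
  unfolding Alt_def multilinear_0 by (auto, metis distinct.simps(1))

text \<open>Polarisation of the vanishing on (v + w, v + w); the last assumption supplies additivity
  in the second argument.\<close>

lemma alternating_swap:
  assumes "\<omega> \<in> multilinear m" "\<And>v w xs. \<omega> (v # v # xs) = 0"
    and "\<And>v. (\<lambda>xs. \<omega> (v # xs)) \<in> multilinear (m - 1)"
  shows "\<omega> (v # w # xs) = - \<omega> (w # v # xs)"
proof -
  have "0 = \<omega> ((v + w) # (v + w) # xs)" using assms(2) by simp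
  also have "\<dots> = \<omega> (v # w # xs) + \<omega> (w # v # xs)"
    using multilinear_ConsD(1)[OF assms(1), of v w "(v + w) # xs"] multilinear_ConsD(1)[OF assms(3), of _ v w xs] assms(2) by simp
  finally show ?thesis by (simp add: eq_neg_iff_add_eq_0)
qed

text \<open>Vanishing need only be tested on equal first two arguments: a repetition inside the tail
  is covered by the contraction, and a repetition of the head further right is moved into the tail
  by swapping the first two arguments.\<close>

lemma Alt_Suc_iff:
  "\<omega> \<in> Alt (Suc m) \<longleftrightarrow> \<omega> [] = 0 \<and> (\<forall>v. contr v \<omega> \<in> Alt m) \<and>
     (\<forall>v w xs. \<omega> ((v + w) # xs) = \<omega> (v # xs) + \<omega> (w # xs)) \<and>
     (\<forall>c v xs. \<omega> ((c *s v) # xs) = c * \<omega> (v # xs)) \<and> (\<forall>v xs. \<omega> (v # v # xs) = 0)" (is "_ \<longleftrightarrow> ?R")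
proof
  assume "\<omega> \<in> Alt (Suc m)"
  then show ?R by (auto simp: Alt_def multilinear_Suc_iff contr_def[abs_def])
next
  assume R: ?R
  then have mult: "\<omega> \<in> multilinear (Suc m)"
    by (auto simp: Alt_def multilinear_Suc_iff contr_def[abs_def])
  have R': "\<omega> (v # xs) = 0" if "\<not> distinct xs" for v xs
    using R that by (auto simp: Alt_def contr_def[abs_def])
  have "\<omega> xs = 0" if "\<not> distinct xs" for xs
  proof (cases xs)
    case Nil with that show ?thesis by simp
  next
    case (Cons e es)
    show ?thesis
    proof (cases "distinct es")
      case False then show ?thesis using R' Cons by simp
    next
      case True
      then have "e \<in> set es" using that Cons by auto
      then obtain f es' where es: "es = f # es'" by (cases es) auto
      show ?thesis
      proof (cases "e = f")
        case True then show ?thesis using R Cons es by simp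
      next
        case False
        then have "\<not> distinct (e # es')" using \<open>e \<in> set es\<close> es by auto
        moreover have "\<omega> (e # f # es') = - \<omega> (f # e # es')"
          using R mult by (intro alternating_swap[OF mult]) (auto simp: multilinear_Suc_iff)
        ultimately show ?thesis using R' Cons es by simp
      qed
    qed
  qed
  with mult show "\<omega> \<in> Alt (Suc m)" by (simp add: Alt_def)
qed

lemma Alt_swap:
  assumes "\<omega> \<in> Alt m"
  shows "\<omega> (v # w # xs) = - \<omega> (w # v # xs)"
proof (cases m)
  case 0
  then show ?thesis using assms by (simp add: Alt_0)
next
  case (Suc m')
  then show ?thesis using assms
    by (intro alternating_swap[of \<omega> m]) (auto simp: Alt_def multilinear_Suc_iff)
qed

lemma contr_in_Alt:
  assumes "\<omega> \<in> Alt (Suc m)"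
  shows "contr v \<omega> \<in> Alt m"
  using assms by (simp add: Alt_Suc_iff)

lemma contr_Alt_0: "\<omega> \<in> Alt 0 \<Longrightarrow> contr v \<omega> = (\<lambda>_. 0)"
  by (auto simp: Alt_0 contr_def)

text \<open>The swap of the first two arguments and the permutations of the tail generate all
  permutations. If the heads a and b differ, the tail is rearranged to bring b to second place, a
  and b are swapped, and the tail is rearranged again.\<close>

lemma Sym_Suc_iff:
  "s \<in> Sym (Suc m) \<longleftrightarrow> s [] = 0 \<and> (\<forall>v. sym_contr v s \<in> Sym m) \<and>
     (\<forall>v w xs. s ((v + w) # xs) = s (v # xs) + s (w # xs)) \<and>
     (\<forall>c v xs. s ((c *s v) # xs) = c * s (v # xs)) \<and> (\<forall>v w xs. s (v # w # xs) = s (w # v # xs))"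
  (is "_ \<longleftrightarrow> ?R")
proof
  assume s: "s \<in> Sym (Suc m)"
  then have perm: "mset xs = mset ys \<Longrightarrow> s xs = s ys" for xs ys by (rule Sym_permute)
  have "s (v # w # xs) = s (w # v # xs)" for v w xs by (rule perm) simp
  moreover have "sym_contr v s \<in> Sym m" for v
  proof (rule SymI)
    show "sym_contr v s \<in> multilinear m"
      using Sym_multilinear[OF s] by (simp add: multilinear_Suc_iff sym_contr_def[abs_def])
    show "sym_contr v s xs = sym_contr v s ys" if "mset xs = mset ys" for xs ys
      unfolding sym_contr_def by (rule perm) (simp add: that)
  qed
  ultimately show ?R using Sym_multilinear[OF s] by (simp add: multilinear_Suc_iff)
next
  assume R: ?R
  then have "sym_contr v s \<in> multilinear m" for v by (auto intro: Sym_multilinear)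
  with R have mult: "s \<in> multilinear (Suc m)"
    by (simp add: multilinear_Suc_iff sym_contr_def[abs_def])
  have R': "s (v # xs) = s (v # ys)" if "mset xs = mset ys" for v xs ys
    using Sym_permute[of "sym_contr v s" m, OF _ that] R by (simp add: sym_contr_def)
  have "s xs = s ys" if "mset xs = mset ys" for xs ys
  proof (cases xs)
    case Nil with that show ?thesis by simp
  next
    case (Cons a xs')
    then have "ys \<noteq> []" using that by auto
    then obtain b ys' where ys: "ys = b # ys'" by (cases ys) auto
    show ?thesis
    proof (cases "a = b")
      case True
      then show ?thesis using R'[of xs' ys' a] Cons ys that by simp
    next
      case False
      have "a \<in># mset ys" using that Cons by (metis list.set_intros(1) set_mset_mset)
      then have a: "a \<in># mset ys'" using ys False by simp
      obtain zs where "mset zs = mset ys' - {#a#}" by (metis ex_mset)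
      then have zs: "mset ys' = mset (a # zs)" using a by simp
      have "mset xs' = mset (b # zs)" using that zs Cons ys by simp
      then have "s xs = s (a # b # zs)" using R' Cons by simp
      also have "\<dots> = s (b # a # zs)" using R by simp
      also have "\<dots> = s ys" using R'[OF zs] ys by simp
      finally show ?thesis .
    qed
  qed
  with mult show "s \<in> Sym (Suc m)" by (rule SymI)
qed

section \<open>Recursion rules for wedge, symmetric product and contraction\<close>

lemma sum_lessThan_length_Cons:
  "(\<Sum>i<length (x # xs). f i) = f 0 + (\<Sum>i<length xs. f (Suc i))"
  unfolding length_Cons by (rule sum.lessThan_Suc_shift)

lemma del_Cons: "del 0 (x # xs) = xs" "del (Suc i) (x # xs) = x # del i xs"
  by (auto simp: del_def)

lemma wedge_Nil: "wedge \<eta> \<omega> [] = 0"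
  by (simp add: wedge_def)

text \<open>The graded Leibniz rule of contraction: one summand feeds the first argument to \<eta>,
  and in the others the shift of the position produces the minus sign. Identities between operators
  then reduce to induction on the argument list.\<close>

lemma wedge_Cons: "wedge \<eta> \<omega> (e # es) = pairing \<eta> e * \<omega> es - wedge \<eta> (contr e \<omega>) es"
  unfolding wedge_def sum_lessThan_length_Cons by (simp add: del_Cons contr_def sum_negf)

lemma sym_mult_Cons: "sym_mult h s (x # xs) = pairing x h * s xs + sym_mult h (sym_contr x s) xs"
  unfolding sym_mult_def sum_lessThan_length_Cons by (simp add: del_Cons sym_contr_def)

lemma contr_wedge: "contr v (wedge \<eta> \<omega>) = (\<lambda>es. pairing \<eta> v * \<omega> es - wedge \<eta> (contr v \<omega>) es)"
  by (simp add: contr_def[of v "wedge \<eta> \<omega>", abs_def] wedge_Cons)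

lemma sym_contr_sym_mult: "sym_contr v (sym_mult h s) = (\<lambda>xs. pairing v h * s xs + sym_mult h (sym_contr v s) xs)"
  by (simp add: sym_contr_def[of v "sym_mult h s", abs_def] sym_mult_Cons)

lemma wedge_add: "wedge \<eta> (\<lambda>es. \<phi> es + \<psi> es) = (\<lambda>es. wedge \<eta> \<phi> es + wedge \<eta> \<psi> es)"
  and wedge_diff: "wedge \<eta> (\<lambda>es. \<phi> es - \<psi> es) = (\<lambda>es. wedge \<eta> \<phi> es - wedge \<eta> \<psi> es)"
  and wedge_scale: "wedge \<eta> (\<lambda>es. c * \<psi> es) = (\<lambda>es. c * wedge \<eta> \<psi> es)"
  and wedge_0: "wedge \<eta> (\<lambda>_. 0) = (\<lambda>_. 0)"
  and wedge_sum: "wedge \<eta> (\<lambda>es. \<Sum>i\<in>I. f i es) = (\<lambda>es. \<Sum>i\<in>I. wedge \<eta> (f i) es)"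
  by (simp_all add: wedge_def fun_eq_iff distrib_left right_diff_distrib sum.distrib sum_subtractf sum_distrib_left
      mult.left_commute sum.swap[of _ _ I])

lemma sym_mult_add: "sym_mult h (\<lambda>xs. \<phi> xs + \<psi> xs) = (\<lambda>xs. sym_mult h \<phi> xs + sym_mult h \<psi> xs)"
  and sym_mult_scale: "sym_mult h (\<lambda>xs. c * \<psi> xs) = (\<lambda>xs. c * sym_mult h \<psi> xs)"
  and sym_mult_0: "sym_mult h (\<lambda>_. 0) = (\<lambda>_. 0)"
  by (simp_all add: sym_mult_def fun_eq_iff distrib_left sum.distrib sum_distrib_left mult.left_commute)

lemma pairing_linear:
  "pairing \<alpha> (v + w) = pairing \<alpha> v + pairing \<alpha> w" "pairing \<alpha> (c *s v) = c * pairing \<alpha> v"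
  "pairing (\<alpha> + \<beta>) v = pairing \<alpha> v + pairing \<beta> v" "pairing (c *s \<alpha>) v = c * pairing \<alpha> v"
  by (auto simp: pairing_def algebra_simps sum.distrib sum_distrib_left)

lemma contr_linear:
  assumes "\<omega> \<in> multilinear m"
  shows "contr (v + w) \<omega> = (\<lambda>es. contr v \<omega> es + contr w \<omega> es)"
    "contr (c *s v) \<omega> = (\<lambda>es. c * contr v \<omega> es)"
  by (auto simp: contr_def multilinear_ConsD[OF assms])

lemma sym_contr_linear:
  assumes "s \<in> multilinear m"
  shows "sym_contr (v + w) s = (\<lambda>xs. sym_contr v s xs + sym_contr w s xs)"
    "sym_contr (c *s v) s = (\<lambda>xs. c * sym_contr v s xs)"
  by (auto simp: sym_contr_def multilinear_ConsD[OF assms])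

text \<open>For equal first two arguments the two pairing terms cancel and the rest contains a
  double contraction with the same vector. Degree 0 is separate because contraction leaves the range
  of degrees.\<close>

lemma wedge_in_Alt: "\<omega> \<in> Alt m \<Longrightarrow> wedge \<eta> \<omega> \<in> Alt (Suc m)"
proof (induction m arbitrary: \<omega>)
  case 0
  have "wedge \<eta> \<omega> (v # w # xs) = 0" for v w xs
    using 0 by (simp add: wedge_Cons contr_Alt_0 Alt_0 wedge_0)
  with 0 show ?case
    by (auto simp: Alt_Suc_iff wedge_Nil wedge_Cons contr_wedge contr_Alt_0 wedge_0 pairing_linear algebra_simps Alt_0)
next
  case (Suc m)
  have "contr v (contr v \<omega>) = (\<lambda>_. 0)" for v
    using Suc.prems by (auto simp: Alt_Suc_iff contr_def)
  then have "wedge \<eta> \<omega> (v # v # xs) = 0" for v xs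
    by (simp add: wedge_Cons contr_def[of v \<omega>] wedge_0 contr_wedge)
  moreover have "contr v (wedge \<eta> \<omega>) \<in> Alt (Suc m)" for v
    unfolding contr_wedge using Suc
    by (intro function_subspace_diff[OF function_subspace_Alt] function_subspace_scale[OF function_subspace_Alt])
      (auto intro: contr_in_Alt)
  moreover have "wedge \<eta> \<omega> ((v + w) # xs) = wedge \<eta> \<omega> (v # xs) + wedge \<eta> \<omega> (w # xs)"
      "wedge \<eta> \<omega> ((c *s v) # xs) = c * wedge \<eta> \<omega> (v # xs)" for v w c xs
    using contr_linear[OF Alt_multilinear[OF Suc.prems]]
    by (auto simp: wedge_Cons pairing_linear wedge_add wedge_scale algebra_simps)
  ultimately show ?case by (simp add: Alt_Suc_iff[of _ "Suc m"] wedge_Nil)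
qed

lemma sym_contr_in_Sym: "s \<in> Sym (Suc m) \<Longrightarrow> sym_contr \<alpha> s \<in> Sym m"
  by (simp add: Sym_Suc_iff)

lemma sym_contr_Sym_0: "s \<in> Sym 0 \<Longrightarrow> sym_contr \<alpha> s = (\<lambda>_. 0)"
  using Sym_multilinear[of s 0] by (auto simp: multilinear_0 sym_contr_def)

lemma sym_mult_in_Sym: "s \<in> Sym m \<Longrightarrow> sym_mult h s \<in> Sym (Suc m)"
proof (induction m arbitrary: s)
  case 0
  then have "sym_contr v s = (\<lambda>_. 0)" "s (v # xs) = 0" for v xs
    using Sym_multilinear[OF 0] by (auto simp: sym_contr_Sym_0 multilinear_0)
  moreover have "(\<lambda>xs. pairing v h * s xs) \<in> Sym 0" for v
    by (rule function_subspace_scale[OF function_subspace_Sym 0])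
  ultimately show ?case
    by (simp add: Sym_Suc_iff sym_mult_def[of _ _ "[]"] sym_mult_Cons sym_contr_sym_mult sym_mult_0 pairing_linear distrib_right)
next
  case (Suc m)
  have "sym_contr v (sym_contr w s) = sym_contr w (sym_contr v s)" for v w
    using Suc.prems by (auto simp: Sym_Suc_iff sym_contr_def)
  then have "sym_mult h s (v # w # xs) = sym_mult h s (w # v # xs)" for v w xs
    by (simp add: sym_mult_Cons sym_contr_sym_mult sym_contr_def[of _ s])
  moreover have "sym_contr v (sym_mult h s) \<in> Sym (Suc m)" for v
    unfolding sym_contr_sym_mult using Suc
    by (intro function_subspace_add[OF function_subspace_Sym] function_subspace_scale[OF function_subspace_Sym])
      (auto intro: sym_contr_in_Sym)
  moreover have "sym_mult h s ((v + w) # xs) = sym_mult h s (v # xs) + sym_mult h s (w # xs)"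
      "sym_mult h s ((c *s v) # xs) = c * sym_mult h s (v # xs)" for v w c xs
    using sym_contr_linear[OF Sym_multilinear[OF Suc.prems]]
    by (auto simp: sym_mult_Cons pairing_linear sym_mult_add sym_mult_scale algebra_simps)
  ultimately show ?case by (simp add: Sym_Suc_iff[of _ "Suc m"] sym_mult_def[of _ _ "[]"])
qed

section \<open>Commutation relations on exterior powers\<close>

lemma sum_UNIV_Plus:
  "(\<Sum>a\<in>(UNIV :: ('a::finite + 'b::finite) set). f a) = (\<Sum>i\<in>UNIV. f (Inl i)) + (\<Sum>i\<in>UNIV. f (Inr i))"
  using sum.Plus[of "UNIV :: 'a set" "UNIV :: 'b set" f] by (simp add: UNIV_Plus_UNIV)

lemma pairing_axis: "pairing (axis a 1) v = v $ a"
  by (simp add: pairing_def axis_def if_distrib[of "\<lambda>x. x * _"] cong: if_cong)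

lemma sharp_nth: "sharp v $ Inl i = - v $ Inr i" "sharp v $ Inr i = v $ Inl i"
  by (simp_all add: sharp_def symp_def axis_def if_distrib[of "\<lambda>x. _ * x"] sum_negf cong: if_cong)

lemma pairing_sharp: "pairing (sharp v) w = symp v w"
  by (simp add: pairing_def sum_UNIV_Plus sharp_nth symp_def sum_subtractf sum_negf)

text \<open>\<open>flat\<close> is a choice of preimages under \<open>sharp\<close>, so the claim is
  surjectivity, given by an explicit preimage.\<close>

lemma sharp_flat: "sharp (flat \<alpha>) = \<alpha>"
  unfolding flat_def
proof (rule surj_f_inv_f, rule surjI)
  fix \<alpha> :: "complex^('a+'a)"
  show "sharp (\<chi> i. case i of Inl j \<Rightarrow> \<alpha> $ Inr j | Inr j \<Rightarrow> - \<alpha> $ Inl j) = \<alpha>"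
    unfolding vec_eq_iff
  proof
    fix i show "sharp (\<chi> i. case i of Inl j \<Rightarrow> \<alpha> $ Inr j | Inr j \<Rightarrow> - \<alpha> $ Inl j) $ i = \<alpha> $ i"
      by (cases i) (simp_all add: sharp_nth)
  qed
qed

lemma wedge_wedge: "wedge \<alpha> (wedge \<beta> \<omega>) es = - wedge \<beta> (wedge \<alpha> \<omega>) es"
proof (induction es arbitrary: \<omega>)
  case Nil
  then show ?case by (simp add: wedge_Nil)
next
  case (Cons e es)
  show ?case using Cons[of "contr e \<omega>"]
    by (simp add: wedge_Cons contr_wedge wedge_diff wedge_scale)
qed

lemma wedge_basis_expansion: "wedge \<eta> \<omega> es = (\<Sum>a\<in>UNIV. \<eta> $ a * wedge (axis a 1) \<omega> es)"
proof -
  have "wedge \<eta> \<omega> es = (\<Sum>i<length es. \<Sum>a\<in>UNIV. \<eta> $ a * ((-1)^i * es ! i $ a * \<omega> (del i es)))"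
    unfolding wedge_def pairing_def
    by (intro sum.cong refl) (simp add: sum_distrib_left sum_distrib_right mult_ac)
  also have "\<dots> = (\<Sum>a\<in>UNIV. \<eta> $ a * wedge (axis a 1) \<omega> es)"
    by (subst sum.swap) (simp add: wedge_def pairing_axis sum_distrib_left)
  finally show ?thesis .
qed

text \<open>The pairs with i = 0 give the one-form \<open>sharp e\<close>, the contraction of the
  symplectic form with e; the others contract \<omega>. There is no sign because a two-form is
  even.\<close>

lemma sigma_wedge_Cons: "sigma_wedge \<omega> (e # es) = wedge (sharp e) \<omega> es + sigma_wedge (contr e \<omega>) es"
proof -
  have "sigma_wedge \<omega> (e # es) = (\<Sum>j<length es. \<Sum>i<Suc j. (-1)^(i + Suc j + 1) * symp ((e # es) ! i) (es ! j)
      * \<omega> (del i (e # del j es)))"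
    unfolding sigma_wedge_def sum_lessThan_length_Cons by (simp add: del_Cons)
  also have "\<dots> = (\<Sum>j<length es. (-1)^j * symp e (es ! j) * \<omega> (del j es) +
      (\<Sum>i<j. (-1)^(i + j + 1) * symp (es ! i) (es ! j) * \<omega> (e # del i (del j es))))"
    by (subst sum.lessThan_Suc_shift) (simp add: del_Cons)
  also have "\<dots> = wedge (sharp e) \<omega> es + sigma_wedge (contr e \<omega>) es"
    by (simp add: sum.distrib wedge_def pairing_sharp sigma_wedge_def contr_def)
  finally show ?thesis .
qed

lemma sigma_wedge_Nil: "sigma_wedge \<omega> [] = 0"
  by (simp add: sigma_wedge_def)

text \<open>Writes the symplectic form in a symplectic basis, so that its commutation relations
  follow from those of wedges with single covectors.\<close>

lemma sigma_wedge_eq: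
  "sigma_wedge \<omega> = (\<lambda>es. \<Sum>i\<in>UNIV. wedge (axis (Inl i) 1) (wedge (axis (Inr i) 1) \<omega>) es)"
proof
  fix es show "sigma_wedge \<omega> es = (\<Sum>i\<in>UNIV. wedge (axis (Inl i) 1) (wedge (axis (Inr i) 1) \<omega>) es)"
  proof (induction es arbitrary: \<omega>)
    case Nil
    then show ?case by (simp add: sigma_wedge_Nil wedge_Nil)
  next
    case (Cons e es)
    have "wedge (sharp e) \<omega> es =
        (\<Sum>i\<in>UNIV. e $ Inl i * wedge (axis (Inr i) 1) \<omega> es - e $ Inr i * wedge (axis (Inl i) 1) \<omega> es)"
      by (subst wedge_basis_expansion) (simp add: sum_UNIV_Plus sharp_nth sum_subtractf sum_negf)
    then show ?case using Cons[of "contr e \<omega>"]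
      by (simp add: sigma_wedge_Cons wedge_Cons contr_wedge wedge_diff wedge_scale pairing_axis
          diff_add_eq diff_diff_eq2 flip: sum.distrib)
  qed
qed

lemma sigma_wedge_wedge: "sigma_wedge (wedge \<eta> \<omega>) = wedge \<eta> (sigma_wedge \<omega>)"
proof -
  have "wedge \<alpha> (wedge \<beta> (wedge \<eta> \<omega>)) = wedge \<eta> (wedge \<alpha> (wedge \<beta> \<omega>))" for \<alpha> \<beta>
  proof -
    have "wedge \<beta> (wedge \<eta> \<omega>) = (\<lambda>es. - 1 * wedge \<eta> (wedge \<beta> \<omega>) es)"
      by (auto simp: wedge_wedge[of \<beta> \<eta>])
    then show ?thesis by (simp only: wedge_scale) (auto simp: wedge_wedge[of \<alpha> \<eta>])
  qed
  then show ?thesis by (simp add: sigma_wedge_eq wedge_sum)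
qed

lemma sigma_wedge_add: "sigma_wedge (\<lambda>es. \<phi> es + \<psi> es) = (\<lambda>es. sigma_wedge \<phi> es + sigma_wedge \<psi> es)"
  and sigma_wedge_scale: "sigma_wedge (\<lambda>es. c * \<psi> es) = (\<lambda>es. c * sigma_wedge \<psi> es)"
  by (simp_all add: sigma_wedge_eq wedge_add wedge_scale sum.distrib sum_distrib_left)

lemma sigma_contr_add: "sigma_contr (\<lambda>es. \<phi> es + \<psi> es) = (\<lambda>es. sigma_contr \<phi> es + sigma_contr \<psi> es)"
  and sigma_contr_scale: "sigma_contr (\<lambda>es. c * \<psi> es) = (\<lambda>es. c * sigma_contr \<psi> es)"
  and sigma_contr_0: "sigma_contr (\<lambda>_. 0) = (\<lambda>_. 0)"
  by (simp_all add: sigma_contr_def fun_eq_iff sum.distrib sum_distrib_left)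

lemma sigma_contr_eq:
  "sigma_contr \<omega> = (\<lambda>es. \<Sum>i\<in>UNIV. contr (axis (Inr i) 1) (contr (axis (Inl i) 1) \<omega>) es)"
  by (rule ext) (simp add: sigma_contr_def contr_def)

lemma sigma_contr_wedge:
  "sigma_contr (wedge \<eta> \<omega>) es = wedge \<eta> (sigma_contr \<omega>) es +
     (\<Sum>i\<in>UNIV. \<eta> $ Inl i * \<omega> (axis (Inr i) 1 # es) - \<eta> $ Inr i * \<omega> (axis (Inl i) 1 # es))"
proof -
  have [simp]: "pairing \<eta> (axis a 1) = \<eta> $ a" for a
    by (simp add: pairing_def axis_def if_distrib[of "\<lambda>x. _ * x"] cong: if_cong)
  show ?thesis
    by (simp add: sigma_contr_def wedge_Cons contr_wedge sigma_contr_eq[of \<omega>] wedge_sum flip: sum.distrib)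
      (simp add: contr_def algebra_simps)
qed

text \<open>The sum over the symplectic basis reassembles e from its coordinates, and the convention
  for \<open>sharp\<close> fixes the sign. On a trace-free form only the last term survives, which
  is the trace that \<open>wedge_tracefree\<close> must remove.\<close>

lemma sigma_contr_wedge_sharp:
  assumes "\<omega> \<in> multilinear m"
  shows "sigma_contr (wedge (sharp e) \<omega>) = (\<lambda>es. wedge (sharp e) (sigma_contr \<omega>) es - contr e \<omega> es)"
proof
  fix es
  have "contr e \<omega> es = (\<Sum>a\<in>UNIV. e $ a * \<omega> (axis a 1 # es))"
    unfolding contr_def by (rule multilinear_basis_Cons[OF assms])
  then show "sigma_contr (wedge (sharp e) \<omega>) es = wedge (sharp e) (sigma_contr \<omega>) es - contr e \<omega> es"
    by (simp add: sigma_contr_wedge sharp_nth sum_UNIV_Plus sum_subtractf sum_negf)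
qed

text \<open>The number operator of the exterior algebra: it multiplies a form by its degree.
  Contractions anticommute, so one argument is split off and contributes 1 to the count.\<close>

lemma sum_wedge_contr:
  assumes "\<omega> \<in> Alt m"
  shows "(\<Sum>a\<in>UNIV. wedge (axis a 1) (contr (axis a 1) \<omega>) es) = of_nat m * \<omega> es"
  using assms
proof (induction es arbitrary: m \<omega>)
  case Nil
  then show ?case by (cases m) (auto simp: wedge_Nil Alt_Suc_iff)
next
  case (Cons e es)
  show ?case
  proof (cases m)
    case 0
    with Cons.prems show ?thesis by (simp add: contr_Alt_0 wedge_0)
  next
    case (Suc m')
    have *: "contr e (contr a \<omega>) = (\<lambda>es. - 1 * contr a (contr e \<omega>) es)" for a
      by (rule ext) (simp add: contr_def Alt_swap[OF Cons.prems, of a e])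
    have "(\<Sum>a\<in>UNIV. wedge (axis a 1) (contr (axis a 1) \<omega>) (e # es)) =
        (\<Sum>a\<in>UNIV. e $ a * \<omega> (axis a 1 # es)) + (\<Sum>a\<in>UNIV. wedge (axis a 1) (contr (axis a 1) (contr e \<omega>)) es)"
      by (simp only: wedge_Cons pairing_axis * wedge_scale) (simp add: contr_def[of _ \<omega>] sum.distrib)
    also have "(\<Sum>a\<in>UNIV. e $ a * \<omega> (axis a 1 # es)) = \<omega> (e # es)"
      by (rule multilinear_basis_Cons[OF Alt_multilinear[OF Cons.prems], symmetric])
    also have "(\<Sum>a\<in>UNIV. wedge (axis a 1) (contr (axis a 1) (contr e \<omega>)) es) = of_nat m' * contr e \<omega> es"
      using Cons.prems Suc by (intro Cons.IH) (auto simp: contr_in_Alt)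
    finally show ?thesis using Suc by (simp add: contr_def algebra_simps)
  qed
qed

text \<open>The sl(2) relation. Moving the trace past both wedges leaves one copy of \<omega> for
  each of the n symplectic pairs and subtracts the number operator.\<close>

lemma sigma_contr_sigma_wedge:
  fixes \<omega> :: "'n::finite E list \<Rightarrow> complex"
  assumes "\<omega> \<in> Alt m"
  shows "sigma_contr (sigma_wedge \<omega>) es =
    sigma_wedge (sigma_contr \<omega>) es + (of_nat CARD('n) - of_nat m) * \<omega> es"
proof -
  let ?p = "\<lambda>i. axis (Inl i) 1 :: 'n E" and ?q = "\<lambda>i. axis (Inr i) 1 :: 'n E"
  have delta: "(axis a 1 :: 'n E) $ b = (if b = a then 1 else 0)" for a b
    by (simp add: axis_def)
  have 1: "sigma_contr (wedge (?q i) \<omega>) = (\<lambda>es. wedge (?q i) (sigma_contr \<omega>) es - contr (?p i) \<omega> es)" for i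
    by (auto simp: sigma_contr_wedge delta contr_def if_distrib[of "\<lambda>x. x * _"] sum_negf cong: if_cong)
  have 2: "sigma_contr (wedge (?p i) \<phi>) es = wedge (?p i) (sigma_contr \<phi>) es + \<phi> (?q i # es)" for i \<phi>
    by (auto simp: sigma_contr_wedge delta if_distrib[of "\<lambda>x. x * _"] cong: if_cong)
  have "sigma_contr (sigma_wedge \<omega>) es = (\<Sum>i\<in>UNIV. sigma_contr (wedge (?p i) (wedge (?q i) \<omega>)) es)"
    unfolding sigma_wedge_eq sigma_contr_def by (rule sum.swap)
  also have "\<dots> = (\<Sum>i\<in>UNIV. wedge (?p i) (wedge (?q i) (sigma_contr \<omega>)) es - wedge (?p i) (contr (?p i) \<omega>) es
      + (\<omega> es - wedge (?q i) (contr (?q i) \<omega>) es))"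
    by (simp add: 1 2 wedge_diff wedge_Cons pairing_axis delta)
  also have "\<dots> = sigma_wedge (sigma_contr \<omega>) es + of_nat CARD('n) * \<omega> es
      - (\<Sum>a\<in>UNIV. wedge (axis a 1) (contr (axis a 1) \<omega>) es)"
    by (simp add: sum.distrib sum_subtractf sigma_wedge_eq[of "sigma_contr \<omega>"] sum_UNIV_Plus)
  finally show ?thesis by (simp add: sum_wedge_contr[OF assms] algebra_simps)
qed

lemma sigma_wedge_in_Alt: "\<omega> \<in> Alt m \<Longrightarrow> sigma_wedge \<omega> \<in> Alt (m + 2)"
  unfolding sigma_wedge_eq
  by (intro function_subspace_sum_plain[OF function_subspace_Alt]) (auto intro!: wedge_in_Alt)

lemma sigma_contr_in_Alt: "\<omega> \<in> Alt (m + 2) \<Longrightarrow> sigma_contr \<omega> \<in> Alt m"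
  unfolding sigma_contr_eq
  by (intro function_subspace_sum_plain[OF function_subspace_Alt] contr_in_Alt) simp

lemma sigma_contr_Alt_less_2:
  assumes "\<omega> \<in> Alt m" "m < 2"
  shows "sigma_contr \<omega> = (\<lambda>_. 0)"
proof -
  have "m = 0 \<or> m = Suc 0" using assms(2) by auto
  then have "contr v (contr w \<omega>) = (\<lambda>_. 0)" for v w
  proof
    assume "m = 0"
    with assms(1) have "contr w \<omega> = (\<lambda>_. 0)" using contr_Alt_0[of \<omega>] by simp
    then show ?thesis by (auto simp: contr_def)
  next
    assume "m = Suc 0"
    with assms(1) show ?thesis by (intro contr_Alt_0 contr_in_Alt) simp
  qed
  then show ?thesis by (simp add: sigma_contr_eq)
qed

text \<open>Pigeonhole: a list of basis vectors longer than the basis repeats an entry.\<close>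

lemma Alt_eq_0:
  fixes \<omega> :: "'n::finite E list \<Rightarrow> complex"
  assumes "\<omega> \<in> Alt m" "2 * CARD('n) < m"
  shows "\<omega> = (\<lambda>_. 0)"
proof (rule multilinear_eq_0I[OF Alt_multilinear[OF assms(1)]])
  fix xs :: "'n E list" assume xs: "length xs = m" "set xs \<subseteq> range (\<lambda>a. axis a 1)"
  have "card (set xs) \<le> card (range (\<lambda>a::'n+'n. axis a (1::complex)))"
    using xs by (intro card_mono) auto
  also have "\<dots> \<le> CARD('n + 'n)" by (rule card_image_le) simp
  also have "\<dots> = 2 * CARD('n)" by simp
  finally have "\<not> distinct xs" using assms(2) xs distinct_card by force
  then show "\<omega> xs = 0" using assms(1) by (simp add: Alt_def)
qed

text \<open>Moving v past the two arguments of the trace is an even permutation.\<close>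

lemma contr_sigma_contr: "\<omega> \<in> Alt m \<Longrightarrow> sigma_contr (contr v \<omega>) = contr v (sigma_contr \<omega>)"
proof
  fix es assume \<omega>: "\<omega> \<in> Alt m"
  have "\<omega> (v # p # q # es) = \<omega> (p # q # v # es)" for p q
  proof (cases m)
    case 0 with \<omega> show ?thesis by (simp add: Alt_0)
  next
    case (Suc m')
    have "\<omega> (p # v # q # es) = - \<omega> (p # q # v # es)"
      using Alt_swap[of "contr p \<omega>" m' v q es] \<omega> Suc by (simp add: contr_in_Alt) (simp add: contr_def)
    then show ?thesis using Alt_swap[OF \<omega>, of v p "q # es"] by simp
  qed
  then show "sigma_contr (contr v \<omega>) es = contr v (sigma_contr \<omega>) es"
    by (simp add: sigma_contr_def contr_def)
qed

lemma contr_in_Alt0: "\<omega> \<in> Alt0 (Suc r) \<Longrightarrow> contr e \<omega> \<in> Alt0 r"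
  by (auto simp: Alt0_def contr_in_Alt contr_sigma_contr contr_def)

lemma function_subspace_Alt0: "function_subspace (Alt0 r)"
proof (rule function_subspaceI)
  fix \<phi> \<psi> :: "'n::finite E list \<Rightarrow> complex" and c assume "\<phi> \<in> Alt0 r" "\<psi> \<in> Alt0 r"
  then show "(\<lambda>x. \<phi> x + c * \<psi> x) \<in> Alt0 r"
    by (auto simp: Alt0_def sigma_contr_add sigma_contr_scale intro: function_subspace_combination[OF function_subspace_Alt])
qed (simp add: Alt0_def function_subspace_0[OF function_subspace_Alt] sigma_contr_0)

lemma Alt0_Alt: "\<psi> \<in> Alt0 r \<Longrightarrow> \<psi> \<in> Alt r"
  by (simp add: Alt0_def)

section \<open>Lefschetz decomposition of graded sl(2)-modules\<close>

text \<open>Bounded degrees take the place of finite dimension: they make L and Lam nilpotent on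
  every homogeneous vector. The Cartan element of sl(2) appears only through the commutator, acting
  on \<open>V q\<close> by n - q.\<close>

locale lefschetz_module = vector_space scale
  for scale :: "complex \<Rightarrow> 'v::ab_group_add \<Rightarrow> 'v" +
  fixes V :: "int \<Rightarrow> 'v set" and L Lam :: "'v \<Rightarrow> 'v" and n :: nat
  assumes subspace_V: "subspace (V q)"
    and V_bounded: "v \<in> V q \<Longrightarrow> q < 0 \<or> 2 * int n < q \<Longrightarrow> v = 0"
    and L_add: "L (v + w) = L v + L w" and L_scale: "L (scale c v) = scale c (L v)"
    and Lam_add: "Lam (v + w) = Lam v + Lam w" and Lam_scale: "Lam (scale c v) = scale c (Lam v)"
    and L_V: "v \<in> V q \<Longrightarrow> L v \<in> V (q + 2)"
    and Lam_V: "v \<in> V q \<Longrightarrow> Lam v \<in> V (q - 2)"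
    and commutator: "v \<in> V q \<Longrightarrow> Lam (L v) = L (Lam v) + scale (of_int (int n - q)) v"
begin

text \<open>Exchanging L and Lam changes the sign of the commutator, and reversing the degree
  changes n - q into its negative; the two cancel.\<close>

lemma mirror: "lefschetz_module scale (\<lambda>q. V (2 * int n - q)) Lam L n"
proof unfold_locales
  fix v q assume v: "v \<in> V (2 * int n - q)"
  show "q < 0 \<or> 2 * int n < q \<Longrightarrow> v = 0" using V_bounded[OF v] by auto
  show "Lam v \<in> V (2 * int n - (q + 2))" using Lam_V[OF v] by (simp add: algebra_simps)
  show "L v \<in> V (2 * int n - (q - 2))" using L_V[OF v] by (simp add: algebra_simps)
  show "L (Lam v) = Lam (L v) + scale (of_int (int n - q)) v"
    unfolding commutator[OF v] by (simp add: algebra_simps flip: scale_left_distrib scale_left_diff_distrib)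
qed (auto simp: subspace_V L_add L_scale Lam_add Lam_scale)

lemma L_0: "L 0 = 0" and Lam_0: "Lam 0 = 0"
  using L_scale[of 0 0] Lam_scale[of 0 0] by simp_all

lemma L_pow_add: "(L ^^ j) (v + w) = (L ^^ j) v + (L ^^ j) w"
  and L_pow_scale: "(L ^^ j) (scale c v) = scale c ((L ^^ j) v)"
  and L_pow_0: "(L ^^ j) 0 = 0"
  by (induction j) (auto simp: L_add L_scale L_0)

lemma Lam_pow_add: "(Lam ^^ j) (v + w) = (Lam ^^ j) v + (Lam ^^ j) w"
  and Lam_pow_scale: "(Lam ^^ j) (scale c v) = scale c ((Lam ^^ j) v)"
  and Lam_pow_0: "(Lam ^^ j) 0 = 0"
  by (induction j) (auto simp: Lam_add Lam_scale Lam_0)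

lemma L_pow_sum: "(L ^^ j) (sum f I) = (\<Sum>i\<in>I. (L ^^ j) (f i))"
  by (induction I rule: infinite_finite_induct) (auto simp: L_pow_add L_pow_0)

lemma Lam_pow_sum: "(Lam ^^ j) (sum f I) = (\<Sum>i\<in>I. (Lam ^^ j) (f i))"
  by (induction I rule: infinite_finite_induct) (auto simp: Lam_pow_add Lam_pow_0)

lemma L_pow_V: "v \<in> V q \<Longrightarrow> (L ^^ j) v \<in> V (q + 2 * int j)"
proof (induction j)
  case (Suc j)
  have eq: "q + 2 * int (Suc j) = q + 2 * int j + 2" by simp
  show ?case unfolding eq funpow.simps o_apply by (rule L_V[OF Suc.IH[OF Suc.prems]])
qed simp

lemma Lam_pow_V: "v \<in> V q \<Longrightarrow> (Lam ^^ j) v \<in> V (q - 2 * int j)"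
proof (induction j)
  case (Suc j)
  have eq: "q - 2 * int (Suc j) = q - 2 * int j - 2" by simp
  show ?case unfolding eq funpow.simps o_apply by (rule Lam_V[OF Suc.IH[OF Suc.prems]])
qed simp

section \<open>Primitive vectors and their strings\<close>

definition prim :: "int \<Rightarrow> 'v set" where
  "prim r = {v \<in> V r. Lam v = 0}"

lemma subspace_prim: "subspace (prim r)"
  using subspace_V[of r] unfolding prim_def subspace_def by (simp add: Lam_0 Lam_add Lam_scale)

text \<open>Each passage of Lam past one L adds the current weight; the weights n - r - 2i for i =
  0, ..., j sum to (j + 1)(n - r - j).\<close>

lemma Lam_L_pow:
  assumes "v \<in> prim r"
  shows "Lam ((L ^^ Suc j) v) = scale (of_nat (Suc j) * of_int (int n - r - int j)) ((L ^^ j) v)"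
proof (induction j)
  case 0
  then show ?case using assms commutator[of v r] by (simp add: prim_def L_0)
next
  case (Suc j)
  have "Lam (L ((L ^^ Suc j) v)) = L (Lam ((L ^^ Suc j) v))
      + scale (of_int (int n - (r + 2 * int (Suc j)))) ((L ^^ Suc j) v)"
    using assms by (intro commutator L_pow_V) (simp add: prim_def)
  also have "\<dots> = scale (of_nat (Suc j) * of_int (int n - r - int j) +
      of_int (int n - (r + 2 * int (Suc j)))) ((L ^^ Suc j) v)"
    unfolding Suc by (simp add: L_scale scale_left_distrib)
  also have "of_nat (Suc j) * of_int (int n - r - int j) + of_int (int n - (r + 2 * int (Suc j)))
      = (of_nat (Suc (Suc j)) * of_int (int n - r - int (Suc j)) :: complex)"
    by (simp add: algebra_simps)
  finally show ?case by simp
qed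

text \<open>The string of v ends because the degrees are bounded. At its last non-zero power Lam
  must still return 0, so the scalar of \<open>Lam_L_pow\<close> vanishes, which places the end at
  exponent n - r.\<close>

lemma L_pow_prim_eq_0:
  assumes v: "v \<in> prim r" and j: "int n - r < int j"
  shows "(L ^^ j) v = 0"
proof (rule ccontr)
  assume nz: "(L ^^ j) v \<noteq> 0"
  \<comment> \<open>An exponent that leaves the range: for 0 \<le> r \<le> 2n it leads to degree 4n
    + 2 - r, and for larger r it truncates to 0 while v itself is already out of range.\<close>
  have "(L ^^ nat (2 * int n + 1 - r)) v = 0"
  proof (cases "r < 0")
    case True
    then show ?thesis using v V_bounded[of v r] by (simp add: prim_def L_pow_0)
  next
    case False
    then show ?thesis using V_bounded[OF L_pow_V[of v r]] v by (simp add: prim_def)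
  qed
  then have k: "(L ^^ (LEAST k. (L ^^ k) v = 0)) v = 0" (is "(L ^^ ?k) v = 0") by (rule LeastI)
  have "j < ?k"
  proof (rule ccontr)
    assume "\<not> j < ?k"
    then have "(L ^^ j) v = (L ^^ (j - ?k)) ((L ^^ ?k) v)"
      by (simp flip: funpow_add[THEN fun_cong, unfolded o_def])
    with k nz show False by (simp add: L_pow_0)
  qed
  then obtain k' where k': "?k = Suc k'" by (cases ?k) auto
  then have "(L ^^ k') v \<noteq> 0" using not_less_Least[of k' "\<lambda>k. (L ^^ k) v = 0"] by simp
  moreover have "scale (of_nat (Suc k') * of_int (int n - r - int k')) ((L ^^ k') v) = 0"
    using Lam_L_pow[OF v, of k'] k k' by (simp add: Lam_0)
  ultimately have "(of_nat (Suc k') * of_int (int n - r - int k') :: complex) = 0" by simp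
  then have "int n - r = int k'"
    by (simp only: mult_eq_0_iff of_nat_eq_0_iff of_int_eq_0_iff) simp
  with j \<open>j < ?k\<close> k' show False by simp
qed

text \<open>The scalar is a product of the factors in \<open>Lam_L_pow\<close>. If j \<le> n - r,
  every exponent met on the way down lies strictly before the end of the string and its factor is
  non-zero.\<close>

lemma Lam_pow_L_pow:
  assumes "v \<in> prim r" "i \<le> j"
  shows "\<exists>c. (Lam ^^ i) ((L ^^ j) v) = scale c ((L ^^ (j - i)) v) \<and> (int j \<le> int n - r \<longrightarrow> c \<noteq> 0)"
  using assms(2)
proof (induction i)
  case 0
  then show ?case by (intro exI[of _ 1]) simp
next
  case (Suc i)
  then obtain c where c: "(Lam ^^ i) ((L ^^ j) v) = scale c ((L ^^ (j - i)) v)"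
      "int j \<le> int n - r \<Longrightarrow> c \<noteq> 0" by auto
  define k where "k = j - Suc i"
  have k: "j - i = Suc k" using Suc.prems by (simp add: k_def)
  have "(Lam ^^ Suc i) ((L ^^ j) v) = scale c (Lam ((L ^^ Suc k) v))"
    using c(1) k by (simp add: Lam_scale)
  also have "\<dots> = scale (c * (of_nat (Suc k) * of_int (int n - r - int k))) ((L ^^ k) v)"
    unfolding Lam_L_pow[OF assms(1)] by simp
  finally show ?case
  proof (intro exI conjI impI)
    assume j: "int j \<le> int n - r"
    then have "int n - r - int k \<noteq> 0" using k by linarith
    then have "(of_int (int n - r - int k) :: complex) \<noteq> 0" by (simp only: of_int_eq_0_iff not_False_eq_True)
    moreover have "(of_nat (Suc k) :: complex) \<noteq> 0" by (simp only: of_nat_eq_0_iff)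
    ultimately show "c * (of_nat (Suc k) * of_int (int n - r - int k)) \<noteq> 0" using c(2)[OF j] by simp
  qed (simp add: k_def)
qed

lemma Lam_pow_L_pow_eq_0:
  assumes "v \<in> prim r" "j < i"
  shows "(Lam ^^ i) ((L ^^ j) v) = 0"
proof -
  obtain c where "(Lam ^^ j) ((L ^^ j) v) = scale c v"
    using Lam_pow_L_pow[OF assms(1), of j j] by auto
  then have "(Lam ^^ Suc j) ((L ^^ j) v) = 0" using assms(1) by (simp add: prim_def Lam_scale)
  moreover have "(Lam ^^ i) ((L ^^ j) v) = (Lam ^^ (i - Suc j)) ((Lam ^^ Suc j) ((L ^^ j) v))"
    using assms(2) by (simp del: funpow.simps flip: funpow_add[THEN fun_cong, unfolded o_def])
  ultimately show ?thesis by (simp add: Lam_pow_0)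
qed

text \<open>Components are removed from the largest exponent b downwards: the b-th power of Lam
  kills all shorter strings and multiplies the component at b by a non-zero scalar. The components
  normalised to 0 are those in degrees where the power of L annihilates every primitive
  vector.\<close>

lemma lefschetz_unique:
  assumes "finite F" "\<And>l. l \<in> F \<Longrightarrow> \<psi> l \<in> prim (q - 2 * int l)"
    and "\<And>l. l \<in> F \<Longrightarrow> int n - (q - 2 * int l) < int l \<Longrightarrow> \<psi> l = 0"
    and "(\<Sum>l\<in>F. (L ^^ l) (\<psi> l)) = 0" "l \<in> F"
  shows "\<psi> l = 0"
  using assms
proof (induction F arbitrary: l rule: finite_linorder_max_induct)
  case (insert b F)
  have "(Lam ^^ b) ((L ^^ a) (\<psi> a)) = 0" if "a \<in> F" for a
    using insert that by (intro Lam_pow_L_pow_eq_0) auto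
  then have "(Lam ^^ b) (\<Sum>l\<in>insert b F. (L ^^ l) (\<psi> l)) = (Lam ^^ b) ((L ^^ b) (\<psi> b))"
    using insert(1,2) by (subst Lam_pow_sum, subst sum.insert) auto
  then have 0: "(Lam ^^ b) ((L ^^ b) (\<psi> b)) = 0" using insert.prems(3) by (simp add: Lam_pow_0)
  have b: "\<psi> b = 0"
  proof (rule ccontr)
    assume nz: "\<psi> b \<noteq> 0"
    then have "int b \<le> int n - (q - 2 * int b)" using insert.prems(2)[of b] by force
    then obtain c where "(Lam ^^ b) ((L ^^ b) (\<psi> b)) = scale c (\<psi> b)" "c \<noteq> 0"
      using Lam_pow_L_pow[OF insert.prems(1)[of b], of b b] by auto
    with 0 nz show False by simp
  qed
  moreover have "(\<Sum>l\<in>F. (L ^^ l) (\<psi> l)) = 0"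
    using insert.prems(3) insert(1,2) b by (subst (asm) sum.insert) (auto simp: L_pow_0)
  ultimately show ?case using insert.IH insert.prems by blast
qed simp

section \<open>Existence of the decomposition\<close>

definition decomposable :: "int \<Rightarrow> 'v \<Rightarrow> bool" where
  "decomposable q v \<longleftrightarrow> (\<exists>\<psi>. (\<forall>l. \<psi> l \<in> prim (q - 2 * int l) \<and>
     (int n - (q - 2 * int l) < int l \<longrightarrow> \<psi> l = 0)) \<and> v = (\<Sum>l\<le>n. (L ^^ l) (\<psi> l)))"

lemma decomposable_0: "decomposable q 0"
  unfolding decomposable_def
  by (intro exI[of _ "\<lambda>_. 0"]) (auto simp: L_pow_0 subspace_0[OF subspace_prim])

lemma decomposable_add:
  assumes "decomposable q v" "decomposable q w"
  shows "decomposable q (v + w)"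
proof -
  obtain \<psi> where \<psi>: "\<And>l. \<psi> l \<in> prim (q - 2 * int l)"
      "\<And>l. int n - (q - 2 * int l) < int l \<Longrightarrow> \<psi> l = 0" "v = (\<Sum>l\<le>n. (L ^^ l) (\<psi> l))"
    using assms(1) unfolding decomposable_def by blast
  obtain \<theta> where \<theta>: "\<And>l. \<theta> l \<in> prim (q - 2 * int l)"
      "\<And>l. int n - (q - 2 * int l) < int l \<Longrightarrow> \<theta> l = 0" "w = (\<Sum>l\<le>n. (L ^^ l) (\<theta> l))"
    using assms(2) unfolding decomposable_def by blast
  show ?thesis unfolding decomposable_def
    using \<psi>(2) \<theta>(2)
    by (intro exI[of _ "\<lambda>l. \<psi> l + \<theta> l"])
      (auto simp: \<psi>(3) \<theta>(3) L_pow_add sum.distrib intro!: subspace_add[OF subspace_prim] \<psi>(1) \<theta>(1))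
qed

lemma decomposable_scale:
  assumes "decomposable q v"
  shows "decomposable q (scale c v)"
proof -
  obtain \<psi> where "\<And>l. \<psi> l \<in> prim (q - 2 * int l)"
      "\<And>l. int n - (q - 2 * int l) < int l \<Longrightarrow> \<psi> l = 0" "v = (\<Sum>l\<le>n. (L ^^ l) (\<psi> l))"
    using assms unfolding decomposable_def by blast
  then show ?thesis unfolding decomposable_def
    by (intro exI[of _ "\<lambda>l. scale c (\<psi> l)"])
      (auto simp: L_pow_scale scale_sum_right subspace_scale[OF subspace_prim])
qed

lemma decomposable_sum: "(\<And>i. i \<in> I \<Longrightarrow> decomposable q (f i)) \<Longrightarrow> decomposable q (sum f I)"
  by (induction I rule: infinite_finite_induct) (auto simp: decomposable_0 decomposable_add)

lemma decomposable_L_pow: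
  assumes "\<psi> \<in> prim (q - 2 * int l)"
  shows "decomposable q ((L ^^ l) \<psi>)"
proof (cases "int n - (q - 2 * int l) < int l \<or> \<psi> = 0")
  case True
  then have "(L ^^ l) \<psi> = 0" using L_pow_prim_eq_0[OF assms] by (auto simp: L_pow_0)
  then show ?thesis by (simp add: decomposable_0)
next
  case False
  then have "0 \<le> q - 2 * int l" using V_bounded[of \<psi> "q - 2 * int l"] assms by (force simp: prim_def)
  with False have "l \<le> n" by linarith
  have "(\<Sum>l'\<le>n. (L ^^ l') (if l' = l then \<psi> else 0)) = (\<Sum>l'\<le>n. if l' = l then (L ^^ l) \<psi> else 0)"
    by (intro sum.cong) (auto simp: L_pow_0)
  then have "(L ^^ l) \<psi> = (\<Sum>l'\<le>n. (L ^^ l') (if l' = l then \<psi> else 0))"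
    using \<open>l \<le> n\<close> by simp
  then show ?thesis unfolding decomposable_def using assms False
    by (intro exI[of _ "\<lambda>l'. if l' = l then \<psi> else 0"]) (auto simp: subspace_0[OF subspace_prim])
qed

text \<open>Induction on the number of contractions that kill v. The last possibly non-zero
  contraction \<theta> is primitive, and for q \<le> n its string is long enough for Lam and L to
  undo each other up to a non-zero scalar. Subtracting a multiple of a power of L applied to
  \<theta> lowers the number.\<close>

lemma decomposable_low:
  assumes "q \<le> int n" "v \<in> V q"
  shows "decomposable q v"
proof -
  have "decomposable q v" if "(Lam ^^ N) v = 0" "v \<in> V q" for N v
    using that
  proof (induction N arbitrary: v)
    case 0
    then show ?case by (simp add: decomposable_0)
  next
    case (Suc N)
    define \<theta> where "\<theta> = (Lam ^^ N) v"
    have \<theta>: "\<theta> \<in> prim (q - 2 * int N)"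
      using Suc.prems Lam_pow_V[OF Suc.prems(2), of N] by (simp add: prim_def \<theta>_def)
    show ?case
    proof (cases "q - 2 * int N < 0")
      case True
      then have "\<theta> = 0" using V_bounded[of \<theta> "q - 2 * int N"] \<theta> by (simp add: prim_def)
      then show ?thesis using Suc by (simp add: \<theta>_def)
    next
      case False
      then have "int N \<le> int n - (q - 2 * int N)" using assms(1) by linarith
      then obtain c where c: "(Lam ^^ N) ((L ^^ N) \<theta>) = scale c \<theta>" "c \<noteq> 0"
        using Lam_pow_L_pow[OF \<theta>, of N N] by auto
      define w where "w = scale (- (1 / c)) ((L ^^ N) \<theta>)"
      have "(L ^^ N) \<theta> \<in> V q" using L_pow_V[of \<theta> "q - 2 * int N" N] \<theta> by (simp add: prim_def)
      then have "v + w \<in> V q" unfolding w_def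
        by (intro subspace_add[OF subspace_V] subspace_scale[OF subspace_V] Suc.prems)
      moreover have "(Lam ^^ N) (v + w) = 0"
        unfolding Lam_pow_add w_def Lam_pow_scale c(1) using c(2) by (simp flip: \<theta>_def)
      ultimately have d: "decomposable q (v + w)" by (rule Suc.IH[rotated])
      have "decomposable q ((v + w) + scale (1 / c) ((L ^^ N) \<theta>))"
        by (rule decomposable_add[OF d decomposable_scale[OF decomposable_L_pow[OF \<theta>]]])
      then show ?thesis by (simp add: w_def)
    qed
  qed
  \<comment> \<open>For q \<ge> 0 the degree after q + 1 contractions is -q - 2, below the
    range.\<close>
  moreover have "(Lam ^^ nat (q + 1)) v = 0"
  proof (cases "q < 0")
    case True
    then show ?thesis using V_bounded[OF assms(2)] by (simp add: Lam_pow_0)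
  next
    case False
    then show ?thesis using V_bounded[OF Lam_pow_V[OF assms(2)]] by simp
  qed
  ultimately show ?thesis using assms(2) by blast
qed

text \<open>Above the middle degree, apply the lower half to the mirrored module: a vector killed by \<open>L\<close> in
  degree \<open>s\<close> is a multiple of \<open>L\<^sup>s\<^sup>-\<^sup>n\<close> of a primitive vector of degree \<open>2n - s\<close>.\<close>

lemma decomposable_high:
  assumes q: "int n \<le> q" and v: "v \<in> V q"
  shows "decomposable q v"
proof -
  interpret m: lefschetz_module scale "\<lambda>q. V (2 * int n - q)" Lam L n by (rule mirror)
  have "m.decomposable (2 * int n - q) v" using q v by (intro m.decomposable_low) auto
  then obtain \<xi> where \<xi>: "\<And>l. \<xi> l \<in> m.prim (2 * int n - q - 2 * int l)"
      and v_eq: "v = (\<Sum>l\<le>n. (Lam ^^ l) (\<xi> l))"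
    unfolding m.decomposable_def by auto
  have "decomposable q ((Lam ^^ l) (\<xi> l))" for l
  proof -
    \<comment> \<open>The vector \<open>\<xi> l\<close> has degree s = q + 2l, and j = s - n is the
      length of its mirrored string. Hence j contractions reach the other end, in degree 2n -
      s.\<close>
    define j where "j = nat (q + 2 * int l - int n)"
    have j: "int j = q + 2 * int l - int n" using q by (simp add: j_def)
    have l: "l \<le> j" using j q by linarith
    define \<psi> where "\<psi> = (Lam ^^ j) (\<xi> l)"
    obtain c where c: "(L ^^ j) \<psi> = scale c (\<xi> l)" "c \<noteq> 0"
      using m.Lam_pow_L_pow[OF \<xi>[of l], of j j] j by (auto simp: \<psi>_def)
    have \<xi>': "\<xi> l = scale (1 / c) ((L ^^ j) \<psi>)" using c by simp
    have "\<xi> l \<in> V (q + 2 * int l)" using \<xi>[of l] unfolding m.prim_def by (simp add: algebra_simps)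
    then have "\<psi> \<in> V (q + 2 * int l - 2 * int j)" unfolding \<psi>_def by (rule Lam_pow_V)
    moreover have "(Lam ^^ Suc j) (\<xi> l) = 0"
      using j by (intro m.L_pow_prim_eq_0[OF \<xi>[of l]]) simp
    ultimately have \<psi>: "\<psi> \<in> prim (q - 2 * int (j - l))"
      using l by (simp add: prim_def \<psi>_def algebra_simps of_nat_diff)
    obtain c' where "(Lam ^^ l) ((L ^^ j) \<psi>) = scale c' ((L ^^ (j - l)) \<psi>)"
      using Lam_pow_L_pow[OF \<psi> l] by blast
    then have "(Lam ^^ l) (\<xi> l) = scale (1 / c * c') ((L ^^ (j - l)) \<psi>)"
      by (subst \<xi>') (simp add: Lam_pow_scale)
    then show ?thesis using decomposable_scale[OF decomposable_L_pow[OF \<psi>]] by simp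
  qed
  then show ?thesis unfolding v_eq by (intro decomposable_sum) auto
qed

lemma lefschetz_decomposition: "v \<in> V q \<Longrightarrow> decomposable q v"
  by (cases "q \<le> int n") (simp_all add: decomposable_low decomposable_high)

text \<open>Characterises primitive vectors by L alone, for settings where only L is easy to
  control. In degree r - 2l with l \<ge> 1 the exponent a + l still lies inside the string, so
  uniqueness removes every component of v except the one with l = 0.\<close>

lemma primI:
  assumes v: "v \<in> V r" and a: "int a = int n - r + 1" and 0: "(L ^^ a) v = 0"
  shows "v \<in> prim r"
proof -
  obtain \<psi> where \<psi>: "\<And>l. \<psi> l \<in> prim (r - 2 * int l)"
      "\<And>l. int n - (r - 2 * int l) < int l \<Longrightarrow> \<psi> l = 0" and v_eq: "v = (\<Sum>l\<le>n. (L ^^ l) (\<psi> l))"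
    using lefschetz_decomposition[OF v] unfolding decomposable_def by blast
  have v_eq': "v = \<psi> 0 + (\<Sum>l\<in>{1..n}. (L ^^ l) (\<psi> l))"
    unfolding v_eq atMost_atLeast0 by (subst sum.atLeast_Suc_atMost) auto
  have "(L ^^ a) (\<psi> 0) = 0" using \<psi>(1)[of 0] a by (intro L_pow_prim_eq_0[of _ r]) auto
  then have "0 = (\<Sum>l\<in>{1..n}. (L ^^ (a + l)) (\<psi> l))"
    using 0 by (simp add: v_eq' L_pow_add L_pow_sum funpow_add)
  also have "\<dots> = (\<Sum>l\<in>{1+a..n+a}. (L ^^ l) (\<psi> (l - a)))"
    by (subst sum.shift_bounds_cl_nat_ivl) (simp add: add.commute)
  finally have sum0: "(\<Sum>l\<in>{1+a..n+a}. (L ^^ l) (\<psi> (l - a))) = 0" by simp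
  have "\<psi> l = 0" if "l \<in> {1..n}" for l
  proof -
    have "\<psi> (l + a - a) = 0"
    proof (rule lefschetz_unique[OF _ _ _ sum0, where q = "r + 2 * int a"])
      fix l assume l: "l \<in> {1+a..n+a}"
      then have "int (l - a) = int l - int a" by auto
      then show "\<psi> (l - a) \<in> prim (r + 2 * int a - 2 * int l)"
        using \<psi>(1)[of "l - a"] by (simp add: algebra_simps)
      assume "int n - (r + 2 * int a - 2 * int l) < int l"
      with a l show "\<psi> (l - a) = 0"
        by (intro \<psi>(2)) (simp add: algebra_simps of_nat_diff)
    qed (use that in auto)
    then show ?thesis by simp
  qed
  then have "v = \<psi> 0" using v_eq' by (simp add: L_pow_0)
  then show ?thesis using \<psi>(1)[of 0] by simp
qed

end

section \<open>The Lefschetz decomposition of exterior powers\<close>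

text \<open>The integer grading makes the degree reversal \<open>q \<mapsto> 2n - q\<close> available, which exchanges \<open>\<sigma>\<^sub>E\<and>\<close>
  with its contraction.\<close>

definition Alt_int :: "int \<Rightarrow> ('n::finite E list \<Rightarrow> complex) set" where
  "Alt_int q = (if q < 0 then {0} else Alt (nat q))"

lemma function_subspace_Alt_int: "function_subspace (Alt_int q)"
proof (cases "q < 0")
  case True
  then show ?thesis by (auto simp: Alt_int_def function_subspace_def zero_fun_def)
next
  case False
  then show ?thesis by (simp add: Alt_int_def function_subspace_Alt)
qed

interpretation alt: lefschetz_module "\<lambda>c \<omega> es. c * \<omega> es"
  "Alt_int :: int \<Rightarrow> ('n::finite E list \<Rightarrow> complex) set" sigma_wedge sigma_contr "CARD('n)"
proof -
  interpret vector_space "\<lambda>(c::complex) (\<omega> :: 'n E list \<Rightarrow> complex) es. c * \<omega> es"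
    by unfold_locales (simp_all add: plus_fun_def algebra_simps)
  have 0: "sigma_wedge (0 :: 'n E list \<Rightarrow> complex) = 0" "sigma_contr (0 :: 'n E list \<Rightarrow> complex) = 0"
    using sigma_wedge_scale[of 0] sigma_contr_0 by (simp_all add: zero_fun_def)
  show "lefschetz_module (\<lambda>(c::complex) (\<omega> :: 'n E list \<Rightarrow> complex) es. c * \<omega> es) Alt_int
      sigma_wedge sigma_contr CARD('n)"
  proof unfold_locales
    fix q
    show "subspace (Alt_int q :: ('n E list \<Rightarrow> complex) set)"
      unfolding subspace_def zero_fun_def plus_fun_def
      using function_subspace_0[OF function_subspace_Alt_int[of q]] function_subspace_add[OF function_subspace_Alt_int[of q]]
        function_subspace_scale[OF function_subspace_Alt_int[of q]] by blast
  next
    fix \<omega> :: "'n E list \<Rightarrow> complex" and q assume \<omega>: "\<omega> \<in> Alt_int q"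
    show "q < 0 \<or> 2 * int CARD('n) < q \<Longrightarrow> \<omega> = 0"
      using \<omega> Alt_eq_0[of \<omega> "nat q"] by (auto simp: Alt_int_def zero_fun_def split: if_splits)
    show "sigma_wedge \<omega> \<in> Alt_int (q + 2)"
    proof (cases "q < 0")
      case True
      with \<omega> have "sigma_wedge \<omega> = 0" by (simp add: Alt_int_def 0)
      then show ?thesis using function_subspace_0[OF function_subspace_Alt_int] by (simp add: zero_fun_def)
    next
      case False
      then show ?thesis using \<omega> sigma_wedge_in_Alt[of \<omega> "nat q"] by (simp add: Alt_int_def nat_add_distrib)
    qed
    show "sigma_contr \<omega> \<in> Alt_int (q - 2)"
    proof (cases "q < 2")
      case True
      have "sigma_contr \<omega> = (\<lambda>_. 0)"
      proof (cases "q < 0")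
        case True
        with \<omega> show ?thesis by (simp add: Alt_int_def 0 zero_fun_def sigma_contr_0)
      next
        case False
        with True \<omega> show ?thesis by (intro sigma_contr_Alt_less_2[of _ "nat q"]) (auto simp: Alt_int_def)
      qed
      then show ?thesis using function_subspace_0[OF function_subspace_Alt_int] by (simp add: zero_fun_def)
    next
      case False
      then have "nat q = nat (q - 2) + 2" by simp
      with False \<omega> show ?thesis using sigma_contr_in_Alt[of \<omega> "nat (q - 2)"] by (simp add: Alt_int_def)
    qed
    show "sigma_contr (sigma_wedge \<omega>) = sigma_wedge (sigma_contr \<omega>) + (\<lambda>es. of_int (int CARD('n) - q) * \<omega> es)"
    proof (cases "q < 0")
      case True
      with \<omega> show ?thesis by (simp add: Alt_int_def 0) (simp add: zero_fun_def plus_fun_def)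
    next
      case False
      then have "of_int (int CARD('n) - q) = (of_nat CARD('n) - of_nat (nat q) :: complex)" by simp
      with False \<omega> show ?thesis
        using sigma_contr_sigma_wedge[of \<omega> "nat q"] by (simp add: Alt_int_def plus_fun_def fun_eq_iff)
    qed
  qed (simp_all add: plus_fun_def sigma_wedge_add sigma_contr_add sigma_wedge_scale sigma_contr_scale)
qed

lemma alt_prim_iff: "\<psi> \<in> alt.prim (int r) \<longleftrightarrow> \<psi> \<in> Alt0 r"
  by (simp add: alt.prim_def Alt_int_def Alt0_def zero_fun_def)

section \<open>Admissible trace-free degrees and divided powers of the symplectic form\<close>

definition lefschetz_degrees :: "nat \<Rightarrow> nat \<Rightarrow> nat set" where
  "lefschetz_degrees n q = {r. (q, r) \<in> lefschetz_indices n}"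

lemma finite_lefschetz_degrees: "finite (lefschetz_degrees n q)"
  by (rule finite_subset[of _ "{..n}"]) (auto simp: lefschetz_degrees_def lefschetz_indices_def)

lemma finite_lefschetz_indices: "finite (lefschetz_indices n)"
  by (rule finite_subset[of _ "{..2 * n} \<times> {..n}"]) (auto simp: lefschetz_indices_def)

text \<open>The bounds on q are symmetric about n, and the parities agree since the two differences
  add up to 2(n - r). Thus the source and the target of \<gamma> have the same index set.\<close>

lemma lefschetz_degrees_mirror:
  assumes "q \<le> 2 * n"
  shows "lefschetz_degrees n (2 * n - q) = lefschetz_degrees n q"
proof -
  have "even (2 * n - q - r) \<longleftrightarrow> even (q - r)" if "r \<le> q" "q \<le> 2 * n - r" "r \<le> n" for r
  proof -
    have "(2 * n - q - r) + (q - r) = 2 * (n - r)" using that by simp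
    then show ?thesis by (metis even_add dvd_triv_left)
  qed
  moreover have "even (2 * n - q - r) \<longleftrightarrow> even (q - r)" if "r \<le> 2 * n - q" "2 * n - q \<le> 2 * n - r" "r \<le> n" for r
    using that assms by (intro calculation) auto
  ultimately show ?thesis using assms by (auto simp: lefschetz_degrees_def lefschetz_indices_def)
qed

lemma lefschetz_degrees_half:
  assumes "r \<in> lefschetz_degrees n q"
  shows "q = r + 2 * ((q - r) div 2)" "r \<le> n" "(q - r) div 2 \<le> n - r" "(2 * n - q - r) div 2 = n - r - (q - r) div 2"
proof -
  have r: "r \<le> n" "r \<le> q" "q \<le> 2 * n - r" "even (q - r)"
    using assms by (auto simp: lefschetz_degrees_def lefschetz_indices_def)
  then obtain h where h: "q - r = 2 * h" by (elim evenE)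
  with r have q: "q = r + 2 * h" "h \<le> n - r" by linarith+
  then have "2 * n - q - r = 2 * (n - r - h)" by simp
  with h q r show "q = r + 2 * ((q - r) div 2)" "r \<le> n" "(q - r) div 2 \<le> n - r"
      "(2 * n - q - r) div 2 = n - r - (q - r) div 2" by simp_all
qed

lemma sigma_wedge_div_eq: "sigma_wedge_div l \<psi> = (sigma_wedge ^^ l) (\<lambda>es. inverse (fact l) * \<psi> es)"
  using alt.L_pow_scale[of l "inverse (fact l)" \<psi>] by (simp add: sigma_wedge_div_def fun_eq_iff divide_inverse)

lemma sigma_wedge_pow_eq: "(sigma_wedge ^^ l) \<psi> = sigma_wedge_div l (\<lambda>es. fact l * \<psi> es)"
  by (simp add: sigma_wedge_div_eq flip: mult.assoc)

lemma sigma_wedge_div_add: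
    "sigma_wedge_div l (\<lambda>es. \<phi> es + \<psi> es) = (\<lambda>es. sigma_wedge_div l \<phi> es + sigma_wedge_div l \<psi> es)"
  and sigma_wedge_div_scale: "sigma_wedge_div l (\<lambda>es. c * \<psi> es) = (\<lambda>es. c * sigma_wedge_div l \<psi> es)"
  and sigma_wedge_div_zero: "sigma_wedge_div l (\<lambda>_. 0) = (\<lambda>_. 0)"
  using alt.L_pow_add[of l \<phi> \<psi>] alt.L_pow_scale[of l c \<psi>] alt.L_pow_0[of l]
  by (simp_all add: sigma_wedge_div_def fun_eq_iff plus_fun_def zero_fun_def add_divide_distrib)

lemma sigma_wedge_div_in_Alt: "\<omega> \<in> Alt m \<Longrightarrow> sigma_wedge_div l \<omega> \<in> Alt (m + 2 * l)"
proof -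
  assume "\<omega> \<in> Alt m"
  then have "(sigma_wedge ^^ l) \<omega> \<in> Alt (m + 2 * l)"
  proof (induction l)
    case (Suc l)
    then show ?case using sigma_wedge_in_Alt[of "(sigma_wedge ^^ l) \<omega>" "m + 2 * l"] by simp
  qed simp
  then show ?thesis
    using function_subspace_scale[OF function_subspace_Alt, of "(sigma_wedge ^^ l) \<omega>" _ "inverse (fact l)"]
    by (simp add: sigma_wedge_div_def[abs_def] divide_inverse mult.commute)
qed

lemma sigma_wedge_div_Alt0_eq_0:
  fixes \<psi> :: "'n::finite E list \<Rightarrow> complex"
  assumes "\<psi> \<in> Alt0 r" "CARD('n) < r + l"
  shows "sigma_wedge_div l \<psi> = (\<lambda>_. 0)"
  using alt.L_pow_prim_eq_0[of \<psi> "int r" l] assms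
  by (simp add: alt_prim_iff sigma_wedge_div_def zero_fun_def)

lemma Alt0_eq_0:
  fixes \<psi> :: "'n::finite E list \<Rightarrow> complex"
  shows "\<psi> \<in> Alt0 r \<Longrightarrow> CARD('n) < r \<Longrightarrow> \<psi> = (\<lambda>_. 0)"
  using sigma_wedge_div_Alt0_eq_0[of \<psi> r 0] by (simp add: sigma_wedge_div_def)

lemma sum_fun_apply: "sum f I x = (\<Sum>i\<in>I. f i x)"
  by (induction I rule: infinite_finite_induct) (auto simp: zero_fun_def plus_fun_def)

lemma Alt_lefschetz_decomposition:
  fixes \<omega> :: "'n::finite E list \<Rightarrow> complex"
  assumes "\<omega> \<in> Alt q"
  shows "\<exists>\<psi>. (\<forall>r. \<psi> r \<in> Alt0 r) \<and>
    \<omega> = (\<lambda>es. \<Sum>r\<in>lefschetz_degrees CARD('n) q. sigma_wedge_div ((q - r) div 2) (\<psi> r) es)"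
proof -
  let ?n = "CARD('n)"
  have "\<omega> \<in> Alt_int (int q)" using assms by (simp add: Alt_int_def)
  then obtain \<theta> where \<theta>: "\<And>l. \<theta> l \<in> alt.prim (int q - 2 * int l)"
      "\<And>l. int ?n - (int q - 2 * int l) < int l \<Longrightarrow> \<theta> l = 0"
      and \<omega>: "\<omega> = (\<Sum>l\<le>?n. (sigma_wedge ^^ l) (\<theta> l))"
    using alt.lefschetz_decomposition[of \<omega> "int q"] unfolding alt.decomposable_def by blast
  \<comment> \<open>The factorial converts powers into divided powers. The value 0 off the index set
    makes membership in \<open>Alt0 r\<close> hold for every r.\<close>
  define \<psi> where "\<psi> r = (if r \<in> lefschetz_degrees ?n q then (\<lambda>es. fact ((q - r) div 2) * \<theta> ((q - r) div 2) es)
      else (\<lambda>_. 0))" for r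
  have "\<psi> r \<in> Alt0 r" for r
  proof (cases "r \<in> lefschetz_degrees ?n q")
    case True
    have "int q - 2 * int ((q - r) div 2) = int r"
      using lefschetz_degrees_half(1)[OF True] by linarith
    then have "\<theta> ((q - r) div 2) \<in> Alt0 r" using \<theta>(1)[of "(q - r) div 2"] by (simp add: alt_prim_iff)
    then show ?thesis using True by (simp add: \<psi>_def function_subspace_scale[OF function_subspace_Alt0])
  next
    case False
    then show ?thesis by (simp add: \<psi>_def function_subspace_0[OF function_subspace_Alt0])
  qed
  moreover have "\<omega> = (\<lambda>es. \<Sum>r\<in>lefschetz_degrees ?n q. sigma_wedge_div ((q - r) div 2) (\<psi> r) es)"
  proof
    fix es
    \<comment> \<open>The l for which r = q - 2l is admissible: the bound q \<le> 2n - r becomes q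
      \<le> n + l and already implies r \<le> n.\<close>
    let ?M = "{l. 2 * l \<le> q \<and> q \<le> ?n + l}"
    have M: "?M \<subseteq> {..?n}" by auto
    have "\<theta> l = 0" if "l \<in> {..?n} - ?M" for l
    proof (cases "2 * l \<le> q")
      case True
      then show ?thesis using that by (intro \<theta>(2)) auto
    next
      case False
      then show ?thesis using \<theta>(1)[of l] by (simp add: alt.prim_def Alt_int_def)
    qed
    then have "\<omega> = (\<Sum>l\<in>?M. (sigma_wedge ^^ l) (\<theta> l))"
      unfolding \<omega> using M by (intro sum.mono_neutral_right) (auto simp: alt.L_pow_0)
    then have "\<omega> es = (\<Sum>l\<in>?M. (sigma_wedge ^^ l) (\<theta> l)) es" by simp
    also have "\<dots> = (\<Sum>l\<in>?M. (sigma_wedge ^^ l) (\<theta> l) es)"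
      by (rule sum_fun_apply)
    also have "\<dots> = (\<Sum>r\<in>lefschetz_degrees ?n q. sigma_wedge_div ((q - r) div 2) (\<psi> r) es)"
    proof (rule sum.reindex_bij_witness[where i = "\<lambda>r. (q - r) div 2" and j = "\<lambda>l. q - 2 * l"])
      fix l assume l: "l \<in> ?M"
      then show "(q - (q - 2 * l)) div 2 = l" by auto
      show m: "q - 2 * l \<in> lefschetz_degrees ?n q"
        using l by (auto simp: lefschetz_degrees_def lefschetz_indices_def)
      with \<open>(q - (q - 2 * l)) div 2 = l\<close>
      show "sigma_wedge_div ((q - (q - 2 * l)) div 2) (\<psi> (q - 2 * l)) es = (sigma_wedge ^^ l) (\<theta> l) es"
        by (simp add: \<psi>_def sigma_wedge_pow_eq)
    next
      fix r assume r: "r \<in> lefschetz_degrees ?n q"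
      note h = lefschetz_degrees_half[OF r]
      show "q - 2 * ((q - r) div 2) = r" using h(1) by linarith
      show "(q - r) div 2 \<in> ?M" unfolding mem_Collect_eq using h(1-3) by linarith
    qed
    finally show "\<omega> es = (\<Sum>r\<in>lefschetz_degrees ?n q. sigma_wedge_div ((q - r) div 2) (\<psi> r) es)" .
  qed
  ultimately show ?thesis by blast
qed

lemma Alt_lefschetz_unique:
  fixes \<psi> :: "nat \<Rightarrow> 'n::finite E list \<Rightarrow> complex"
  assumes \<psi>: "\<And>r. r \<in> lefschetz_degrees CARD('n) q \<Longrightarrow> \<psi> r \<in> Alt0 r"
    and 0: "\<And>es. (\<Sum>r\<in>lefschetz_degrees CARD('n) q. sigma_wedge_div ((q - r) div 2) (\<psi> r) es) = 0"
    and r: "r \<in> lefschetz_degrees CARD('n) q"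
  shows "\<psi> r = (\<lambda>_. 0)"
proof -
  let ?D = "lefschetz_degrees CARD('n) q" and ?h = "\<lambda>r. (q - r) div 2"
  define \<theta> where "\<theta> l es = inverse (fact l) * \<psi> (q - 2 * l) es" for l es
  have inv: "q - 2 * ?h r = r" if "r \<in> ?D" for r
    using lefschetz_degrees_half(1)[OF that] by linarith
  have inj: "inj_on ?h ?D" by (rule inj_on_inverseI[of _ "\<lambda>l. q - 2 * l"]) (rule inv)
  have \<theta>: "\<theta> (?h r) es = inverse (fact (?h r)) * \<psi> r es" if "r \<in> ?D" for r es
    by (simp add: \<theta>_def inv that)
  have "\<theta> (?h r) = 0"
  proof (rule alt.lefschetz_unique[where F = "?h ` ?D" and q = "int q"])
    fix l assume "l \<in> ?h ` ?D"
    then obtain s where s: "s \<in> ?D" "l = ?h s" by auto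
    note h = lefschetz_degrees_half[OF s(1)]
    have eq: "int q - 2 * int l = int s" using h(1) s(2) by linarith
    have "\<theta> l = (\<lambda>es. inverse (fact l) * \<psi> s es)" using \<theta>[OF s(1)] s(2) by blast
    then have "\<theta> l \<in> Alt0 s" using \<psi>[OF s(1)] by (simp add: function_subspace_scale[OF function_subspace_Alt0])
    then show "\<theta> l \<in> alt.prim (int q - 2 * int l)" unfolding eq alt_prim_iff .
    assume "int CARD('n) - (int q - 2 * int l) < int l"
    then show "\<theta> l = 0" using h(2,3) s(2) unfolding eq by linarith
  next
    have "(\<Sum>l\<in>?h ` ?D. (sigma_wedge ^^ l) (\<theta> l)) = (\<Sum>r\<in>?D. (sigma_wedge ^^ ?h r) (\<theta> (?h r)))"
      by (subst sum.reindex[OF inj]) simp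
    also have "\<dots> = (\<Sum>r\<in>?D. sigma_wedge_div (?h r) (\<psi> r))"
    proof (rule sum.cong[OF refl])
      fix r assume "r \<in> ?D"
      then have "\<theta> (?h r) = (\<lambda>es. inverse (fact (?h r)) * \<psi> r es)" using \<theta> by blast
      then show "(sigma_wedge ^^ ?h r) (\<theta> (?h r)) = sigma_wedge_div (?h r) (\<psi> r)" by (simp add: sigma_wedge_div_eq)
    qed
    also have "\<dots> = 0" using 0 by (simp add: fun_eq_iff sum_fun_apply zero_fun_def)
    finally show "(\<Sum>l\<in>?h ` ?D. (sigma_wedge ^^ l) (\<theta> l)) = 0" .
  qed (use r finite_lefschetz_degrees in auto)
  then have "inverse (fact (?h r)) * \<psi> r es = 0" for es
    using \<theta>[OF r, of es] by (simp add: zero_fun_def)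
  then show ?thesis by auto
qed

text \<open>Defined by choice, but uniqueness of the decomposition fixes the component for every r
  in \<open>lefschetz_degrees\<close>; there it is also linear.\<close>

definition lefschetz_part :: "nat \<Rightarrow> ('n::finite E list \<Rightarrow> complex) \<Rightarrow> nat \<Rightarrow> 'n E list \<Rightarrow> complex" where
  "lefschetz_part q \<omega> = (SOME \<psi>. (\<forall>r. \<psi> r \<in> Alt0 r) \<and>
    \<omega> = (\<lambda>es. \<Sum>r\<in>lefschetz_degrees CARD('n) q. sigma_wedge_div ((q - r) div 2) (\<psi> r) es))"

lemma
  fixes \<omega> :: "'n::finite E list \<Rightarrow> complex"
  assumes "\<omega> \<in> Alt q"
  shows lefschetz_part_in: "lefschetz_part q \<omega> r \<in> Alt0 r"
    and lefschetz_part_sum: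
      "\<omega> = (\<lambda>es. \<Sum>r\<in>lefschetz_degrees CARD('n) q. sigma_wedge_div ((q - r) div 2) (lefschetz_part q \<omega> r) es)"
  using someI_ex[OF Alt_lefschetz_decomposition[OF assms], folded lefschetz_part_def] by auto

lemma lefschetz_sum_in_Alt:
  fixes \<psi> :: "nat \<Rightarrow> 'n::finite E list \<Rightarrow> complex"
  assumes "\<And>r. r \<in> lefschetz_degrees CARD('n) q \<Longrightarrow> \<psi> r \<in> Alt0 r"
  shows "(\<lambda>es. \<Sum>r\<in>lefschetz_degrees CARD('n) q. sigma_wedge_div ((q - r) div 2) (\<psi> r) es) \<in> Alt q"
proof (rule function_subspace_sum_plain[OF function_subspace_Alt])
  fix r assume r: "r \<in> lefschetz_degrees CARD('n) q"
  then show "sigma_wedge_div ((q - r) div 2) (\<psi> r) \<in> Alt q"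
    using sigma_wedge_div_in_Alt[OF Alt0_Alt[OF assms[OF r]], of "(q - r) div 2"]
      lefschetz_degrees_half(1)[OF r] by simp
qed

lemma lefschetz_part_eq:
  fixes \<psi> :: "nat \<Rightarrow> 'n::finite E list \<Rightarrow> complex"
  assumes \<psi>: "\<And>r. r \<in> lefschetz_degrees CARD('n) q \<Longrightarrow> \<psi> r \<in> Alt0 r"
    and \<omega>: "\<omega> = (\<lambda>es. \<Sum>r\<in>lefschetz_degrees CARD('n) q. sigma_wedge_div ((q - r) div 2) (\<psi> r) es)"
    and r: "r \<in> lefschetz_degrees CARD('n) q"
  shows "lefschetz_part q \<omega> r = \<psi> r"
proof -
  have Alt: "\<omega> \<in> Alt q" unfolding \<omega> by (rule lefschetz_sum_in_Alt[OF \<psi>])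
  have "(\<lambda>es. lefschetz_part q \<omega> r es + -1 * \<psi> r es) = (\<lambda>_. 0)"
  proof (rule Alt_lefschetz_unique[OF _ _ r])
    fix s assume "s \<in> lefschetz_degrees CARD('n) q"
    then show "(\<lambda>es. lefschetz_part q \<omega> s es + -1 * \<psi> s es) \<in> Alt0 s"
      by (intro function_subspace_combination[OF function_subspace_Alt0] lefschetz_part_in[OF Alt] \<psi>)
  next
    fix es
    show "(\<Sum>r\<in>lefschetz_degrees CARD('n) q. sigma_wedge_div ((q - r) div 2)
        (\<lambda>es. lefschetz_part q \<omega> r es + -1 * \<psi> r es) es) = 0"
      using fun_cong[OF lefschetz_part_sum[OF Alt], of es] fun_cong[OF \<omega>, of es]
      by (simp only: sigma_wedge_div_add sigma_wedge_div_scale sum.distrib) (simp add: sum_negf)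
  qed
  then show ?thesis by (auto simp: fun_eq_iff)
qed

lemma lefschetz_part_linear:
  fixes \<omega> :: "'n::finite E list \<Rightarrow> complex"
  assumes r: "r \<in> lefschetz_degrees CARD('n) q"
  shows "linear_between (Alt q) (Alt0 r) (\<lambda>\<omega> :: 'n E list \<Rightarrow> complex. lefschetz_part q \<omega> r)"
  unfolding linear_between_def
proof (intro conjI ballI allI)
  fix \<phi> \<psi> :: "'n E list \<Rightarrow> complex" and c assume *: "\<phi> \<in> Alt q" "\<psi> \<in> Alt q"
  show "lefschetz_part q (\<lambda>x. \<phi> x + c * \<psi> x) r = (\<lambda>y. lefschetz_part q \<phi> r y + c * lefschetz_part q \<psi> r y)"
  proof (rule lefschetz_part_eq[OF _ _ r])
    show "(\<lambda>y. lefschetz_part q \<phi> r y + c * lefschetz_part q \<psi> r y) \<in> Alt0 r" for r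
      by (intro function_subspace_combination[OF function_subspace_Alt0] lefschetz_part_in *)
    show "(\<lambda>x. \<phi> x + c * \<psi> x) = (\<lambda>es. \<Sum>r\<in>lefschetz_degrees CARD('n) q. sigma_wedge_div ((q - r) div 2)
        (\<lambda>y. lefschetz_part q \<phi> r y + c * lefschetz_part q \<psi> r y) es)"
      using fun_cong[OF lefschetz_part_sum[OF *(1)]] fun_cong[OF lefschetz_part_sum[OF *(2)]]
      by (intro ext) (simp only: sigma_wedge_div_add sigma_wedge_div_scale sum.distrib flip: sum_distrib_left)
  qed
qed (rule lefschetz_part_in)

lemma lefschetz_part_single:
  fixes \<psi> :: "'n::finite E list \<Rightarrow> complex"
  assumes \<psi>: "\<psi> \<in> Alt0 r" and r: "r \<in> lefschetz_degrees CARD('n) q" and s: "s \<in> lefschetz_degrees CARD('n) q"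
  shows "lefschetz_part q (sigma_wedge_div ((q - r) div 2) \<psi>) s = (if s = r then \<psi> else (\<lambda>_. 0))"
proof (rule lefschetz_part_eq[OF _ _ s])
  show "(if s = r then \<psi> else (\<lambda>_. 0)) \<in> Alt0 s" for s
    using \<psi> function_subspace_0[OF function_subspace_Alt0] by auto
  have "sigma_wedge_div ((q - s) div 2) (if s = r then \<psi> else (\<lambda>_. 0)) es =
      (if s = r then sigma_wedge_div ((q - r) div 2) \<psi> es else 0)" for s es
    by (simp add: sigma_wedge_div_zero)
  then show "sigma_wedge_div ((q - r) div 2) \<psi> = (\<lambda>es. \<Sum>s\<in>lefschetz_degrees CARD('n) q.
      sigma_wedge_div ((q - s) div 2) (if s = r then \<psi> else (\<lambda>_. 0)) es)"
    using r finite_lefschetz_degrees by simp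
qed

text \<open>The maps that act by a scalar on each summand while exchanging the power of the
  symplectic form appropriate to q for the one appropriate to q'. The form part of \<gamma> is of
  this kind, and inverting the scalars inverts the map.\<close>

definition lefschetz_map ::
    "nat \<Rightarrow> nat \<Rightarrow> (nat \<Rightarrow> complex) \<Rightarrow> ('n::finite E list \<Rightarrow> complex) \<Rightarrow> 'n E list \<Rightarrow> complex" where
  "lefschetz_map q q' a \<omega> = (\<lambda>es. \<Sum>r\<in>lefschetz_degrees CARD('n) q.
     a r * sigma_wedge_div ((q' - r) div 2) (lefschetz_part q \<omega> r) es)"

lemma lefschetz_map_alt:
  fixes \<omega> :: "'n::finite E list \<Rightarrow> complex"
  assumes "lefschetz_degrees CARD('n) q = lefschetz_degrees CARD('n) q'"
  shows "lefschetz_map q q' a \<omega> = (\<lambda>es. \<Sum>r\<in>lefschetz_degrees CARD('n) q'.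
     sigma_wedge_div ((q' - r) div 2) (\<lambda>es. a r * lefschetz_part q \<omega> r es) es)"
  by (simp add: lefschetz_map_def assms sigma_wedge_div_scale)

lemma linear_between_lefschetz_map:
  assumes "lefschetz_degrees CARD('n) q = lefschetz_degrees CARD('n) q'"
  shows "linear_between (Alt q) (Alt q') (lefschetz_map q q' a :: ('n::finite E list \<Rightarrow> complex) \<Rightarrow> _)"
  unfolding linear_between_def
proof (intro conjI ballI allI)
  fix \<phi> \<psi> :: "'n E list \<Rightarrow> complex" and c assume *: "\<phi> \<in> Alt q" "\<psi> \<in> Alt q"
  show "lefschetz_map q q' a \<phi> \<in> Alt q'"
    unfolding lefschetz_map_alt[OF assms]
    by (intro lefschetz_sum_in_Alt function_subspace_scale[OF function_subspace_Alt0] lefschetz_part_in *)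
  show "lefschetz_map q q' a (\<lambda>x. \<phi> x + c * \<psi> x) = (\<lambda>y. lefschetz_map q q' a \<phi> y + c * lefschetz_map q q' a \<psi> y)"
    unfolding lefschetz_map_def
    by (auto simp: linear_betweenD(2)[OF lefschetz_part_linear *] sigma_wedge_div_add sigma_wedge_div_scale
        sum_distrib_left algebra_simps simp flip: sum.distrib intro!: sum.cong)
qed

lemma lefschetz_map_inverse:
  fixes \<omega> :: "'n::finite E list \<Rightarrow> complex"
  assumes D: "lefschetz_degrees CARD('n) q = lefschetz_degrees CARD('n) q'"
    and a: "\<And>r. r \<in> lefschetz_degrees CARD('n) q \<Longrightarrow> a r \<noteq> 0" and \<omega>: "\<omega> \<in> Alt q"
  shows "lefschetz_map q' q (\<lambda>r. inverse (a r)) (lefschetz_map q q' a \<omega>) = \<omega>"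
proof -
  have *: "lefschetz_part q' (lefschetz_map q q' a \<omega>) r = (\<lambda>es. a r * lefschetz_part q \<omega> r es)"
    if "r \<in> lefschetz_degrees CARD('n) q" for r
    using that unfolding D
    by (intro lefschetz_part_eq[OF _ lefschetz_map_alt[OF D]])
      (auto intro!: function_subspace_scale[OF function_subspace_Alt0] lefschetz_part_in[OF \<omega>])
  have "lefschetz_map q' q (\<lambda>r. inverse (a r)) (lefschetz_map q q' a \<omega>) es = \<omega> es" for es
  proof -
    have "lefschetz_map q' q (\<lambda>r. inverse (a r)) (lefschetz_map q q' a \<omega>) es =
        (\<Sum>r\<in>lefschetz_degrees CARD('n) q. sigma_wedge_div ((q - r) div 2) (lefschetz_part q \<omega> r) es)"
      unfolding lefschetz_map_def[of q' q] D[symmetric]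
      by (intro sum.cong refl) (simp add: * sigma_wedge_div_scale a)
    also have "\<dots> = \<omega> es" using fun_cong[OF lefschetz_part_sum[OF \<omega>], of es] by simp
    finally show ?thesis .
  qed
  then show ?thesis by blast
qed

lemma bij_betw_lefschetz_map:
  assumes D: "lefschetz_degrees CARD('n) q = lefschetz_degrees CARD('n) q'"
    and a: "\<And>r. r \<in> lefschetz_degrees CARD('n) q \<Longrightarrow> a r \<noteq> 0"
  shows "bij_betw (lefschetz_map q q' a) (Alt q) (Alt q' :: ('n::finite E list \<Rightarrow> complex) set)"
proof (rule bij_betw_byWitness[where f' = "lefschetz_map q' q (\<lambda>r. inverse (a r))"])
  show "\<forall>\<omega>\<in>Alt q. lefschetz_map q' q (\<lambda>r. inverse (a r)) (lefschetz_map q q' a \<omega>) = (\<omega> :: 'n E list \<Rightarrow> complex)"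
    using lefschetz_map_inverse[OF D, of a] a by blast
  show "\<forall>\<omega>\<in>Alt q'. lefschetz_map q q' a (lefschetz_map q' q (\<lambda>r. inverse (a r)) \<omega>) = (\<omega> :: 'n E list \<Rightarrow> complex)"
    using lefschetz_map_inverse[OF D[symmetric], of "\<lambda>r. inverse (a r)"] a by (simp add: D)
  show "lefschetz_map q q' a ` Alt q \<subseteq> (Alt q' :: ('n E list \<Rightarrow> complex) set)"
    using linear_betweenD(1)[OF linear_between_lefschetz_map[OF D]] by blast
  show "lefschetz_map q' q (\<lambda>r. inverse (a r)) ` Alt q' \<subseteq> (Alt q :: ('n E list \<Rightarrow> complex) set)"
    using linear_betweenD(1)[OF linear_between_lefschetz_map[OF D[symmetric]]] by blast
qed

lemma lefschetz_map_single:
  fixes \<psi> :: "'n::finite E list \<Rightarrow> complex"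
  assumes \<psi>: "\<psi> \<in> Alt0 r" and r: "r \<in> lefschetz_degrees CARD('n) q"
  shows "lefschetz_map q q' a (sigma_wedge_div ((q - r) div 2) \<psi>) = (\<lambda>es. a r * sigma_wedge_div ((q' - r) div 2) \<psi> es)"
proof
  fix es
  have "lefschetz_map q q' a (sigma_wedge_div ((q - r) div 2) \<psi>) es =
      (\<Sum>s\<in>lefschetz_degrees CARD('n) q. if s = r then a r * sigma_wedge_div ((q' - r) div 2) \<psi> es else 0)"
    unfolding lefschetz_map_def
    by (intro sum.cong refl) (simp add: lefschetz_part_single[OF \<psi> r] sigma_wedge_div_zero)
  then show "lefschetz_map q q' a (sigma_wedge_div ((q - r) div 2) \<psi>) es = a r * sigma_wedge_div ((q' - r) div 2) \<psi> es"
    using r finite_lefschetz_degrees by simp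
qed

section \<open>The volume form and equivariance\<close>

abbreviation unit_form :: "'n::finite E list \<Rightarrow> complex" where
  "unit_form \<equiv> (\<lambda>es. if es = [] then 1 else 0)"

lemma unit_form_in_Alt0: "(unit_form :: 'n::finite E list \<Rightarrow> complex) \<in> Alt0 0"
proof -
  have "(unit_form :: 'n E list \<Rightarrow> complex) \<in> Alt 0" by (simp add: Alt_0)
  from this sigma_contr_Alt_less_2[OF this] show ?thesis by (simp add: Alt0_def)
qed

lemma lefschetz_degrees_top: "lefschetz_degrees n (2 * n) = {0}"
  by (auto simp: lefschetz_degrees_def lefschetz_indices_def)

lemma vol_in_Alt: "(vol :: 'n::finite E list \<Rightarrow> complex) \<in> Alt (2 * CARD('n))"
  using sigma_wedge_div_in_Alt[OF Alt0_Alt[OF unit_form_in_Alt0], of "CARD('n)"] by (simp add: vol_def)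

text \<open>In degree 2n only r = 0 is admissible, and forms of degree 0 are scalars.\<close>

lemma Alt_top:
  fixes \<omega> :: "'n::finite E list \<Rightarrow> complex"
  assumes "\<omega> \<in> Alt (2 * CARD('n))"
  shows "\<exists>c. \<omega> = (\<lambda>es. c * vol es)"
proof -
  obtain \<psi> :: "nat \<Rightarrow> 'n E list \<Rightarrow> complex" where "\<And>r. \<psi> r \<in> Alt0 r" and \<omega>: "\<omega> = sigma_wedge_div CARD('n) (\<psi> 0)"
    using Alt_lefschetz_decomposition[OF assms] by (auto simp: lefschetz_degrees_top)
  then have "\<psi> 0 \<in> Alt 0" by (simp add: Alt0_def)
  then have "\<psi> 0 = (\<lambda>es. \<psi> 0 [] * unit_form es)" by (auto simp: Alt_0)
  then have "\<omega> = sigma_wedge_div CARD('n) (\<lambda>es. \<psi> 0 [] * unit_form es)" using \<omega> by metis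
  also have "\<dots> = (\<lambda>es. \<psi> 0 [] * vol es)" by (simp only: sigma_wedge_div_scale vol_def)
  finally show ?thesis by blast
qed

text \<open>Uniqueness of the Lefschetz components would otherwise force the unit form to
  vanish.\<close>

lemma vol_nonzero: "\<exists>es. (vol es :: complex) \<noteq> 0"
proof (rule ccontr)
  assume "\<nexists>es. (vol (es :: 'a E list) :: complex) \<noteq> 0"
  then have "(unit_form :: 'a E list \<Rightarrow> complex) = (\<lambda>_. 0)"
    using Alt_lefschetz_unique[of "2 * CARD('a)" "\<lambda>_. unit_form :: 'a E list \<Rightarrow> complex" 0]
    by (simp add: lefschetz_degrees_top unit_form_in_Alt0 vol_def)
  then show False by (metis (full_types) zero_neq_one)
qed

section \<open>The action of Sp(n) on forms\<close>

lemma matrix_inv_inverse: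
  assumes "invertible A"
  shows "A ** matrix_inv A = mat 1" "matrix_inv A ** A = mat 1"
  using someI_ex[OF assms[unfolded invertible_def]] unfolding matrix_inv_def by auto

text \<open>Preserving a non-degenerate form makes b injective, hence invertible, and only then is
  the chosen \<open>matrix_inv b\<close> an inverse.\<close>

lemma Sp_inverse:
  assumes b: "b \<in> Sp"
  shows "b ** matrix_inv b = mat 1" "matrix_inv b ** b = mat 1"
proof -
  have "inj ((*v) b)"
    unfolding vec.inj_iff_eq_0
  proof (intro allI impI)
    fix v assume v: "b *v v = 0"
    have "v $ i = 0" for i
    proof -
      have "symp v w = 0" for w
      proof -
        have "symp v w = symp (b *v v) (b *v w)" using b by (simp add: Sp_def)
        then show ?thesis by (simp add: v symp_def)
      qed
      then have "sharp v = 0" by (simp add: sharp_def vec_eq_iff)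
      then have "sharp v $ j = 0" for j by simp
      then show ?thesis using sharp_nth[of v] by (cases i) (metis neg_equal_0_iff_equal)+
    qed
    then show "v = 0" by (simp add: vec_eq_iff)
  qed
  then obtain c where "c ** b = mat 1" using matrix_left_invertible_injective by blast
  then have "invertible b" using invertible_left_inverse by blast
  then show "b ** matrix_inv b = mat 1" "matrix_inv b ** b = mat 1" by (rule matrix_inv_inverse)+
qed

lemma symp_matrix_inv:
  assumes "b \<in> Sp"
  shows "symp (matrix_inv b *v v) (matrix_inv b *v w) = symp v w"
proof -
  have "symp (matrix_inv b *v v) (matrix_inv b *v w) = symp (b *v (matrix_inv b *v v)) (b *v (matrix_inv b *v w))"
    using assms by (simp add: Sp_def)
  then show ?thesis by (simp add: matrix_vector_mul_assoc Sp_inverse[OF assms])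
qed

lemma del_map: "del i (map f xs) = map f (del i xs)"
  by (simp add: del_def take_map drop_map)

lemma contr_alt_act: "contr v (alt_act b \<omega>) = alt_act b (contr (matrix_inv b *v v) \<omega>)"
  by (auto simp: contr_def alt_act_def)

lemma alt_act_in_Alt: "\<omega> \<in> Alt m \<Longrightarrow> alt_act b \<omega> \<in> Alt m"
proof (induction m arbitrary: \<omega>)
  case 0
  then show ?case by (simp add: Alt_0 alt_act_def)
next
  case (Suc m)
  then show ?case
    unfolding Alt_Suc_iff contr_alt_act by (simp add: alt_act_def matrix_vector_right_distrib vector_scalar_commute)
qed

lemma sigma_wedge_alt_act:
  assumes b: "b \<in> Sp"
  shows "sigma_wedge (alt_act b \<omega>) = alt_act b (sigma_wedge \<omega>)"
proof
  fix es
  show "sigma_wedge (alt_act b \<omega>) es = alt_act b (sigma_wedge \<omega>) es"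
    unfolding sigma_wedge_def alt_act_def
    by (auto intro!: sum.cong simp: symp_matrix_inv[OF b] del_map)
qed

lemma sigma_wedge_div_alt_act:
  assumes b: "b \<in> Sp"
  shows "sigma_wedge_div l (alt_act b \<omega>) = alt_act b (sigma_wedge_div l \<omega>)"
proof -
  have "(sigma_wedge ^^ l) (alt_act b \<omega>) = alt_act b ((sigma_wedge ^^ l) \<omega>)"
    by (induction l) (simp_all add: sigma_wedge_alt_act[OF b])
  then show ?thesis by (simp add: sigma_wedge_div_def alt_act_def fun_eq_iff)
qed

text \<open>The trace is a sum over a fixed basis, which the group moves, whereas wedging with the
  symplectic form visibly commutes with the action. Trace-freeness is therefore tested by a power of
  \<open>sigma_wedge\<close>, using \<open>alt.primI\<close>.\<close>

lemma alt_act_in_Alt0: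
  fixes \<psi> :: "'n::finite E list \<Rightarrow> complex"
  assumes b: "b \<in> Sp" and \<psi>: "\<psi> \<in> Alt0 r"
  shows "alt_act b \<psi> \<in> Alt0 r"
proof (cases "r \<le> CARD('n)")
  case True
  let ?a = "CARD('n) - r + 1"
  have "sigma_wedge_div ?a (alt_act b \<psi>) = (\<lambda>_. 0)"
    unfolding sigma_wedge_div_alt_act[OF b]
    using sigma_wedge_div_Alt0_eq_0[OF \<psi>, of ?a] True by (simp add: alt_act_def)
  then have "(sigma_wedge ^^ ?a) (alt_act b \<psi>) = 0"
    by (simp only: sigma_wedge_div_def fun_eq_iff zero_fun_def divide_eq_0_iff fact_nonzero simp_thms)
  moreover have "alt_act b \<psi> \<in> Alt_int (int r)"
    using alt_act_in_Alt[OF Alt0_Alt[OF \<psi>]] by (simp add: Alt_int_def)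
  ultimately have "alt_act b \<psi> \<in> alt.prim (int r)"
    using True by (intro alt.primI[of _ "int r" ?a]) auto
  then show ?thesis by (simp add: alt_prim_iff)
next
  case False
  then have "\<psi> = (\<lambda>_. 0)" using Alt0_eq_0[OF \<psi>] by simp
  then show ?thesis by (simp add: alt_act_def function_subspace_0[OF function_subspace_Alt0])
qed

lemma lefschetz_map_alt_act:
  fixes \<omega> :: "'n::finite E list \<Rightarrow> complex"
  assumes b: "b \<in> Sp" and \<omega>: "\<omega> \<in> Alt q"
  shows "lefschetz_map q q' a (alt_act b \<omega>) = alt_act b (lefschetz_map q q' a \<omega>)"
proof -
  have "lefschetz_part q (alt_act b \<omega>) r = alt_act b (lefschetz_part q \<omega> r)"
    if "r \<in> lefschetz_degrees CARD('n) q" for r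
  proof (rule lefschetz_part_eq[OF alt_act_in_Alt0[OF b lefschetz_part_in[OF \<omega>]] _ that])
    show "alt_act b \<omega> = (\<lambda>es. \<Sum>r\<in>lefschetz_degrees CARD('n) q.
        sigma_wedge_div ((q - r) div 2) (alt_act b (lefschetz_part q \<omega> r)) es)"
      unfolding sigma_wedge_div_alt_act[OF b] using fun_cong[OF lefschetz_part_sum[OF \<omega>]]
      by (simp add: alt_act_def)
  qed
  then show ?thesis
    by (auto simp: lefschetz_map_def sigma_wedge_div_alt_act[OF b] intro!: sum.cong) (simp add: alt_act_def)
qed

lemma vol_alt_act:
  assumes "b \<in> Sp"
  shows "vol (map ((*v) (matrix_inv b)) es) = vol es"
proof -
  have "alt_act b unit_form = unit_form" by (simp add: alt_act_def)
  then have "alt_act b vol = vol" unfolding vol_def using sigma_wedge_div_alt_act[OF assms, of _ unit_form] by simp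
  then show ?thesis by (metis alt_act_def)
qed

section \<open>Existence of the isomorphism \<gamma>\<close>

lemma vol_tensor_apply: "vol_tensor \<omega> (es, es') = vol es * \<omega> es'"
  by (simp add: vol_tensor_def)

lemma linear_between_vol_tensor:
  "linear_between (Alt m) (tensor_space (Alt (2 * CARD('n))) (Alt m)) (vol_tensor :: ('n::finite E list \<Rightarrow> complex) \<Rightarrow> _)"
  unfolding linear_between_def
proof (intro conjI ballI allI)
  fix \<omega> :: "'n E list \<Rightarrow> complex" assume "\<omega> \<in> Alt m"
  then show "vol_tensor \<omega> \<in> tensor_space (Alt (2 * CARD('n))) (Alt m)"
    using function_subspace_scale[OF function_subspace_Alt vol_in_Alt]
    by (auto simp: tensor_space_def vol_tensor_apply mult.commute[of "vol _"])
      (simp add: function_subspace_scale[OF function_subspace_Alt] mult.commute[of _ "vol _"])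
qed (auto simp: vol_tensor_def fun_eq_iff algebra_simps)

text \<open>Top forms are multiples of \<open>vol\<close>, so an element of the tensor product is
  recovered from its slice at one list e0 with non-zero volume, after division by that
  volume.\<close>

lemma bij_betw_vol_tensor:
  "bij_betw (vol_tensor :: ('n::finite E list \<Rightarrow> complex) \<Rightarrow> _) (Alt m) (tensor_space (Alt (2 * CARD('n))) (Alt m))"
proof -
  obtain e0 :: "'n E list" where e0: "vol e0 \<noteq> 0" using vol_nonzero by blast
  show ?thesis
  proof (rule bij_betw_byWitness[where f' = "\<lambda>\<Phi> es'. inverse (vol e0) * \<Phi> (e0, es')"])
    show "\<forall>\<omega>\<in>Alt m. (\<lambda>es'. inverse (vol e0) * vol_tensor \<omega> (e0, es')) = \<omega>"
      using e0 by (simp add: vol_tensor_apply)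
    show "vol_tensor ` Alt m \<subseteq> tensor_space (Alt (2 * CARD('n))) (Alt m :: ('n E list \<Rightarrow> complex) set)"
      using linear_betweenD(1)[OF linear_between_vol_tensor] by blast
    show "(\<lambda>\<Phi> es'. inverse (vol e0) * \<Phi> (e0, es')) ` tensor_space (Alt (2 * CARD('n))) (Alt m) \<subseteq> Alt m"
      by (auto simp: tensor_space_def intro!: function_subspace_scale[OF function_subspace_Alt])
    show "\<forall>\<Phi>\<in>tensor_space (Alt (2 * CARD('n))) (Alt m). vol_tensor (\<lambda>es'. inverse (vol e0) * \<Phi> (e0, es')) = \<Phi>"
    proof (intro ballI ext)
      fix \<Phi> :: "'n E list \<times> 'n E list \<Rightarrow> complex" and x assume \<Phi>: "\<Phi> \<in> tensor_space (Alt (2 * CARD('n))) (Alt m)"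
      obtain es es' :: "'n E list" where x: "x = (es, es')" by (cases x) auto
      have "(\<lambda>es. \<Phi> (es, es')) \<in> Alt (2 * CARD('n))" using \<Phi> by (simp add: tensor_space_def)
      from Alt_top[OF this] obtain c where "\<Phi> (es, es') = c * vol es" for es by metis
      then show "vol_tensor (\<lambda>es'. inverse (vol e0) * \<Phi> (e0, es')) x = \<Phi> x"
        using e0 by (simp add: x vol_tensor_apply)
    qed
  qed
qed

lemma linear_between_comp:
  assumes "linear_between V W F" "linear_between W X G"
  shows "linear_between V X (G \<circ> F)"
  using assms by (simp add: linear_between_def)

lemma gamma_coeff_nonzero: "gamma_coeff n k q l \<noteq> 0"
  by (simp add: gamma_coeff_def del: fact_Suc)

lemma lefschetz_degrees_iff:
  "r \<in> lefschetz_degrees n q \<longleftrightarrow> r \<le> n \<and> q \<le> 2 * n - r \<and> (\<exists>l. r + 2 * l = q)"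
proof
  assume "r \<in> lefschetz_degrees n q"
  then show "r \<le> n \<and> q \<le> 2 * n - r \<and> (\<exists>l. r + 2 * l = q)"
    using lefschetz_degrees_half(1)[of r n q, symmetric] unfolding lefschetz_degrees_def lefschetz_indices_def by blast
next
  assume "r \<le> n \<and> q \<le> 2 * n - r \<and> (\<exists>l. r + 2 * l = q)"
  then obtain l where "q = r + 2 * l" "r \<le> n" "q \<le> 2 * n - r" by auto
  then show "r \<in> lefschetz_degrees n q"
    by (simp add: lefschetz_degrees_def lefschetz_indices_def)
qed

text \<open>The required values on the Lefschetz summands describe a diagonal map followed by
  tensoring with the volume form. It is bijective because its scalars are non-zero and the degrees q
  and 2n - q have the same summands; equivariance comes from that of the Lefschetz components and
  the invariance of the volume form.\<close>

lemma is_gamma_exists: "\<exists>\<gamma> :: nat \<Rightarrow> 'n::finite form \<Rightarrow> 'n dual_form. is_gamma k \<gamma>"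
proof -
  define G where "G q = (lefschetz_map q (2 * CARD('n) - q) (\<lambda>r. gamma_coeff CARD('n) k q ((q - r) div 2))
    :: ('n E list \<Rightarrow> complex) \<Rightarrow> 'n E list \<Rightarrow> complex)" for q
  define \<gamma> where "\<gamma> q = tensor_op (id :: (H list \<Rightarrow> complex) \<Rightarrow> _) (vol_tensor \<circ> G q)" for q
  have "is_gamma k \<gamma>"
    unfolding is_gamma_def
  proof (intro allI impI conjI)
    fix q :: nat assume q: "q \<le> 2 * CARD('n)"
    have D: "lefschetz_degrees CARD('n) q = lefschetz_degrees CARD('n) (2 * CARD('n) - q)"
      by (rule lefschetz_degrees_mirror[OF q, symmetric])
    have lin: "linear_between (Alt q) (tensor_space (Alt (2 * CARD('n))) (Alt (2 * CARD('n) - q))) (vol_tensor \<circ> G q)"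
      unfolding G_def by (rule linear_between_comp[OF linear_between_lefschetz_map[OF D] linear_between_vol_tensor])
    have bij: "bij_betw (vol_tensor \<circ> G q) (Alt q) (tensor_space (Alt (2 * CARD('n))) (Alt (2 * CARD('n) - q)))"
      unfolding G_def using gamma_coeff_nonzero
      by (intro bij_betw_trans[OF bij_betw_lefschetz_map[OF D] bij_betw_vol_tensor]) auto
    show "bij_betw (\<gamma> q) (form_space k q) (dual_form_space k q)"
      unfolding \<gamma>_def form_space_def dual_form_space_def
      by (intro bij_betw_tensor_op_id lin bij function_subspace_Sym function_subspace_Alt finitely_determined_Alt
          function_subspace_tensor_space finitely_determined_tensor_space)
    show "linear_between (form_space k q) (dual_form_space k q) (\<gamma> q)"
      unfolding \<gamma>_def form_space_def dual_form_space_def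
      by (intro linear_between_tensor_op_id lin function_subspace_Sym function_subspace_Alt finitely_determined_Alt)
    show "\<forall>a\<in>Sp. \<forall>b\<in>Sp. \<forall>\<phi>\<in>form_space k q. \<gamma> q (form_act a b \<phi>) = dual_form_act a b (\<gamma> q \<phi>)"
    proof (intro ballI ext)
      fix a :: "complex^(unit+unit)^(unit+unit)" and b :: "complex^('n+'n)^('n+'n)" and \<phi> :: "'n form" and x
      assume b: "b \<in> Sp" and \<phi>: "\<phi> \<in> form_space k q"
      obtain xs :: "H list" and es es' :: "'n E list" where x: "x = (xs, (es, es'))" by (cases x) auto
      let ?\<omega> = "\<lambda>y. \<phi> (map (\<lambda>\<alpha>. \<alpha> v* a) xs, y)"
      have \<omega>: "?\<omega> \<in> Alt q" using \<phi> by (simp add: form_space_def tensor_space_def)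
      have "G q (alt_act b ?\<omega>) = alt_act b (G q ?\<omega>)"
        unfolding G_def by (rule lefschetz_map_alt_act[OF b \<omega>])
      then show "\<gamma> q (form_act a b \<phi>) x = dual_form_act a b (\<gamma> q \<phi>) x"
        by (simp add: x \<gamma>_def tensor_op_def sym_act_def vol_tensor_apply vol_alt_act[OF b] alt_act_def)
    qed
    fix r l assume rl: "r \<le> CARD('n) \<and> r + 2 * l = q \<and> q \<le> 2 * CARD('n) - r"
    then have r: "r \<in> lefschetz_degrees CARD('n) q" and l: "(q - r) div 2 = l" by (auto simp: lefschetz_degrees_iff)
    show "\<forall>\<psi>\<in>tensor_space (Sym (k + q)) (Alt0 r). \<gamma> q (tensor_op id (sigma_wedge_div l) \<psi>) =
         (\<lambda>x. gamma_coeff CARD('n) k q l * tensor_op id (vol_tensor \<circ> sigma_wedge_div (CARD('n) - r - l)) \<psi> x)"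
    proof (intro ballI ext)
      fix \<psi> :: "'n form" and x assume \<psi>: "\<psi> \<in> tensor_space (Sym (k + q)) (Alt0 r)"
      obtain xs :: "H list" and es es' :: "'n E list" where x: "x = (xs, (es, es'))" by (cases x) auto
      have "(\<lambda>y. \<psi> (xs, y)) \<in> Alt0 r" using \<psi> by (simp add: tensor_space_def)
      from lefschetz_map_single[OF this r, of "2 * CARD('n) - q" "\<lambda>r. gamma_coeff CARD('n) k q ((q - r) div 2)",
          unfolded lefschetz_degrees_half(4)[OF r] l, folded G_def]
      show "\<gamma> q (tensor_op id (sigma_wedge_div l) \<psi>) x =
         gamma_coeff CARD('n) k q l * tensor_op id (vol_tensor \<circ> sigma_wedge_div (CARD('n) - r - l)) \<psi> x"
        by (simp add: x \<gamma>_def tensor_op_def vol_tensor_apply)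
    qed
  qed
  then show ?thesis by blast
qed

section \<open>Finitary operators\<close>

text \<open>A condition on arbitrary functions, not only on elements of a fibre. It allows operators
  acting on different variables to be exchanged.\<close>

definition finitary :: "(('x \<Rightarrow> complex) \<Rightarrow> 'y \<Rightarrow> complex) \<Rightarrow> bool" where
  "finitary F \<longleftrightarrow> (\<forall>y. \<exists>Z a. finite Z \<and> (\<forall>\<phi>. F \<phi> y = (\<Sum>z\<in>Z. a z * \<phi> z)))"

lemma finitary_linear:
  assumes "finitary F"
  shows "F (\<lambda>x. \<phi> x + \<psi> x) y = F \<phi> y + F \<psi> y" "F (\<lambda>x. c * \<phi> x) y = c * F \<phi> y" "F (\<lambda>_. 0) y = 0"
    "F (\<lambda>x. \<phi> x - \<psi> x) y = F \<phi> y - F \<psi> y"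
    "F (\<lambda>x. \<Sum>i\<in>I. f i x) y = (\<Sum>i\<in>I. F (f i) y)"
proof -
  obtain Z a where F: "finite Z" "\<And>\<phi>. F \<phi> y = (\<Sum>z\<in>Z. a z * \<phi> z)"
    using assms unfolding finitary_def by metis
  show "F (\<lambda>x. \<phi> x + \<psi> x) y = F \<phi> y + F \<psi> y" "F (\<lambda>x. c * \<phi> x) y = c * F \<phi> y" "F (\<lambda>_. 0) y = 0"
    "F (\<lambda>x. \<phi> x - \<psi> x) y = F \<phi> y - F \<psi> y"
    by (simp_all add: F(2) algebra_simps sum.distrib sum_subtractf sum_distrib_left)
  show "F (\<lambda>x. \<Sum>i\<in>I. f i x) y = (\<Sum>i\<in>I. F (f i) y)"
    by (simp add: F(2) sum_distrib_left sum.swap[of _ _ I])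
qed

text \<open>Different indices may evaluate at the same point, so the coefficients are collected over
  the fibres of g.\<close>

lemma finitary_evaluation_sum:
  assumes "finite I"
  shows "\<exists>Z a. finite Z \<and> (\<forall>\<phi>. (\<Sum>i\<in>I. c i * \<phi> (g i)) = (\<Sum>z\<in>Z. a z * \<phi> z :: complex))"
proof (intro exI conjI allI)
  show "finite (g ` I)" using assms by simp
  fix \<phi> :: "'b \<Rightarrow> complex"
  show "(\<Sum>i\<in>I. c i * \<phi> (g i)) = (\<Sum>z\<in>g ` I. (\<Sum>i\<in>{i \<in> I. g i = z}. c i) * \<phi> z)"
    unfolding sum.image_gen[OF assms, of _ g] by (simp add: sum_distrib_right)
qed

lemma finitary_id: "finitary id"
  unfolding finitary_def by (intro allI exI[of _ "{_}"] exI[of _ "\<lambda>_. 1"]) auto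

lemma finitary_comp:
  assumes "finitary F" "finitary G"
  shows "finitary (\<lambda>\<phi>. F (G \<phi>))"
  unfolding finitary_def
proof
  fix y
  obtain Z a where F: "finite Z" "\<And>\<phi>. F \<phi> y = (\<Sum>z\<in>Z. a z * \<phi> z)"
    using assms(1) unfolding finitary_def by metis
  obtain Z' a' where G: "\<And>z. finite (Z' z)" "\<And>z \<phi>. G \<phi> z = (\<Sum>w\<in>Z' z. a' z w * \<phi> w)"
    using assms(2) unfolding finitary_def by metis
  have "F (G \<phi>) y = (\<Sum>(z, w)\<in>Sigma Z Z'. (\<lambda>(z, w). a z * a' z w) (z, w) * \<phi> (snd (z, w)))" for \<phi>
    by (simp add: F G sum_distrib_left mult.assoc sum.Sigma)
  then have *: "F (G \<phi>) y = (\<Sum>i\<in>Sigma Z Z'. (case i of (z, w) \<Rightarrow> a z * a' z w) * \<phi> (snd i))" for \<phi>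
    by (simp add: case_prod_unfold)
  show "\<exists>Z a. finite Z \<and> (\<forall>\<phi>. F (G \<phi>) y = (\<Sum>z\<in>Z. a z * \<phi> z))"
    unfolding * by (rule finitary_evaluation_sum) (use F G in auto)
qed

lemma finitary_add:
  assumes "finitary F" "finitary G"
  shows "finitary (\<lambda>\<phi> y. F \<phi> y + c * G \<phi> y)"
  unfolding finitary_def
proof
  fix y
  obtain Z a where F: "finite Z" "\<And>\<phi>. F \<phi> y = (\<Sum>z\<in>Z. a z * \<phi> z)"
    using assms(1) unfolding finitary_def by metis
  obtain Z' a' where G: "finite Z'" "\<And>\<phi>. G \<phi> y = (\<Sum>z\<in>Z'. a' z * \<phi> z)"
    using assms(2) unfolding finitary_def by metis
  have *: "F \<phi> y + c * G \<phi> y = (\<Sum>i\<in>Z <+> Z'. (case i of Inl z \<Rightarrow> a z | Inr z \<Rightarrow> c * a' z) *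
      \<phi> (case i of Inl z \<Rightarrow> z | Inr z \<Rightarrow> z))" for \<phi>
    by (simp add: sum.Plus F G sum_distrib_left mult.assoc)
  show "\<exists>Z a. finite Z \<and> (\<forall>\<phi>. F \<phi> y + c * G \<phi> y = (\<Sum>z\<in>Z. a z * \<phi> z))"
    unfolding * by (rule finitary_evaluation_sum) (use F G in auto)
qed

lemma finitary_wedge: "finitary (wedge \<eta>)"
  unfolding finitary_def wedge_def by (intro allI finitary_evaluation_sum) simp

lemma finitary_sym_mult: "finitary (sym_mult h)"
  unfolding finitary_def sym_mult_def by (intro allI finitary_evaluation_sum) simp

lemma finitary_contr: "finitary (contr e)" and finitary_sym_contr: "finitary (sym_contr \<alpha>)"
  unfolding finitary_def contr_def sym_contr_def
  by (intro allI exI[of _ "{_}"] exI[of _ "\<lambda>_. 1"]; auto)+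

lemma finitary_sigma_wedge: "finitary sigma_wedge"
  unfolding finitary_def
proof
  fix es
  have *: "sigma_wedge \<omega> es = (\<Sum>x\<in>Sigma {..<length es} lessThan. (case x of (j, i) \<Rightarrow>
     (-1)^(i+j+1) * symp (es ! i) (es ! j)) * \<omega> (case x of (j, i) \<Rightarrow> del i (del j es)))" for \<omega>
    unfolding sigma_wedge_def by (subst sum.Sigma) (auto simp: case_prod_unfold)
  show "\<exists>Z a. finite Z \<and> (\<forall>\<phi>. sigma_wedge \<phi> es = (\<Sum>z\<in>Z. a z * \<phi> z))"
    unfolding * by (rule finitary_evaluation_sum) auto
qed

lemma finitary_scale: "finitary F \<Longrightarrow> finitary (\<lambda>\<phi> y. c * F \<phi> y)"
  unfolding finitary_def
proof
  fix y assume "\<forall>y. \<exists>Z a. finite Z \<and> (\<forall>\<phi>. F \<phi> y = (\<Sum>z\<in>Z. a z * \<phi> z))"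
  then obtain Z a where F: "finite Z" "\<And>\<phi>. F \<phi> y = (\<Sum>z\<in>Z. a z * \<phi> z)" by metis
  show "\<exists>Z a. finite Z \<and> (\<forall>\<phi>. c * F \<phi> y = (\<Sum>z\<in>Z. a z * \<phi> z))"
    by (intro exI[of _ Z] exI[of _ "\<lambda>z. c * a z"]) (simp add: F sum_distrib_left mult.assoc)
qed

lemma finitary_sigma_wedge_div: "finitary (sigma_wedge_div l)"
proof -
  have "finitary (sigma_wedge ^^ l)"
  proof (induction l)
    case 0
    then show ?case using finitary_id by (simp add: id_def)
  next
    case (Suc l)
    from finitary_comp[OF finitary_sigma_wedge this] show ?case by (simp add: o_def)
  qed
  from finitary_scale[OF this, of "inverse (fact l)"] show ?thesis
    by (simp add: sigma_wedge_div_def[abs_def] divide_inverse mult.commute)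
qed

text \<open>\<open>tensor_op\<close> applies its second operator first. Expanding F in finitely many
  values and using linearity of G shows that the order is immaterial.\<close>

lemma tensor_op_swap:
  fixes F :: "('a \<Rightarrow> complex) \<Rightarrow> 'b \<Rightarrow> complex" and G :: "('c \<Rightarrow> complex) \<Rightarrow> 'd \<Rightarrow> complex"
  assumes "finitary F" "finitary G"
  shows "tensor_op id G (tensor_op F id \<phi>) = tensor_op F G \<phi>"
proof
  fix y :: "'b \<times> 'd"
  obtain xs es where y: "y = (xs, es)" by (cases y)
  obtain Z a where F: "finite Z" "\<And>\<phi>. F \<phi> xs = (\<Sum>z\<in>Z. a z * \<phi> z)"
    using assms(1) unfolding finitary_def by metis
  show "tensor_op id G (tensor_op F id \<phi>) y = tensor_op F G \<phi> y"
    by (simp add: y tensor_op_def F(2) finitary_linear[OF assms(2)])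
qed

lemma tensor_op_comp:
  assumes "finitary F" "finitary G"
  shows "tensor_op id G (tensor_op F G' \<phi>) = tensor_op F (\<lambda>\<omega>. G (G' \<omega>)) \<phi>"
proof -
  have "tensor_op F G' \<phi> = tensor_op F id (tensor_op id G' \<phi>)" by (simp add: tensor_op_def)
  then have "tensor_op id G (tensor_op F G' \<phi>) = tensor_op F G (tensor_op id G' \<phi>)"
    by (simp add: tensor_op_swap[OF assms])
  then show ?thesis by (simp add: tensor_op_def)
qed

lemma tensor_op_cong:
  assumes "\<phi> \<in> tensor_space V W" "\<And>\<omega>. \<omega> \<in> W \<Longrightarrow> G \<omega> = G' \<omega>"
  shows "tensor_op F G \<phi> = tensor_op F G' \<phi>"
  using assms by (simp add: tensor_op_def tensor_space_def)

lemma tensor_op_in: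
  assumes F: "finitary F" "\<And>s. s \<in> V \<Longrightarrow> F s \<in> V'" and G: "finitary G" "\<And>\<omega>. \<omega> \<in> W \<Longrightarrow> G \<omega> \<in> W'"
    and W: "function_subspace V'" "function_subspace W'" and \<phi>: "\<phi> \<in> tensor_space V W"
  shows "tensor_op F G \<phi> \<in> tensor_space V' W'"
  unfolding tensor_space_def
proof (intro CollectI conjI allI)
  fix xs
  obtain Z a where Z: "finite Z" "\<And>\<phi>. F \<phi> xs = (\<Sum>z\<in>Z. a z * \<phi> z)"
    using F(1) unfolding finitary_def by metis
  show "(\<lambda>y. tensor_op F G \<phi> (xs, y)) \<in> W'"
    using \<phi> by (simp add: tensor_op_def Z(2) tensor_space_def function_subspace_sum[OF W(2)] G(2))
next
  fix es
  obtain Z a where Z: "finite Z" "\<And>\<phi>. G \<phi> es = (\<Sum>z\<in>Z. a z * \<phi> z)"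
    using G(1) unfolding finitary_def by metis
  have "tensor_op F G \<phi> (x, es) = (\<Sum>z\<in>Z. a z * F (\<lambda>x. \<phi> (x, z)) x)" for x
    by (simp add: tensor_op_def Z(2) finitary_linear[OF F(1)])
  then show "(\<lambda>x. tensor_op F G \<phi> (x, es)) \<in> V'"
    using \<phi> by (simp add: tensor_space_def function_subspace_sum[OF W(1)] F(2))
qed

section \<open>Clifford multiplication and the symbols\<close>

lemma sigma_wedge_0: "sigma_wedge (\<lambda>_. 0) = (\<lambda>_. 0)"
  using sigma_wedge_scale[of 0 "\<lambda>_. 0"] by simp

text \<open>If a multiple of the symplectic form is primitive, a power of \<open>sigma_wedge\<close>
  kills \<theta>, so \<theta> is itself primitive by \<open>alt.primI\<close>. The sl(2) relation
  then reads 0 = (n - j)\<theta>, with n > j.\<close>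

lemma Alt0_inter_sigma_wedge:
  fixes \<theta> :: "'n::finite E list \<Rightarrow> complex"
  assumes \<theta>: "\<theta> \<in> Alt j" and 0: "sigma_wedge \<theta> \<in> Alt0 (j + 2)"
  shows "sigma_wedge \<theta> = (\<lambda>_. 0)"
proof (cases "j + 2 \<le> CARD('n)")
  case False
  then show ?thesis using Alt0_eq_0[OF 0] by simp
next
  case True
  let ?a = "CARD('n) - j + 1"
  \<comment> \<open>Here ?a is the exponent demanded by \<open>alt.primI\<close> for \<theta>. On
    its multiple this leaves the power n - j, one more than what already kills primitive forms of
    degree j + 2.\<close>
  have a: "?a = Suc (Suc (CARD('n) - (j + 2) + 1))" using True by simp
  have "sigma_wedge \<theta> \<in> alt.prim (int (j + 2))" using 0 by (simp only: alt_prim_iff)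
  then have "(sigma_wedge ^^ Suc (CARD('n) - (j + 2) + 1)) (sigma_wedge \<theta>) = 0"
    using True by (intro alt.L_pow_prim_eq_0) auto
  then have "(sigma_wedge ^^ ?a) \<theta> = 0" unfolding a by (simp only: funpow_Suc_right o_apply)
  then have "\<theta> \<in> alt.prim (int j)"
    using \<theta> True by (intro alt.primI[of _ "int j" ?a]) (auto simp: Alt_int_def)
  then have "sigma_contr \<theta> = (\<lambda>_. 0)" by (simp add: alt_prim_iff Alt0_def)
  then have "(of_nat CARD('n) - of_nat j) * \<theta> es = 0" for es
    using sigma_contr_sigma_wedge[OF \<theta>, of es] 0 by (simp add: Alt0_def sigma_wedge_0)
  moreover have "of_nat CARD('n) - of_nat j \<noteq> (0 :: complex)"
    using True by (simp flip: of_nat_diff)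
  ultimately have "\<theta> = (\<lambda>_. 0)" by (simp add: fun_eq_iff)
  then show ?thesis by (simp add: sigma_wedge_0)
qed

text \<open>\<open>wedge0\<close> is defined by a description operator and meaningful only on \<open>Alt0\<close>; this is its
  extension to a finitary operator on all functions.\<close>

definition wedge_tracefree :: "nat \<Rightarrow> 'n::finite E \<Rightarrow> ('n E list \<Rightarrow> complex) \<Rightarrow> 'n E list \<Rightarrow> complex" where
  "wedge_tracefree r e \<omega> =
     (\<lambda>es. wedge (sharp e) \<omega> es + inverse (of_nat (CARD('n) - r + 1)) * sigma_wedge (contr e \<omega>) es)"

lemma finitary_wedge_tracefree: "finitary (wedge_tracefree r e)"
  unfolding wedge_tracefree_def[abs_def]
  by (rule finitary_add[OF finitary_wedge finitary_comp[OF finitary_sigma_wedge finitary_contr]])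

text \<open>The wedge contributes the trace -(contraction of \<psi> with e). That contraction is
  trace-free of degree r - 1, so the sl(2) relation gives the correction term the trace (n - r + 1)
  times it, which the reciprocal coefficient makes cancel.\<close>

lemma wedge_tracefree_in_Alt0:
  fixes \<psi> :: "'n::finite E list \<Rightarrow> complex"
  assumes \<psi>: "\<psi> \<in> Alt0 r" and r: "r \<le> CARD('n)"
  shows "wedge_tracefree r e \<psi> \<in> Alt0 (Suc r)"
proof -
  let ?c = "inverse (of_nat (CARD('n) - r + 1)) :: complex"
  have \<psi>A: "\<psi> \<in> Alt r" and \<psi>0: "sigma_contr \<psi> = (\<lambda>_. 0)" using \<psi> by (auto simp: Alt0_def)
  have "sigma_wedge (contr e \<psi>) \<in> Alt (Suc r) \<and>
      sigma_contr (sigma_wedge (contr e \<psi>)) = (\<lambda>es. of_nat (CARD('n) - r + 1) * contr e \<psi> es)"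
  proof (cases r)
    case 0
    then show ?thesis using contr_Alt_0[of \<psi>] \<psi>A
      by (simp add: sigma_wedge_0 sigma_contr_0 function_subspace_0[OF function_subspace_Alt])
  next
    case (Suc r')
    then have c: "contr e \<psi> \<in> Alt0 r'" using contr_in_Alt0 \<psi> by simp
    have "of_nat CARD('n) - of_nat r' = (of_nat (CARD('n) - r + 1) :: complex)"
      using r Suc by (simp add: of_nat_diff)
    moreover have "sigma_contr (contr e \<psi>) = (\<lambda>_. 0)" using c by (simp add: Alt0_def)
    ultimately have "sigma_contr (sigma_wedge (contr e \<psi>)) es = of_nat (CARD('n) - r + 1) * contr e \<psi> es" for es
      unfolding sigma_contr_sigma_wedge[OF Alt0_Alt[OF c]] by (simp only: sigma_wedge_0) simp
    then show ?thesis using sigma_wedge_in_Alt[OF Alt0_Alt[OF c]] Suc by auto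
  qed
  note s = conjunct1[OF this] conjunct2[OF this]
  have "wedge_tracefree r e \<psi> \<in> Alt (Suc r)"
    unfolding wedge_tracefree_def
    by (rule function_subspace_combination[OF function_subspace_Alt wedge_in_Alt[OF \<psi>A] s(1)])
  moreover have "sigma_contr (wedge_tracefree r e \<psi>) = (\<lambda>_. 0)"
  proof -
    have "sigma_contr (wedge_tracefree r e \<psi>) =
        (\<lambda>es. - contr e \<psi> es + ?c * (of_nat (CARD('n) - r + 1) * contr e \<psi> es))"
      unfolding wedge_tracefree_def sigma_contr_add sigma_contr_scale s(2)
        sigma_contr_wedge_sharp[OF Alt_multilinear[OF \<psi>A]] \<psi>0 wedge_0 by simp
    moreover have "?c * (of_nat (CARD('n) - r + 1) * x) = x" for x
      by (simp only: mult.assoc[symmetric]) (simp del: of_nat_Suc of_nat_add add: left_inverse)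
    ultimately show ?thesis by (simp only:) simp
  qed
  ultimately show ?thesis by (simp add: Alt0_def)
qed

text \<open>Two candidates for the projection differ by a trace-free form that is also a multiple of
  the symplectic form, hence by 0. This identifies the described form with the explicit one.\<close>

lemma wedge0_eq:
  fixes \<psi> :: "'n::finite E list \<Rightarrow> complex"
  assumes \<psi>: "\<psi> \<in> Alt0 r" and r: "r \<le> CARD('n)"
  shows "wedge0 r (sharp e) \<psi> = wedge_tracefree r e \<psi>"
proof -
  \<comment> \<open>For r = 0 this set contains only 0; for r \<ge> 1 it is the image of a linear
    map. In both cases it is closed under differences.\<close>
  let ?S = "insert (\<lambda>_. 0) {sigma_wedge \<theta> | \<theta> j. (\<theta> :: 'n E list \<Rightarrow> complex) \<in> Alt j \<and> j + 2 = r + 1}"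
  have S: "(\<lambda>es. a es - b es) \<in> ?S" if ab: "a \<in> ?S" "b \<in> ?S" for a b :: "'n E list \<Rightarrow> complex"
  proof -
    show ?thesis
    proof (cases r)
      case 0
      with ab show ?thesis by simp
    next
      case (Suc j)
      have "\<exists>\<theta>. \<theta> \<in> Alt j \<and> a = sigma_wedge \<theta>" if "a \<in> ?S" for a
        using that
      proof
        assume "a = (\<lambda>_. 0)"
        then show ?thesis
          by (intro exI[of _ "\<lambda>_. 0"]) (simp add: sigma_wedge_0 function_subspace_0[OF function_subspace_Alt])
      next
        assume "a \<in> {sigma_wedge \<theta> | \<theta> j. (\<theta> :: 'n E list \<Rightarrow> complex) \<in> Alt j \<and> j + 2 = r + 1}"
        then show ?thesis using Suc by auto
      qed
      from this[OF ab(1)] this[OF ab(2)] obtain \<theta> \<theta>' where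
        *: "\<theta> \<in> Alt j" "\<theta>' \<in> Alt j" "a = sigma_wedge \<theta>" "b = sigma_wedge \<theta>'" by blast
      have "(\<lambda>es. a es - b es) = sigma_wedge (\<lambda>es. \<theta> es + (-1) * \<theta>' es)"
        unfolding sigma_wedge_add sigma_wedge_scale * by simp
      moreover have "(\<lambda>es. \<theta> es + (-1) * \<theta>' es) \<in> Alt j"
        by (rule function_subspace_combination[OF function_subspace_Alt *(1,2)])
      ultimately show ?thesis using Suc by auto
    qed
  qed
  have mem: "(\<lambda>es. wedge (sharp e) \<psi> es - wedge_tracefree r e \<psi> es) \<in> ?S"
  proof (cases r)
    case 0
    then have "contr e \<psi> = (\<lambda>_. 0)" using contr_Alt_0 Alt0_Alt[OF \<psi>] by blast
    then show ?thesis by (simp add: wedge_tracefree_def sigma_wedge_0)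
  next
    case (Suc r')
    let ?\<theta> = "\<lambda>es. - inverse (of_nat (CARD('n) - r + 1)) * contr e \<psi> es"
    have "?\<theta> \<in> Alt r'"
      using contr_in_Alt Alt0_Alt[OF \<psi>] Suc by (intro function_subspace_scale[OF function_subspace_Alt]) auto
    moreover have "(\<lambda>es. wedge (sharp e) \<psi> es - wedge_tracefree r e \<psi> es) = sigma_wedge ?\<theta>"
      unfolding sigma_wedge_scale by (simp add: wedge_tracefree_def)
    ultimately show ?thesis using Suc by auto
  qed
  show ?thesis
    unfolding wedge0_def tracefree_part_def
  proof (rule the_equality)
    show "wedge_tracefree r e \<psi> \<in> Alt0 (r + 1) \<and> (\<lambda>es. wedge (sharp e) \<psi> es - wedge_tracefree r e \<psi> es) \<in> ?S"
      using wedge_tracefree_in_Alt0[OF assms] mem by simp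
  next
    fix \<phi> assume \<phi>: "\<phi> \<in> Alt0 (r + 1) \<and> (\<lambda>es. wedge (sharp e) \<psi> es - \<phi> es) \<in> ?S"
    let ?d = "\<lambda>es. \<phi> es - wedge_tracefree r e \<psi> es"
    have d0: "?d \<in> Alt0 (r + 1)"
      using \<phi> wedge_tracefree_in_Alt0[OF assms] by (simp add: function_subspace_diff[OF function_subspace_Alt0])
    have "?d \<in> ?S" using S[OF mem conjunct2[OF \<phi>]] by simp
    then have "?d = (\<lambda>_. 0)"
    proof
      assume "?d \<in> {sigma_wedge \<theta> | \<theta> j. (\<theta> :: 'n E list \<Rightarrow> complex) \<in> Alt j \<and> j + 2 = r + 1}"
      then obtain \<theta> :: "'n E list \<Rightarrow> complex" and j where *: "?d = sigma_wedge \<theta>" "\<theta> \<in> Alt j" "j + 2 = r + 1"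
        by blast
      then show ?thesis using Alt0_inter_sigma_wedge[of \<theta> j] d0 by simp
    qed
    then show "\<phi> = wedge_tracefree r e \<psi>" by (simp add: fun_eq_iff)
  qed
qed

lemma sigma_wedge_div_wedge: "sigma_wedge_div j (wedge \<eta> \<omega>) = wedge \<eta> (sigma_wedge_div j \<omega>)"
proof -
  have "(sigma_wedge ^^ j) (wedge \<eta> \<omega>) = wedge \<eta> ((sigma_wedge ^^ j) \<omega>)"
    by (induction j) (simp_all add: sigma_wedge_wedge)
  then show ?thesis
    using wedge_scale[of \<eta> "inverse (fact j)" "(sigma_wedge ^^ j) \<omega>"]
    by (simp add: sigma_wedge_div_def[abs_def] divide_inverse mult.commute)
qed

lemma sigma_wedge_div_sigma_wedge:
  "sigma_wedge_div j (sigma_wedge \<omega>) = (\<lambda>es. of_nat (j + 1) * sigma_wedge_div (j + 1) \<omega> es)"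
  by (simp add: sigma_wedge_div_def fun_eq_iff funpow_swap1 field_simps del: of_nat_Suc)

text \<open>The formula for \<open>wedge_tracefree\<close> solved for the wedge. One further
  symplectic form turns a divided power j into j + 1 times the next one, which is the origin of the
  numerator.\<close>

lemma wedge_sigma_wedge_div:
  fixes \<psi> :: "'n::finite E list \<Rightarrow> complex"
  shows "wedge (sharp e) (sigma_wedge_div j \<psi>) es = sigma_wedge_div j (wedge_tracefree r e \<psi>) es
     - of_nat (j + 1) / of_nat (CARD('n) - r + 1) * sigma_wedge_div (j + 1) (contr e \<psi>) es"
proof -
  have "sigma_wedge_div j (wedge_tracefree r e \<psi>) es = wedge (sharp e) (sigma_wedge_div j \<psi>) es +
      inverse (of_nat (CARD('n) - r + 1)) * (of_nat (j + 1) * sigma_wedge_div (j + 1) (contr e \<psi>) es)"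
    unfolding wedge_tracefree_def sigma_wedge_div_add sigma_wedge_div_scale sigma_wedge_div_wedge
      sigma_wedge_div_sigma_wedge by simp
  then show ?thesis by (simp add: divide_inverse mult_ac del: of_nat_Suc of_nat_add)
qed

section \<open>Recurrences for the coefficients of \<gamma>\<close>

lemma choose_two_Suc: "Suc q choose 2 = (q choose 2) + q"
  by (simp add: numeral_2_eq_2)

text \<open>Here q - l is constant, so only the second factorial and the denominator change. The
  sign of \<delta> in degree q + 1, the increment q of the binomial exponent and the change of l
  multiply to +1.\<close>

lemma gamma_coeff_step_down:
  "of_nat (k + n + Suc l + 1) / of_nat (k + Suc q + 1) * gamma_coeff n k q l =
    (-1) ^ Suc q * gamma_coeff n k (Suc q) (Suc l)"
proof -
  have f: "fact (k + n + Suc l + 1) = (of_nat (k + n + Suc l + 1) * fact (k + n + l + 1) :: complex)"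
    "fact (k + Suc q + 1) = (of_nat (k + Suc q + 1) * fact (k + q + 1) :: complex)"
    by (simp_all only: fact_Suc add_Suc_right add_Suc)
  have s: "(-1::complex) ^ Suc q * ((-1) ^ (Suc q choose 2) * ((-1) ^ Suc l * x)) = (-1) ^ (q choose 2) * ((-1) ^ l * x)" for x
    by (simp add: choose_two_Suc power_add mult.left_commute[of "(-1)^q"] flip: mult.assoc power_mult_distrib)
  show ?thesis
    unfolding gamma_coeff_def s f by (simp add: field_simps del: fact_Suc of_nat_Suc of_nat_add)
qed

text \<open>Here l is constant and the first factorial changes instead. The signs now multiply to
  -1, which compensates the minus sign of the trace correction.\<close>

lemma gamma_coeff_step_same:
  assumes "l \<le> q"
  shows "of_nat (k + Suc q - l) / of_nat (k + Suc q + 1) * gamma_coeff n k q l =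
    - ((-1) ^ Suc q * gamma_coeff n k (Suc q) l)"
proof -
  have f: "fact (k + Suc q - l) = (of_nat (k + Suc q - l) * fact (k + q - l) :: complex)"
    "fact (k + Suc q + 1) = (of_nat (k + Suc q + 1) * fact (k + q + 1) :: complex)"
    using assms by (simp_all only: fact_Suc add_Suc_right add_Suc Suc_diff_le trans_le_add2)
  have s: "- ((-1::complex) ^ Suc q * ((-1) ^ (Suc q choose 2) * ((-1) ^ l * x))) = (-1) ^ (q choose 2) * ((-1) ^ l * x)" for x
    by (simp add: choose_two_Suc power_add mult.left_commute[of "(-1)^q"] flip: mult.assoc power_mult_distrib)
  show ?thesis
    unfolding gamma_coeff_def s f by (simp add: field_simps del: fact_Suc of_nat_Suc of_nat_add)
qed

section \<open>Clifford multiplication on Lefschetz components\<close>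

definition lefschetz_component :: "nat \<Rightarrow> nat \<Rightarrow> 'n::finite lefschetz_family \<Rightarrow> 'n form" where
  "lefschetz_component q r \<Phi> = (\<lambda>j. \<Phi> ((q, r), j))"

abbreviation embed :: "nat \<Rightarrow> nat \<Rightarrow> 'n::finite form \<Rightarrow> 'n form" where
  "embed q r \<equiv> tensor_op id (sigma_wedge_div ((q - r) div 2))"

lemma lefschetz_component_in:
  assumes "\<Phi> \<in> lefschetz_space k" "(q, r) \<in> lefschetz_indices CARD('n)"
  shows "lefschetz_component q r (\<Phi> :: 'n::finite lefschetz_family) \<in> tensor_space (Sym (k + q)) (Alt0 r)"
proof -
  have "(\<lambda>i. \<Phi> ((q, r), i)) \<in> (if (q, r) \<in> lefschetz_indices CARD('n)
      then case (q, r) of (q, r) \<Rightarrow> tensor_space (Sym (k + q)) (Alt0 r) else {\<lambda>_. 0})"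
    using assms(1) unfolding lefschetz_space_def direct_sum_def by blast
  then show ?thesis using assms(2) by (simp add: lefschetz_component_def)
qed

lemma lefschetz_sum_eq:
  "lefschetz_sum \<Phi> (q, i) =
    (\<Sum>r\<in>lefschetz_degrees CARD('n) q. embed q r (lefschetz_component q r \<Phi>) (i :: H list \<times> 'n::finite E list))"
proof -
  have "{qr \<in> lefschetz_indices CARD('n). fst qr = q} = Pair q ` lefschetz_degrees CARD('n) q"
    by (auto simp: lefschetz_degrees_def)
  then have "lefschetz_sum \<Phi> (q, i) = (\<Sum>qr\<in>Pair q ` lefschetz_degrees CARD('n) q.
      case qr of (q', r) \<Rightarrow> tensor_op id (sigma_wedge_div ((q - r) div 2)) (\<lambda>j. \<Phi> ((q, r), j)) i)"
    by (simp add: lefschetz_sum_def)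
  also have "\<dots> = (\<Sum>r\<in>lefschetz_degrees CARD('n) q. embed q r (lefschetz_component q r \<Phi>) i)"
    by (subst sum.reindex) (auto simp: inj_on_def lefschetz_component_def)
  finally show ?thesis .
qed

lemma sum_lefschetz_indices:
  "(\<Sum>(q, r)\<in>lefschetz_indices n. if q = a then f r else 0) = (\<Sum>r\<in>lefschetz_degrees n a. f r)"
proof -
  have "(\<Sum>(q, r)\<in>lefschetz_indices n. if q = a then f r else 0) =
      (\<Sum>x\<in>Pair a ` lefschetz_degrees n a. f (snd x))"
    by (intro sum.mono_neutral_cong_right finite_lefschetz_indices) (auto simp: lefschetz_degrees_def split: if_splits)
  also have "\<dots> = (\<Sum>r\<in>lefschetz_degrees n a. f r)"
    by (subst sum.reindex) (auto simp: inj_on_def)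
  finally show ?thesis .
qed

text \<open>\<open>cliff\<close> works on a preimage selected by \<open>inv_into\<close>;
  surjectivity makes the selection a genuine preimage. One is built by taking Lefschetz components
  slice by slice.\<close>

lemma lefschetz_sum_surj:
  assumes \<phi>: "\<phi> \<in> forms_space k"
  shows "\<exists>\<Phi>\<in>lefschetz_space k. lefschetz_sum \<Phi> = (\<phi> :: 'n::finite forms)"
proof -
  define \<Phi> :: "'n lefschetz_family" where "\<Phi> = (\<lambda>((q, r), j). if (q, r) \<in> lefschetz_indices CARD('n)
     then tensor_op id (\<lambda>\<omega>. lefschetz_part q \<omega> r) (degree_part q \<phi>) j else 0)"
  have deg: "degree_part q \<phi> \<in> tensor_space (Sym (k + q)) (Alt q)" if "q \<le> 2 * CARD('n)" for q
    using \<phi> that by (auto simp: forms_space_def direct_sum_def degree_part_def form_space_def dest!: spec[of _ q])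
  have le: "q \<le> 2 * CARD('n)" if "(q, r) \<in> lefschetz_indices CARD('n)" for q r
    using that by (auto simp: lefschetz_indices_def)
  have "\<Phi> \<in> lefschetz_space k"
    unfolding lefschetz_space_def direct_sum_def
  proof (intro CollectI allI)
    fix t :: "nat \<times> nat"
    obtain q r where t: "t = (q, r)" by (cases t) auto
    show "(\<lambda>i. \<Phi> (t, i)) \<in> (if t \<in> lefschetz_indices CARD('n)
        then case t of (q, r) \<Rightarrow> tensor_space (Sym (k + q)) (Alt0 r) else {\<lambda>_. 0})"
    proof (cases "(q, r) \<in> lefschetz_indices CARD('n)")
      case True
      then have r: "r \<in> lefschetz_degrees CARD('n) q" by (simp add: lefschetz_degrees_def)
      have "tensor_op id (\<lambda>\<omega>. lefschetz_part q \<omega> r) (degree_part q \<phi>) \<in> tensor_space (Sym (k + q)) (Alt0 r)"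
        by (rule tensor_op_id_in[OF function_subspace_Sym function_subspace_Alt finitely_determined_Alt
            lefschetz_part_linear[OF r] deg[OF le[OF True]]])
      then show ?thesis using True by (simp add: t \<Phi>_def)
    next
      case False
      then show ?thesis by (simp add: t \<Phi>_def)
    qed
  qed
  moreover have "lefschetz_sum \<Phi> = \<phi>"
  proof
    fix x :: "nat \<times> H list \<times> 'n E list"
    obtain q xs es where x: "x = (q, (xs, es))" by (cases x) auto
    have comp: "lefschetz_component q r \<Phi> = tensor_op id (\<lambda>\<omega>. lefschetz_part q \<omega> r) (degree_part q \<phi>)"
      if "r \<in> lefschetz_degrees CARD('n) q" for r
      using that by (simp add: lefschetz_component_def \<Phi>_def lefschetz_degrees_def)
    show "lefschetz_sum \<Phi> x = \<phi> x"
    proof (cases "q \<le> 2 * CARD('n)")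
      case True
      let ?\<omega> = "\<lambda>y. degree_part q \<phi> (xs, y)"
      have \<omega>: "?\<omega> \<in> Alt q" using deg[OF True] by (simp add: tensor_space_def)
      have "lefschetz_sum \<Phi> x = (\<Sum>r\<in>lefschetz_degrees CARD('n) q.
          sigma_wedge_div ((q - r) div 2) (lefschetz_part q ?\<omega> r) es)"
        unfolding x lefschetz_sum_eq by (intro sum.cong refl) (simp add: comp tensor_op_def)
      also have "\<dots> = degree_part q \<phi> (xs, es)" using fun_cong[OF lefschetz_part_sum[OF \<omega>], of es] by simp
      finally show ?thesis by (simp add: x degree_part_def)
    next
      case False
      then have "lefschetz_degrees CARD('n) q = {}" using le by (auto simp: lefschetz_degrees_def)
      moreover have "(\<lambda>i. \<phi> (q, i)) = (\<lambda>_. 0)"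
        using \<phi> False by (auto simp: forms_space_def direct_sum_def dest!: spec[of _ q])
      ultimately show ?thesis unfolding x lefschetz_sum_eq by (simp add: fun_eq_iff)
    qed
  qed
  ultimately show ?thesis by blast
qed

text \<open>The contribution of one source (q, r) to one target t, without the factor sqrt 2 and
  with \<open>wedge0\<close> replaced by its finitary extension, so that operators can be exchanged
  freely.\<close>

definition clifford_term ::
    "nat \<Rightarrow> H \<Rightarrow> 'n::finite E \<Rightarrow> nat \<Rightarrow> nat \<Rightarrow> 'n form \<Rightarrow> nat \<times> nat \<Rightarrow> 'n form" where
  "clifford_term k h e q r \<phi> t i = (let n = CARD('n); l = (q - r) div 2 in
         (if t = (q + 1, r + 1)
          then 1 / of_nat (k + q + 1)
               * tensor_op (sym_mult h) (wedge_tracefree r e) \<phi> i else 0)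
       - (if r \<ge> 1 \<and> t = (q + 1, r - 1)
          then 1 / of_nat (k + q + 1) * (of_nat (l + 1) / of_nat (n - r + 1))
               * tensor_op (sym_mult h) (contr e) \<phi> i else 0)
       + (if q \<ge> 1 \<and> t = (q - 1, r + 1)
          then of_nat (k + n + l + 1) / of_nat (k + q + 1)
               * tensor_op (sym_contr (sharp h)) (wedge_tracefree r e) \<phi> i else 0)
       + (if q \<ge> 1 \<and> r \<ge> 1 \<and> t = (q - 1, r - 1)
          then of_nat (k + q - l) / of_nat (k + q + 1) * (of_nat (n - r - l + 1) / of_nat (n - r + 1))
               * tensor_op (sym_contr (sharp h)) (contr e) \<phi> i else 0))"

lemma cliff_lefschetz_eq:
  fixes e :: "'n::finite E"
  assumes \<Phi>: "\<Phi> \<in> lefschetz_space k" and t: "t \<in> lefschetz_indices CARD('n)"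
  shows "cliff_lefschetz k h e \<Phi> (t, i) = of_real (sqrt 2) *
    (\<Sum>(q, r)\<in>lefschetz_indices CARD('n). clifford_term k h e q r (lefschetz_component q r \<Phi>) t i)"
proof -
  have *: "tensor_op F (wedge0 r (sharp e)) (\<lambda>j. \<Phi> ((q, r), j)) = tensor_op F (wedge_tracefree r e) (\<lambda>j. \<Phi> ((q, r), j))"
    if "(q, r) \<in> lefschetz_indices CARD('n)" for q r and F :: "(H list \<Rightarrow> complex) \<Rightarrow> H list \<Rightarrow> complex"
    using lefschetz_component_in[OF \<Phi> that] that unfolding lefschetz_component_def
    by (intro tensor_op_cong[of _ "Sym (k + q)" "Alt0 r"] wedge0_eq) (auto simp: lefschetz_indices_def)
  show ?thesis
    unfolding cliff_lefschetz_def using t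
    by (auto intro!: sum.cong simp: clifford_term_def lefschetz_component_def Let_def * simp del: of_nat_Suc of_nat_add)
qed

text \<open>The part of Clifford multiplication that lowers q, already embedded in forms of degree q
  - 1. Only the first target can be missing for r < n; the second occurs as soon as r \<ge>
  1.\<close>

definition delta_term :: "nat \<Rightarrow> H \<Rightarrow> 'n::finite E \<Rightarrow> nat \<Rightarrow> nat \<Rightarrow> 'n form \<Rightarrow> 'n form" where
  "delta_term k h e q r \<phi> i = (let n = CARD('n); l = (q - r) div 2 in
     (if r + 1 \<in> lefschetz_degrees n (q - 1)
      then of_nat (k + n + l + 1) / of_nat (k + q + 1)
           * embed (q - 1) (r + 1) (tensor_op (sym_contr (sharp h)) (wedge_tracefree r e) \<phi>) i else 0)
   + (if r \<ge> 1
      then of_nat (k + q - l) / of_nat (k + q + 1) * (of_nat (n - r - l + 1) / of_nat (n - r + 1))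
           * embed (q - 1) (r - 1) (tensor_op (sym_contr (sharp h)) (contr e) \<phi>) i else 0))"

lemma finitary_tensor_op:
  assumes "finitary F" "finitary G"
  shows "finitary (tensor_op F G)"
  unfolding finitary_def
proof
  fix y :: "'b \<times> 'd"
  obtain xs es where y: "y = (xs, es)" by (cases y)
  obtain Z a where F: "finite Z" "\<And>\<phi>. F \<phi> xs = (\<Sum>z\<in>Z. a z * \<phi> z)"
    using assms(1) unfolding finitary_def by metis
  obtain Z' a' where G: "finite Z'" "\<And>\<phi>. G \<phi> es = (\<Sum>z\<in>Z'. a' z * \<phi> z)"
    using assms(2) unfolding finitary_def by metis
  have "tensor_op F G \<phi> y = (\<Sum>z\<in>Z. a z * (\<Sum>w\<in>Z'. a' w * \<phi> (z, w)))" for \<phi>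
    by (simp add: y tensor_op_def F(2) G(2))
  then have *: "tensor_op F G \<phi> y = (\<Sum>i\<in>Z \<times> Z'. (a (fst i) * a' (snd i)) * \<phi> i)" for \<phi>
    by (simp add: sum_distrib_left sum.cartesian_product case_prod_unfold mult.assoc)
  show "\<exists>Z a. finite Z \<and> (\<forall>\<phi>. tensor_op F G \<phi> y = (\<Sum>z\<in>Z. a z * \<phi> z))"
    unfolding * using F(1) G(1) by (intro exI[of _ "Z \<times> Z'"] exI[of _ "\<lambda>i. a (fst i) * a' (snd i)"]) auto
qed

lemma finitary_embed: "finitary (embed q r)"
  by (rule finitary_tensor_op[OF finitary_id finitary_sigma_wedge_div])

lemma sum_delta_degrees:
  "(\<Sum>s\<in>lefschetz_degrees n Q. if P \<and> (Q, s) = (a, b) then f s else 0) =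
    (if P \<and> Q = a \<and> b \<in> lefschetz_degrees n Q then f b else (0::complex))"
proof (cases "P \<and> Q = a")
  case True
  then have "(\<Sum>s\<in>lefschetz_degrees n Q. if P \<and> (Q, s) = (a, b) then f s else 0) =
      (\<Sum>s\<in>lefschetz_degrees n Q. if s = b then f s else 0)" by (intro sum.cong) auto
  then show ?thesis using True finite_lefschetz_degrees by simp
qed auto

text \<open>Lowering r always leads to an admissible target. Raising r fails exactly at the upper
  end l = n - r when q rises, and at the lower end l = 0 when q falls; r = n is both ends at
  once.\<close>

lemma mem_lefschetz_degrees_shift:
  assumes r: "r \<in> lefschetz_degrees n q"
  shows "1 \<le> r \<Longrightarrow> r - 1 \<in> lefschetz_degrees n (q + 1)"
    and "1 \<le> r \<Longrightarrow> r - 1 \<in> lefschetz_degrees n (q - 1)"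
    and "r + 1 \<in> lefschetz_degrees n (q + 1) \<longleftrightarrow> r < n \<and> (q - r) div 2 < n - r"
    and "1 \<le> q \<Longrightarrow> r + 1 \<in> lefschetz_degrees n (q - 1) \<longleftrightarrow> r < n \<and> 1 \<le> (q - r) div 2"
proof -
  obtain l where l: "r + 2 * l = q" "r \<le> n" "q \<le> 2 * n - r" using r by (auto simp: lefschetz_degrees_iff)
  show "1 \<le> r \<Longrightarrow> r - 1 \<in> lefschetz_degrees n (q + 1)"
    unfolding lefschetz_degrees_iff using l by (intro conjI exI[of _ "l + 1"]) auto
  show "1 \<le> r \<Longrightarrow> r - 1 \<in> lefschetz_degrees n (q - 1)"
    unfolding lefschetz_degrees_iff using l by (intro conjI exI[of _ l]) auto
  have div: "(q - r) div 2 = l" using l by auto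
  show "r + 1 \<in> lefschetz_degrees n (q + 1) \<longleftrightarrow> r < n \<and> (q - r) div 2 < n - r"
    unfolding lefschetz_degrees_iff div using l by (auto intro!: exI[of _ l])
  show "r + 1 \<in> lefschetz_degrees n (q - 1) \<longleftrightarrow> r < n \<and> 1 \<le> (q - r) div 2" if "1 \<le> q"
    unfolding lefschetz_degrees_iff div
  proof
    assume "r + 1 \<le> n \<and> q - 1 \<le> 2 * n - (r + 1) \<and> (\<exists>l. r + 1 + 2 * l = q - 1)"
    with l show "r < n \<and> 1 \<le> l" by auto
  next
    assume "r < n \<and> 1 \<le> l"
    with l that show "r + 1 \<le> n \<and> q - 1 \<le> 2 * n - (r + 1) \<and> (\<exists>l. r + 1 + 2 * l = q - 1)"
      by (intro conjI exI[of _ "l - 1"]) auto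
  qed
qed

text \<open>Each of the four terms reaches at most one target. The delicate case is a target (q + 1,
  r + 1) that does not occur: Clifford multiplication omits the term by convention, while in d it is
  present and has to vanish by itself.\<close>

lemma embed_clifford_terms:
  fixes \<eta> :: "'n::finite E"
  assumes r: "r \<in> lefschetz_degrees CARD('n) q" and \<phi>: "\<phi> \<in> tensor_space (Sym (k + q)) (Alt0 r)"
  shows "(\<Sum>s\<in>lefschetz_degrees CARD('n) Q. embed Q s (clifford_term k (flat \<alpha>) (flat \<eta>) q r \<phi> (Q, s)) i) =
    (if Q = q + 1 then symbol_d k q \<alpha> \<eta> (embed q r \<phi>) i else 0) +
    (if 1 \<le> q \<and> Q = q - 1 then delta_term k (flat \<alpha>) (flat \<eta>) q r \<phi> i else 0)"
proof -
  let ?h = "flat \<alpha>" and ?e = "flat \<eta>" and ?n = "CARD('n)"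
  let ?l = "(q - r) div 2"
  let ?A = "tensor_op (sym_mult ?h) (wedge_tracefree r ?e) \<phi>" and ?B = "tensor_op (sym_mult ?h) (contr ?e) \<phi>"
  let ?C = "tensor_op (sym_contr \<alpha>) (wedge_tracefree r ?e) \<phi>" and ?D = "tensor_op (sym_contr \<alpha>) (contr ?e) \<phi>"
  define a b c d where "a = (1 / of_nat (k + q + 1) :: complex)"
    and "b = (1 / of_nat (k + q + 1) * (of_nat (?l + 1) / of_nat (?n - r + 1)) :: complex)"
    and "c = (of_nat (k + ?n + ?l + 1) / of_nat (k + q + 1) :: complex)"
    and "d = (of_nat (k + q - ?l) / of_nat (k + q + 1) * (of_nat (?n - r - ?l + 1) / of_nat (?n - r + 1)) :: complex)"
  note lin = finitary_linear[OF finitary_embed]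
  \<comment> \<open>All four conditions get the shape of a guard conjoined with one target,
    including a vacuous guard, so that \<open>sum_delta_degrees\<close> evaluates every sum.\<close>
  have "embed Q s (clifford_term k ?h ?e q r \<phi> (Q, s)) i =
      (if True \<and> (Q, s) = (q + 1, r + 1) then a * embed Q s ?A i else 0)
    - (if 1 \<le> r \<and> (Q, s) = (q + 1, r - 1) then b * embed Q s ?B i else 0)
    + (if 1 \<le> q \<and> (Q, s) = (q - 1, r + 1) then c * embed Q s ?C i else 0)
    + (if (1 \<le> q \<and> 1 \<le> r) \<and> (Q, s) = (q - 1, r - 1) then d * embed Q s ?D i else 0)" for s
  proof -
    have "clifford_term k ?h ?e q r \<phi> (Q, s) = (\<lambda>i.
        (if True \<and> (Q, s) = (q + 1, r + 1) then a else 0) * ?A i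
      - (if 1 \<le> r \<and> (Q, s) = (q + 1, r - 1) then b else 0) * ?B i
      + (if 1 \<le> q \<and> (Q, s) = (q - 1, r + 1) then c else 0) * ?C i
      + (if (1 \<le> q \<and> 1 \<le> r) \<and> (Q, s) = (q - 1, r - 1) then d else 0) * ?D i)"
      by (auto simp: clifford_term_def a_def b_def c_def d_def Let_def sharp_flat fun_eq_iff
          simp del: of_nat_Suc of_nat_add)
    then show ?thesis by (simp only: lin(1,2,4)) auto
  qed
  then have "(\<Sum>s\<in>lefschetz_degrees ?n Q. embed Q s (clifford_term k ?h ?e q r \<phi> (Q, s)) i) =
      (if True \<and> Q = q + 1 \<and> r + 1 \<in> lefschetz_degrees ?n Q then a * embed Q (r + 1) ?A i else 0)
    - (if 1 \<le> r \<and> Q = q + 1 \<and> r - 1 \<in> lefschetz_degrees ?n Q then b * embed Q (r - 1) ?B i else 0)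
    + (if 1 \<le> q \<and> Q = q - 1 \<and> r + 1 \<in> lefschetz_degrees ?n Q then c * embed Q (r + 1) ?C i else 0)
    + (if (1 \<le> q \<and> 1 \<le> r) \<and> Q = q - 1 \<and> r - 1 \<in> lefschetz_degrees ?n Q then d * embed Q (r - 1) ?D i else 0)"
    by (simp only: sum.distrib sum_subtractf sum_delta_degrees)
  moreover have "(if 1 \<le> q \<and> Q = q - 1 \<and> r + 1 \<in> lefschetz_degrees ?n Q then c * embed Q (r + 1) ?C i else 0)
    + (if (1 \<le> q \<and> 1 \<le> r) \<and> Q = q - 1 \<and> r - 1 \<in> lefschetz_degrees ?n Q then d * embed Q (r - 1) ?D i else 0)
    = (if 1 \<le> q \<and> Q = q - 1 then delta_term k ?h ?e q r \<phi> i else 0)"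
    using mem_lefschetz_degrees_shift(2)[OF r]
    by (auto simp: delta_term_def c_def d_def sharp_flat Let_def simp del: of_nat_Suc of_nat_add)
  moreover have "(if True \<and> Q = q + 1 \<and> r + 1 \<in> lefschetz_degrees ?n Q then a * embed Q (r + 1) ?A i else 0)
    - (if 1 \<le> r \<and> Q = q + 1 \<and> r - 1 \<in> lefschetz_degrees ?n Q then b * embed Q (r - 1) ?B i else 0)
    = (if Q = q + 1 then symbol_d k q \<alpha> \<eta> (embed q r \<phi>) i else 0)"
  proof (cases "Q = q + 1")
    case True
    have rn: "r \<le> ?n" using r by (simp add: lefschetz_degrees_iff)
    obtain xs es where i: "i = (xs, es)" by (cases i) auto
    have sub: "(\<lambda>y. \<phi> (x, y)) \<in> Alt0 r" for x using \<phi> by (simp add: tensor_space_def)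
    \<comment> \<open>At the end of the string r + 1 + l exceeds n, and that power of the symplectic
      form annihilates trace-free forms of degree r + 1.\<close>
    have A0: "embed Q (r + 1) ?A i = 0" if "\<not> (r < ?n \<and> ?l < ?n - r)"
    proof -
      have "sigma_wedge_div ?l (wedge_tracefree r ?e (\<lambda>y. \<phi> (x, y))) = (\<lambda>_. 0)" for x
        using that lefschetz_degrees_half(3)[OF r] rn
        by (intro sigma_wedge_div_Alt0_eq_0[OF wedge_tracefree_in_Alt0[OF sub rn]]) auto
      then show ?thesis using True unfolding tensor_op_comp[OF finitary_sym_mult finitary_sigma_wedge_div]
        by (simp add: i tensor_op_def finitary_linear(3)[OF finitary_sym_mult])
    qed
    have shift: "(Q - (r + 1)) div 2 = ?l" "1 \<le> r \<Longrightarrow> (Q - (r - 1)) div 2 = ?l + 1"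
      using True lefschetz_degrees_half(1)[OF r] by auto
    have "symbol_d k q \<alpha> \<eta> (embed q r \<phi>) i =
        a * sym_mult ?h (\<lambda>x. wedge (sharp ?e) (sigma_wedge_div ?l (\<lambda>y. \<phi> (x, y))) es) xs"
      by (simp add: symbol_d_def a_def i tensor_op_def sharp_flat)
    also have "\<dots> = a * sym_mult ?h (\<lambda>x. sigma_wedge_div ?l (wedge_tracefree r ?e (\<lambda>y. \<phi> (x, y))) es) xs
        - b * sym_mult ?h (\<lambda>x. sigma_wedge_div (?l + 1) (contr ?e (\<lambda>y. \<phi> (x, y))) es) xs"
      unfolding wedge_sigma_wedge_div[where r = r]
      by (simp only: finitary_linear[OF finitary_sym_mult]) (simp add: a_def b_def algebra_simps)
    also have "sym_mult ?h (\<lambda>x. sigma_wedge_div ?l (wedge_tracefree r ?e (\<lambda>y. \<phi> (x, y))) es) xs = embed Q (r + 1) ?A i"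
      unfolding tensor_op_comp[OF finitary_sym_mult finitary_sigma_wedge_div] shift by (simp add: i tensor_op_def)
    also have "b * sym_mult ?h (\<lambda>x. sigma_wedge_div (?l + 1) (contr ?e (\<lambda>y. \<phi> (x, y))) es) xs =
        (if 1 \<le> r then b * embed Q (r - 1) ?B i else 0)"
    proof (cases "1 \<le> r")
      case True
      then show ?thesis
        unfolding tensor_op_comp[OF finitary_sym_mult finitary_sigma_wedge_div] shift(2)[OF True] by (simp add: i tensor_op_def)
    next
      case False
      have "contr ?e (\<lambda>y. \<phi> (x, y)) = (\<lambda>_. 0)" for x
        using False sub[of x] by (intro contr_Alt_0 Alt0_Alt) (cases r, auto)
      then show ?thesis using False
        by (simp add: finitary_linear(3)[OF finitary_sym_mult] finitary_linear(3)[OF finitary_sigma_wedge_div])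
    qed
    finally have "symbol_d k q \<alpha> \<eta> (embed q r \<phi>) i =
        a * embed Q (r + 1) ?A i - (if 1 \<le> r then b * embed Q (r - 1) ?B i else 0)" .
    then show ?thesis
      using True A0 mem_lefschetz_degrees_shift(1,3)[OF r] by auto
  qed simp
  ultimately show ?thesis by simp
qed

section \<open>The symbol of \<delta> conjugated by \<gamma>\<close>

lemma is_gammaD:
  fixes \<gamma> :: "nat \<Rightarrow> 'n::finite form \<Rightarrow> 'n dual_form"
  assumes "is_gamma k \<gamma>" "q \<le> 2 * CARD('n)"
  shows "bij_betw (\<gamma> q) (form_space k q) (dual_form_space k q)"
    and "linear_between (form_space k q) (dual_form_space k q) (\<gamma> q)"
    and "r \<in> lefschetz_degrees CARD('n) q \<Longrightarrow> \<psi> \<in> tensor_space (Sym (k + q)) (Alt0 r) \<Longrightarrow>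
      \<gamma> q (embed q r \<psi>) = (\<lambda>x. gamma_coeff CARD('n) k q ((q - r) div 2) *
         tensor_op id (vol_tensor \<circ> sigma_wedge_div (CARD('n) - r - (q - r) div 2)) \<psi> x)"
proof -
  show "bij_betw (\<gamma> q) (form_space k q) (dual_form_space k q)"
    and "linear_between (form_space k q) (dual_form_space k q) (\<gamma> q)"
    using assms by (auto simp: is_gamma_def)
  assume r: "r \<in> lefschetz_degrees CARD('n) q" and \<psi>: "\<psi> \<in> tensor_space (Sym (k + q)) (Alt0 r)"
  have "r \<le> CARD('n) \<and> r + 2 * ((q - r) div 2) = q \<and> q \<le> 2 * CARD('n) - r"
    using r lefschetz_degrees_half(1)[OF r] by (simp add: lefschetz_degrees_iff)
  then show "\<gamma> q (embed q r \<psi>) = (\<lambda>x. gamma_coeff CARD('n) k q ((q - r) div 2) *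
         tensor_op id (vol_tensor \<circ> sigma_wedge_div (CARD('n) - r - (q - r) div 2)) \<psi> x)"
    using assms \<psi> unfolding is_gamma_def by blast
qed

lemma function_subspace_form_space: "function_subspace (form_space k q)"
  and finitely_determined_form_space: "finitely_determined (form_space k q)"
  and function_subspace_dual_form_space: "function_subspace (dual_form_space k q)"
  unfolding form_space_def dual_form_space_def
  by (intro function_subspace_tensor_space finitely_determined_tensor_space function_subspace_Sym
      function_subspace_Alt finitely_determined_Sym finitely_determined_Alt)+

lemma function_subspace_forms_space: "function_subspace (forms_space k)"
  and finitely_determined_forms_space: "finitely_determined (forms_space k)"
  unfolding forms_space_def
  by (intro function_subspace_direct_sum finitely_determined_direct_sum function_subspace_form_space
      finitely_determined_form_space finite_atLeastAtMost)+

lemma embed_in_form_space: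
  fixes \<psi> :: "'n::finite form"
  assumes r: "r \<in> lefschetz_degrees CARD('n) q" and \<psi>: "\<psi> \<in> tensor_space (Sym (k + q)) (Alt0 r)"
  shows "embed q r \<psi> \<in> form_space k q"
  unfolding form_space_def
proof (rule tensor_op_in[OF finitary_id _ finitary_sigma_wedge_div _ function_subspace_Sym function_subspace_Alt \<psi>])
  fix \<omega> :: "'n E list \<Rightarrow> complex" assume "\<omega> \<in> Alt0 r"
  from sigma_wedge_div_in_Alt[OF Alt0_Alt[OF this], of "(q - r) div 2"]
  show "sigma_wedge_div ((q - r) div 2) \<omega> \<in> Alt q" using lefschetz_degrees_half(1)[OF r] by simp
qed simp

lemma delta_term_in_form_space:
  fixes e :: "'n::finite E" and \<phi> :: "'n form"
  assumes r: "r \<in> lefschetz_degrees CARD('n) q" and q: "1 \<le> q" and \<phi>: "\<phi> \<in> tensor_space (Sym (k + q)) (Alt0 r)"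
  shows "r + 1 \<in> lefschetz_degrees CARD('n) (q - 1) \<Longrightarrow>
      tensor_op (sym_contr \<alpha>) (wedge_tracefree r e) \<phi> \<in> tensor_space (Sym (k + (q - 1))) (Alt0 (r + 1))"
    and "1 \<le> r \<Longrightarrow> tensor_op (sym_contr \<alpha>) (contr e) \<phi> \<in> tensor_space (Sym (k + (q - 1))) (Alt0 (r - 1))"
    and "delta_term k h e q r \<phi> \<in> form_space k (q - 1)"
proof -
  have rn: "r \<le> CARD('n)" using r by (simp add: lefschetz_degrees_iff)
  have S: "sym_contr \<alpha> s \<in> Sym (k + (q - 1))" if "s \<in> Sym (k + q)" for s \<alpha>
    using sym_contr_in_Sym[of s "k + (q - 1)" \<alpha>] that q by simp
  show C: "tensor_op (sym_contr \<alpha>) (wedge_tracefree r e) \<phi> \<in> tensor_space (Sym (k + (q - 1))) (Alt0 (r + 1))" for \<alpha>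
    using wedge_tracefree_in_Alt0[OF _ rn]
    by (intro tensor_op_in[OF finitary_sym_contr S finitary_wedge_tracefree _ function_subspace_Sym function_subspace_Alt0 \<phi>]) auto
  show D: "tensor_op (sym_contr \<alpha>) (contr e) \<phi> \<in> tensor_space (Sym (k + (q - 1))) (Alt0 (r - 1))" if "1 \<le> r" for \<alpha>
    using that
    by (intro tensor_op_in[OF finitary_sym_contr S finitary_contr contr_in_Alt0 function_subspace_Sym function_subspace_Alt0 \<phi>]) auto
  have 1: "(\<lambda>i. if r + 1 \<in> lefschetz_degrees CARD('n) (q - 1)
      then c * embed (q - 1) (r + 1) (tensor_op (sym_contr (sharp h)) (wedge_tracefree r e) \<phi>) i else 0) \<in> form_space k (q - 1)" for c
  proof (cases "r + 1 \<in> lefschetz_degrees CARD('n) (q - 1)")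
    case True
    from function_subspace_scale[OF function_subspace_form_space embed_in_form_space[OF this C]] True
    show ?thesis by simp
  qed (simp add: function_subspace_0[OF function_subspace_form_space])
  have 2: "(\<lambda>i. if r \<ge> 1
      then c * embed (q - 1) (r - 1) (tensor_op (sym_contr (sharp h)) (contr e) \<phi>) i else 0) \<in> form_space k (q - 1)" for c
  proof (cases "r \<ge> 1")
    case True
    from function_subspace_scale[OF function_subspace_form_space
        embed_in_form_space[OF mem_lefschetz_degrees_shift(2)[OF r True] D[OF True]]] True
    show ?thesis by simp
  qed (simp add: function_subspace_0[OF function_subspace_form_space])
  show "delta_term k h e q r \<phi> \<in> form_space k (q - 1)"
    unfolding delta_term_def[abs_def] Let_def
    by (rule function_subspace_add[OF function_subspace_form_space 1 2])
qed

text \<open>With m = n - r - l the target (q - 1, r + 1) has the same m and l - 1, while (q - 1, r -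
  1) has m + 1 and l. The wedge identity for the m-th divided power yields both terms, and the two
  recurrences match their coefficients. Working with \<gamma> on both sides avoids its
  inverse.\<close>

lemma gamma_delta_term:
  fixes \<gamma> :: "nat \<Rightarrow> 'n::finite form \<Rightarrow> 'n dual_form"
  assumes \<gamma>: "is_gamma k \<gamma>" and r: "r \<in> lefschetz_degrees CARD('n) q" and q: "1 \<le> q" "q \<le> 2 * CARD('n)"
    and \<phi>: "\<phi> \<in> tensor_space (Sym (k + q)) (Alt0 r)"
  shows "\<gamma> (q - 1) (delta_term k (flat \<alpha>) (flat \<eta>) q r \<phi>) = symbol_delta q \<alpha> \<eta> (\<gamma> q (embed q r \<phi>))"
proof -
  let ?e = "flat \<eta>" and ?n = "CARD('n)"
  define l where "l = (q - r) div 2"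
  define m where "m = ?n - r - l"
  have h: "q = r + 2 * l" "r \<le> ?n" "l \<le> ?n - r" using lefschetz_degrees_half[OF r] by (simp_all add: l_def)
  define P where "P \<longleftrightarrow> r + 1 \<in> lefschetz_degrees ?n (q - 1)"
  have P: "P \<longleftrightarrow> r < ?n \<and> 1 \<le> l" unfolding P_def l_def by (rule mem_lefschetz_degrees_shift(4)[OF r q(1)])
  let ?C = "tensor_op (sym_contr \<alpha>) (wedge_tracefree r ?e) \<phi>" and ?D = "tensor_op (sym_contr \<alpha>) (contr ?e) \<phi>"
  define c d where "c = (of_nat (k + ?n + l + 1) / of_nat (k + q + 1) :: complex)"
    and "d = (of_nat (k + q - l) / of_nat (k + q + 1) * (of_nat (?n - r - l + 1) / of_nat (?n - r + 1)) :: complex)"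
  define c' where "c' = (if P then c else 0)"
  define d' where "d' = (if 1 \<le> r then d else 0)"
  have q': "q - 1 \<le> 2 * ?n" using q by simp
  note lin = is_gammaD(2)[OF \<gamma> q']
  note CD = delta_term_in_form_space(1,2)[OF r q(1) \<phi>, folded P_def]
  \<comment> \<open>Replacing a missing target by 0 lets linearity of \<gamma> be used without
    distinguishing cases.\<close>
  define C' where "C' = (if P then embed (q - 1) (r + 1) ?C else (\<lambda>_. 0))"
  define D' where "D' = (if 1 \<le> r then embed (q - 1) (r - 1) ?D else (\<lambda>_. 0))"
  have C': "C' \<in> form_space k (q - 1)"
  proof (cases P)
    case True
    then have "r + 1 \<in> lefschetz_degrees ?n (q - 1)" by (simp add: P_def)
    from embed_in_form_space[OF this CD(1)[OF True]] True show ?thesis by (simp add: C'_def)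
  qed (simp add: C'_def function_subspace_0[OF function_subspace_form_space])
  have D': "D' \<in> form_space k (q - 1)"
  proof (cases "1 \<le> r")
    case True
    from embed_in_form_space[OF mem_lefschetz_degrees_shift(2)[OF r True] CD(2)[OF True]] True
    show ?thesis by (simp add: D'_def)
  qed (simp add: D'_def function_subspace_0[OF function_subspace_form_space])
  have "delta_term k (flat \<alpha>) (flat \<eta>) q r \<phi> = (\<lambda>i. c * C' i + d * D' i)"
    by (auto simp: delta_term_def[abs_def] Let_def sharp_flat c_def d_def C'_def D'_def P_def l_def
        simp del: of_nat_Suc of_nat_add)
  then have L: "\<gamma> (q - 1) (delta_term k (flat \<alpha>) (flat \<eta>) q r \<phi>) = (\<lambda>x. c * \<gamma> (q - 1) C' x + d * \<gamma> (q - 1) D' x)"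
    using linear_betweenD(2)[OF lin function_subspace_scale[OF function_subspace_form_space C'] D']
      linear_between_scale[OF lin function_subspace_form_space C'] by simp
  have sub: "(\<lambda>y. \<phi> (x, y)) \<in> Alt0 r" for x using \<phi> by (simp add: tensor_space_def)
  show ?thesis
  proof
    fix x :: "H list \<times> ('n E list \<times> 'n E list)"
    obtain xs :: "H list" and es es' :: "'n E list" where x: "x = (xs, (es, es'))" by (cases x) auto
    let ?\<omega> = "\<lambda>y. \<phi> (\<alpha> # xs, y)"
    have gC: "c * \<gamma> (q - 1) C' x = (-1) ^ q * gamma_coeff ?n k q l * (vol es * sigma_wedge_div m (wedge_tracefree r ?e ?\<omega>) es')"
    proof (cases P)
      case True
      then have l1: "1 \<le> l" and mem: "r + 1 \<in> lefschetz_degrees ?n (q - 1)" using P by (simp_all add: P_def)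
      have idx: "(q - 1 - (r + 1)) div 2 = l - 1" "?n - (r + 1) - (l - 1) = m" "Suc (q - 1) = q" "Suc (l - 1) = l"
        using h l1 q by (auto simp: m_def)
      have "\<gamma> (q - 1) C' x = gamma_coeff ?n k (q - 1) (l - 1) * (vol es * sigma_wedge_div m (wedge_tracefree r ?e ?\<omega>) es')"
        using is_gammaD(3)[OF \<gamma> q' mem CD(1)[OF True], of \<alpha> ?e] True idx
        by (simp add: C'_def x tensor_op_def vol_tensor_apply sym_contr_def)
      moreover have "c * gamma_coeff ?n k (q - 1) (l - 1) = (-1) ^ q * gamma_coeff ?n k q l"
        using gamma_coeff_step_down[of k ?n "l - 1" "q - 1"] unfolding idx c_def .
      ultimately show ?thesis by (simp only: mult.assoc[symmetric])
    next
      case False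
      \<comment> \<open>A missing target means l = 0, hence m = n - r, and the m-th power of the
        symplectic form kills trace-free forms of degree r + 1.\<close>
      then have "sigma_wedge_div m (wedge_tracefree r ?e ?\<omega>) = (\<lambda>_. 0)"
        using P h by (intro sigma_wedge_div_Alt0_eq_0[OF wedge_tracefree_in_Alt0[OF sub h(2)]]) (auto simp: m_def)
      moreover have "\<gamma> (q - 1) C' = (\<lambda>_. 0)"
        using False linear_between_0[OF lin function_subspace_form_space] by (simp add: C'_def)
      ultimately show ?thesis by simp
    qed
    have gD: "d * \<gamma> (q - 1) D' x = - ((-1) ^ q * gamma_coeff ?n k q l *
        (vol es * (of_nat (m + 1) / of_nat (?n - r + 1) * sigma_wedge_div (m + 1) (contr ?e ?\<omega>) es')))"
    proof (cases "1 \<le> r")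
      case True
      note mem = mem_lefschetz_degrees_shift(2)[OF r True]
      have idx: "(q - 1 - (r - 1)) div 2 = l" "?n - (r - 1) - l = m + 1" "Suc (q - 1) = q" "l \<le> q - 1"
        using h True q by (auto simp: m_def)
      have g: "\<gamma> (q - 1) D' x = gamma_coeff ?n k (q - 1) l * (vol es * sigma_wedge_div (m + 1) (contr ?e ?\<omega>) es')"
        using is_gammaD(3)[OF \<gamma> q' mem CD(2)[OF True], of \<alpha> ?e] True idx
        by (simp add: D'_def x tensor_op_def vol_tensor_apply sym_contr_def)
      have "of_nat (k + q - l) / of_nat (k + q + 1) * gamma_coeff ?n k (q - 1) l = - ((-1) ^ q * gamma_coeff ?n k q l)"
        using gamma_coeff_step_same[OF idx(4), of k ?n] unfolding idx(3) .
      moreover have "d = of_nat (k + q - l) / of_nat (k + q + 1) * (of_nat (m + 1) / of_nat (?n - r + 1))"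
        by (simp only: d_def m_def)
      moreover have "a * b * g = a * g * b" for a b g :: complex by simp
      ultimately have "d * gamma_coeff ?n k (q - 1) l =
          - ((-1) ^ q * gamma_coeff ?n k q l) * (of_nat (m + 1) / of_nat (?n - r + 1))"
        by (simp only:)
      then show ?thesis unfolding g
        by (simp only: mult.assoc[symmetric]) (simp only: mult_ac mult_minus_left mult_minus_right)
    next
      case False
      then have "contr ?e ?\<omega> = (\<lambda>_. 0)" using sub[of "\<alpha> # xs"] by (intro contr_Alt_0 Alt0_Alt) (cases r, auto)
      moreover have "\<gamma> (q - 1) D' = (\<lambda>_. 0)"
        using False linear_between_0[OF lin function_subspace_form_space] by (simp add: D'_def)
      ultimately show ?thesis by (simp add: finitary_linear(3)[OF finitary_sigma_wedge_div])
    qed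
    have "symbol_delta q \<alpha> \<eta> (\<gamma> q (embed q r \<phi>)) x =
        (-1) ^ q * (gamma_coeff ?n k q l * (vol es * wedge (sharp ?e) (sigma_wedge_div m ?\<omega>) es'))"
      unfolding l_def[symmetric] is_gammaD(3)[OF \<gamma> q(2) r \<phi>, folded l_def, folded m_def]
      by (simp add: symbol_delta_def x tensor_op_def vol_tensor_apply sym_contr_def wedge_scale sharp_flat)
    also have "\<dots> = c * \<gamma> (q - 1) C' x + d * \<gamma> (q - 1) D' x"
      unfolding gC gD wedge_sigma_wedge_div[where r = r] by (simp add: algebra_simps)
    finally show "\<gamma> (q - 1) (delta_term k (flat \<alpha>) (flat \<eta>) q r \<phi>) x = symbol_delta q \<alpha> \<eta> (\<gamma> q (embed q r \<phi>)) x"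
      using L by simp
  qed
qed

lemma symbol_d_in_form_space:
  assumes "\<phi> \<in> form_space k q"
  shows "symbol_d k q \<alpha> \<eta> \<phi> \<in> form_space k (q + 1)"
proof -
  have "tensor_op (sym_mult (flat \<alpha>)) (wedge \<eta>) \<phi> \<in> form_space k (q + 1)"
    using assms sym_mult_in_Sym[of _ "k + q"] wedge_in_Alt unfolding form_space_def
    by (intro tensor_op_in[OF finitary_sym_mult _ finitary_wedge _ function_subspace_Sym function_subspace_Alt]) auto
  then show ?thesis unfolding symbol_d_def by (rule function_subspace_scale[OF function_subspace_form_space])
qed

lemma degree_part_in_form_space:
  assumes "\<phi> \<in> forms_space k" "q \<le> 2 * CARD('n)"
  shows "degree_part q (\<phi> :: 'n::finite forms) \<in> form_space k q"
  using assms by (auto simp: forms_space_def direct_sum_def degree_part_def dest!: spec[of _ q])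

lemma symbol_d_sum: "symbol_d k q \<alpha> \<eta> (\<lambda>i. \<Sum>r\<in>I. f r i) i = (\<Sum>r\<in>I. symbol_d k q \<alpha> \<eta> (f r) i)"
  unfolding symbol_d_def finitary_linear(5)[OF finitary_tensor_op[OF finitary_sym_mult finitary_wedge]]
  by (rule sum_distrib_left)

lemma sum_case_prod_add: "(\<Sum>(q, r)\<in>I. f q r + g q r) = (\<Sum>(q, r)\<in>I. f q r) + (\<Sum>(q, r)\<in>I. g q r)"
  by (simp add: case_prod_unfold sum.distrib)

lemma symbol_delta_sum: "symbol_delta q \<alpha> \<eta> (\<lambda>i. \<Sum>r\<in>I. f r i) = (\<lambda>i. \<Sum>r\<in>I. symbol_delta q \<alpha> \<eta> (f r) i)"
  by (rule ext) (simp add: symbol_delta_def tensor_op_def sym_contr_def case_prod_unfold wedge_sum sum_distrib_left)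

text \<open>Exhibits an explicit element of the fibre that \<gamma> maps to the symbol of \<delta>;
  injectivity of \<gamma> then evaluates \<open>inv_into\<close> at that symbol.\<close>

lemma
  fixes \<gamma> :: "nat \<Rightarrow> 'n::finite form \<Rightarrow> 'n dual_form" and \<Phi> :: "'n lefschetz_family"
    and \<alpha> :: H and \<eta> :: "'n E"
  assumes \<gamma>: "is_gamma k \<gamma>" and \<Phi>: "\<Phi> \<in> lefschetz_space k" and q: "q + 1 \<le> 2 * CARD('n)"
  defines "\<delta> \<equiv> (\<lambda>i. \<Sum>r\<in>lefschetz_degrees CARD('n) (q + 1).
    delta_term k (flat \<alpha>) (flat \<eta>) (q + 1) r (lefschetz_component (q + 1) r \<Phi>) i)"
  shows delta_sum_in_form_space: "\<delta> \<in> form_space k q"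
    and gamma_delta_sum: "\<gamma> q \<delta> = symbol_delta (q + 1) \<alpha> \<eta> (\<gamma> (q + 1) (degree_part (q + 1) (lefschetz_sum \<Phi>)))"
proof -
  let ?D = "lefschetz_degrees CARD('n) (q + 1)"
  have comp: "lefschetz_component (q + 1) r \<Phi> \<in> tensor_space (Sym (k + (q + 1))) (Alt0 r)" if "r \<in> ?D" for r
    using that lefschetz_component_in[OF \<Phi>, of "q + 1" r] by (simp only: lefschetz_degrees_def mem_Collect_eq)
  have mem: "delta_term k (flat \<alpha>) (flat \<eta>) (q + 1) r (lefschetz_component (q + 1) r \<Phi>) \<in> form_space k q" if "r \<in> ?D" for r
    using delta_term_in_form_space(3)[OF that _ comp[OF that]] by simp
  show "\<delta> \<in> form_space k q"
    unfolding \<delta>_def by (rule function_subspace_sum_plain[OF function_subspace_form_space mem])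
  have "degree_part (q + 1) (lefschetz_sum \<Phi>) = (\<lambda>i. \<Sum>r\<in>?D. embed (q + 1) r (lefschetz_component (q + 1) r \<Phi>) i)"
    by (simp only: degree_part_def lefschetz_sum_eq)
  then have "\<gamma> (q + 1) (degree_part (q + 1) (lefschetz_sum \<Phi>)) =
      (\<lambda>i. \<Sum>r\<in>?D. \<gamma> (q + 1) (embed (q + 1) r (lefschetz_component (q + 1) r \<Phi>)) i)"
    using linear_between_sum_plain[OF is_gammaD(2)[OF \<gamma> q] function_subspace_form_space finite_lefschetz_degrees
        embed_in_form_space[OF _ comp]] by simp
  then have "symbol_delta (q + 1) \<alpha> \<eta> (\<gamma> (q + 1) (degree_part (q + 1) (lefschetz_sum \<Phi>))) =
      (\<lambda>i. \<Sum>r\<in>?D. symbol_delta (q + 1) \<alpha> \<eta> (\<gamma> (q + 1) (embed (q + 1) r (lefschetz_component (q + 1) r \<Phi>))) i)"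
    by (simp only: symbol_delta_sum)
  also have "\<dots> = (\<lambda>i. \<Sum>r\<in>?D. \<gamma> q (delta_term k (flat \<alpha>) (flat \<eta>) (q + 1) r (lefschetz_component (q + 1) r \<Phi>)) i)"
  proof (intro ext sum.cong refl)
    fix i r assume "r \<in> ?D"
    from gamma_delta_term[OF \<gamma> this _ q comp[OF this], of \<alpha> \<eta>]
    show "symbol_delta (q + 1) \<alpha> \<eta> (\<gamma> (q + 1) (embed (q + 1) r (lefschetz_component (q + 1) r \<Phi>))) i =
        \<gamma> q (delta_term k (flat \<alpha>) (flat \<eta>) (q + 1) r (lefschetz_component (q + 1) r \<Phi>)) i" by simp
  qed
  also have "\<dots> = \<gamma> q \<delta>"
    unfolding \<delta>_def using q
    by (intro linear_between_sum_plain[OF is_gammaD(2)[OF \<gamma>] function_subspace_form_space finite_lefschetz_degrees mem, symmetric])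
      auto
  finally show "\<gamma> q \<delta> = symbol_delta (q + 1) \<alpha> \<eta> (\<gamma> (q + 1) (degree_part (q + 1) (lefschetz_sum \<Phi>)))" by simp
qed

text \<open>The symbol identity on a whole fibre. The sums over sources and targets are exchanged,
  so that the identity for one source applies; membership in the fibres follows from the same
  decomposition of \<phi>.\<close>

lemma
  fixes \<gamma> :: "nat \<Rightarrow> 'n::finite form \<Rightarrow> 'n dual_form" and \<phi> :: "'n forms"
  assumes \<gamma>: "is_gamma k \<gamma>" and \<phi>: "\<phi> \<in> forms_space k"
  shows cliff_eq: "cliff k (flat \<alpha>) (flat \<eta>) \<phi> (Q, i) = of_real (sqrt 2) *
     ((if 1 \<le> Q \<and> Q \<le> 2 * CARD('n) then symbol_d k (Q - 1) \<alpha> \<eta> (degree_part (Q - 1) \<phi>) i else 0)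
    + (if Q + 1 \<le> 2 * CARD('n) then inv_into (form_space k Q) (\<gamma> Q)
         (symbol_delta (Q + 1) \<alpha> \<eta> (\<gamma> (Q + 1) (degree_part (Q + 1) \<phi>))) i else 0))" (is "_ = ?R Q i")
    and symbol_delta_in: "Q + 1 \<le> 2 * CARD('n) \<Longrightarrow>
       symbol_delta (Q + 1) \<alpha> \<eta> (\<gamma> (Q + 1) (degree_part (Q + 1) \<phi>)) \<in> dual_form_space k Q"
    and cliff_in: "cliff k (flat \<alpha>) (flat \<eta>) \<phi> \<in> forms_space k"
proof -
  let ?n = "CARD('n)"
  define \<Phi> where "\<Phi> = inv_into (lefschetz_space k) lefschetz_sum \<phi>"
  have "\<phi> \<in> lefschetz_sum ` lefschetz_space k" using lefschetz_sum_surj[OF \<phi>] by auto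
  then have \<Phi>: "\<Phi> \<in> lefschetz_space k" and \<phi>_eq: "\<phi> = lefschetz_sum \<Phi>"
    unfolding \<Phi>_def by (simp_all add: inv_into_into f_inv_into_f)
  note delta = delta_sum_in_form_space[OF \<gamma> \<Phi>] gamma_delta_sum[OF \<gamma> \<Phi>, folded \<phi>_eq]
  show sd: "symbol_delta (Q + 1) \<alpha> \<eta> (\<gamma> (Q + 1) (degree_part (Q + 1) \<phi>)) \<in> dual_form_space k Q"
    if "Q + 1 \<le> 2 * ?n" for Q
  proof -
    have Q: "Q \<le> 2 * ?n" using that by simp
    show ?thesis unfolding delta(2)[OF that, of \<alpha> \<eta>, symmetric]
      by (rule linear_betweenD(1)[OF is_gammaD(2)[OF \<gamma> Q] delta(1)[OF that]])
  qed
  have inv: "inv_into (form_space k Q) (\<gamma> Q) (symbol_delta (Q + 1) \<alpha> \<eta> (\<gamma> (Q + 1) (degree_part (Q + 1) \<phi>))) =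
      (\<lambda>i. \<Sum>r\<in>lefschetz_degrees ?n (Q + 1).
        delta_term k (flat \<alpha>) (flat \<eta>) (Q + 1) r (lefschetz_component (Q + 1) r \<Phi>) i)"
    if "Q + 1 \<le> 2 * ?n" for Q
    unfolding delta(2)[OF that, symmetric] using that
    by (intro inv_into_f_f[OF bij_betw_imp_inj_on[OF is_gammaD(1)[OF \<gamma>]] delta(1)]) auto
  show eq: "cliff k (flat \<alpha>) (flat \<eta>) \<phi> (Q, i) = ?R Q i" for Q i
  proof (cases "Q \<le> 2 * ?n")
    case False
    then have "lefschetz_degrees ?n Q = {}" by (auto simp: lefschetz_degrees_def lefschetz_indices_def)
    then show ?thesis using False unfolding cliff_def lefschetz_sum_eq by simp
  next
    case True
    have "cliff k (flat \<alpha>) (flat \<eta>) \<phi> (Q, i) =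
        (\<Sum>s\<in>lefschetz_degrees ?n Q. embed Q s (\<lambda>j. of_real (sqrt 2) *
          (\<Sum>x\<in>lefschetz_indices ?n. clifford_term k (flat \<alpha>) (flat \<eta>) (fst x) (snd x)
             (lefschetz_component (fst x) (snd x) \<Phi>) (Q, s) j)) i)"
      unfolding cliff_def \<Phi>_def[symmetric] lefschetz_sum_eq
    proof (rule sum.cong[OF refl])
      fix s assume "s \<in> lefschetz_degrees ?n Q"
      then have "lefschetz_component Q s (cliff_lefschetz k (flat \<alpha>) (flat \<eta>) \<Phi>) = (\<lambda>j. of_real (sqrt 2) *
          (\<Sum>x\<in>lefschetz_indices ?n. clifford_term k (flat \<alpha>) (flat \<eta>) (fst x) (snd x)
             (lefschetz_component (fst x) (snd x) \<Phi>) (Q, s) j))"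
        using cliff_lefschetz_eq[OF \<Phi>, of "(Q, s)"]
        by (simp add: lefschetz_component_def[of Q s] lefschetz_degrees_def case_prod_unfold)
      then show "embed Q s (lefschetz_component Q s (cliff_lefschetz k (flat \<alpha>) (flat \<eta>) \<Phi>)) i =
          embed Q s (\<lambda>j. of_real (sqrt 2) *
          (\<Sum>x\<in>lefschetz_indices ?n. clifford_term k (flat \<alpha>) (flat \<eta>) (fst x) (snd x)
             (lefschetz_component (fst x) (snd x) \<Phi>) (Q, s) j)) i" by simp
    qed
    also have "\<dots> = of_real (sqrt 2) * (\<Sum>x\<in>lefschetz_indices ?n. \<Sum>s\<in>lefschetz_degrees ?n Q.
        embed Q s (clifford_term k (flat \<alpha>) (flat \<eta>) (fst x) (snd x) (lefschetz_component (fst x) (snd x) \<Phi>) (Q, s)) i)"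
      by (simp only: finitary_linear(2,5)[OF finitary_embed] sum_distrib_left[symmetric])
        (subst sum.swap, simp)
    \<comment> \<open>Only sources of degree Q - 1 and Q + 1 reach degree Q. The guard 1 \<le> Q
      excludes the spurious source that truncated subtraction creates at Q = 0.\<close>
    also have "(\<Sum>x\<in>lefschetz_indices ?n. \<Sum>s\<in>lefschetz_degrees ?n Q.
        embed Q s (clifford_term k (flat \<alpha>) (flat \<eta>) (fst x) (snd x) (lefschetz_component (fst x) (snd x) \<Phi>) (Q, s)) i) =
      (\<Sum>(q, r)\<in>lefschetz_indices ?n.
        (if q = Q - 1 then (if 1 \<le> Q then symbol_d k (Q - 1) \<alpha> \<eta> (embed (Q - 1) r (lefschetz_component (Q - 1) r \<Phi>)) i else 0) else 0) +
        (if q = Q + 1 then delta_term k (flat \<alpha>) (flat \<eta>) (Q + 1) r (lefschetz_component (Q + 1) r \<Phi>) i else 0))"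
    proof (rule sum.cong[OF refl], clarify)
      fix q r assume "(q, r) \<in> lefschetz_indices ?n"
      then have "r \<in> lefschetz_degrees ?n q" "lefschetz_component q r \<Phi> \<in> tensor_space (Sym (k + q)) (Alt0 r)"
        using lefschetz_component_in[OF \<Phi>] by (simp_all add: lefschetz_degrees_def)
      from embed_clifford_terms[OF this, of Q \<alpha> \<eta> i]
      show "(\<Sum>s\<in>lefschetz_degrees ?n Q. embed Q s (clifford_term k (flat \<alpha>) (flat \<eta>) (fst (q, r)) (snd (q, r))
           (lefschetz_component (fst (q, r)) (snd (q, r)) \<Phi>) (Q, s)) i) =
        (if q = Q - 1 then (if 1 \<le> Q then symbol_d k (Q - 1) \<alpha> \<eta> (embed (Q - 1) r (lefschetz_component (Q - 1) r \<Phi>)) i else 0) else 0) +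
        (if q = Q + 1 then delta_term k (flat \<alpha>) (flat \<eta>) (Q + 1) r (lefschetz_component (Q + 1) r \<Phi>) i else 0)"
        by auto
    qed
    also have "\<dots> = (if 1 \<le> Q then symbol_d k (Q - 1) \<alpha> \<eta> (degree_part (Q - 1) \<phi>) i else 0) +
        (\<Sum>r\<in>lefschetz_degrees ?n (Q + 1). delta_term k (flat \<alpha>) (flat \<eta>) (Q + 1) r (lefschetz_component (Q + 1) r \<Phi>) i)"
    proof -
      have "degree_part (Q - 1) \<phi> = (\<lambda>i. \<Sum>r\<in>lefschetz_degrees ?n (Q - 1). embed (Q - 1) r (lefschetz_component (Q - 1) r \<Phi>) i)"
        by (simp only: degree_part_def \<phi>_eq lefschetz_sum_eq)
      then have "symbol_d k (Q - 1) \<alpha> \<eta> (degree_part (Q - 1) \<phi>) i =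
          (\<Sum>r\<in>lefschetz_degrees ?n (Q - 1). symbol_d k (Q - 1) \<alpha> \<eta> (embed (Q - 1) r (lefschetz_component (Q - 1) r \<Phi>)) i)"
        by (simp only: symbol_d_sum)
      then show ?thesis
        unfolding sum_case_prod_add sum_lefschetz_indices by simp
    qed
    also have "(\<Sum>r\<in>lefschetz_degrees ?n (Q + 1). delta_term k (flat \<alpha>) (flat \<eta>) (Q + 1) r (lefschetz_component (Q + 1) r \<Phi>) i) =
        (if Q + 1 \<le> 2 * ?n then inv_into (form_space k Q) (\<gamma> Q)
         (symbol_delta (Q + 1) \<alpha> \<eta> (\<gamma> (Q + 1) (degree_part (Q + 1) \<phi>))) i else 0)"
    proof (cases "Q + 1 \<le> 2 * ?n")
      case True
      then show ?thesis using inv[OF True] by simp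
    next
      case False
      then have "lefschetz_degrees ?n (Q + 1) = {}" by (auto simp: lefschetz_degrees_def lefschetz_indices_def)
      then show ?thesis using False by simp
    qed
    finally show ?thesis using True by simp
  qed
  show "cliff k (flat \<alpha>) (flat \<eta>) \<phi> \<in> forms_space k"
    unfolding forms_space_def direct_sum_def
  proof (intro CollectI allI)
    fix Q
    show "(\<lambda>i. cliff k (flat \<alpha>) (flat \<eta>) \<phi> (Q, i)) \<in> (if Q \<in> {0..2 * ?n} then form_space k Q else {\<lambda>_. 0})"
    proof (cases "Q \<le> 2 * ?n")
      case True
      have "(\<lambda>i. if 1 \<le> Q \<and> Q \<le> 2 * ?n then symbol_d k (Q - 1) \<alpha> \<eta> (degree_part (Q - 1) \<phi>) i else 0) \<in> form_space k Q"
      proof (cases "1 \<le> Q")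
        case Q: True
        then have "Q - 1 \<le> 2 * ?n" "Q - 1 + 1 = Q" using True by simp_all
        with symbol_d_in_form_space[OF degree_part_in_form_space[OF \<phi>, of "Q - 1"], of \<alpha> \<eta>] Q True
        show ?thesis by simp
      qed (simp add: function_subspace_0[OF function_subspace_form_space])
      moreover have "(\<lambda>i. if Q + 1 \<le> 2 * ?n then inv_into (form_space k Q) (\<gamma> Q)
         (symbol_delta (Q + 1) \<alpha> \<eta> (\<gamma> (Q + 1) (degree_part (Q + 1) \<phi>))) i else 0) \<in> form_space k Q"
      proof (cases "Q + 1 \<le> 2 * ?n")
        case Q: True
        show ?thesis unfolding inv[OF Q] using Q delta(1)[OF Q, of \<alpha> \<eta>] by simp
      qed (simp add: function_subspace_0[OF function_subspace_form_space])
      ultimately show ?thesis unfolding eq using True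
        by (auto intro!: function_subspace_scale[OF function_subspace_form_space] function_subspace_add[OF function_subspace_form_space])
    next
      case False
      then show ?thesis unfolding eq by simp
    qed
  qed
qed

section \<open>Horizontal curves\<close>

text \<open>Picard iteration. Time is clamped to {0..a} by c, so that the integral operator acts on
  the complete space of bounded continuous functions on the whole line; K * a < 1 makes it a
  contraction there.\<close>

lemma linear_ode_exists:
  fixes f :: "real \<Rightarrow> 'a::banach \<Rightarrow> 'a"
  assumes a: "0 < a" and cont: "continuous_on ({0..a} \<times> UNIV) (\<lambda>(t, v). f t v)"
    and lipschitz: "\<And>t v w. t \<in> {0..a} \<Longrightarrow> norm (f t v - f t w) \<le> K * norm (v - w)"
    and K: "0 \<le> K" "K * a < 1"
  shows "\<exists>V. V 0 = v0 \<and> (\<forall>t\<in>{0..a}. (V has_vector_derivative f t (V t)) (at t within {0..a}))"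
proof -
  define c where "c t = max 0 (min a t)" for t :: real
  have c: "c t \<in> {0..a}" and c_id: "t \<in> {0..a} \<Longrightarrow> c t = t" for t using a by (auto simp: c_def)
  define g where "g U t = v0 + integral {0..t} (\<lambda>s. f s (apply_bcontfun U s))" for U and t :: real
  define T where "T U = Bcontfun (\<lambda>t. g U (c t))" for U
  have cont_f: "continuous_on {0..a} (\<lambda>s. f s (apply_bcontfun U s))" for U
  proof -
    have "continuous_on {0..a} (\<lambda>s. (s, apply_bcontfun U s))"
      by (intro continuous_on_Pair continuous_on_id continuous_on_apply_bcontfun)
    from continuous_on_compose2[OF cont this] show ?thesis by auto
  qed
  have cont_g: "continuous_on {0..a} (g U)" for U
    unfolding g_def[abs_def]
    by (intro continuous_intros indefinite_integral_continuous_1 integrable_continuous_interval cont_f)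
  have T: "apply_bcontfun (T U) = (\<lambda>t. g U (c t))" for U
  proof -
    have "continuous_on UNIV (\<lambda>t. g U (c t))"
      by (rule continuous_on_compose2[OF cont_g]) (use c in \<open>auto simp: c_def intro!: continuous_intros\<close>)
    moreover have "bounded (range (\<lambda>t. g U (c t)))"
      using c by (intro bounded_subset[OF compact_imp_bounded[OF compact_continuous_image[OF cont_g compact_Icc]]]) auto
    ultimately show ?thesis by (simp add: T_def Bcontfun_inverse bcontfun_def)
  qed
  have "\<exists>!U. T U = U"
  proof (rule banach_fix_type)
    show "0 \<le> K * a" "K * a < 1" using K a by auto
    show "\<forall>U W. dist (T U) (T W) \<le> K * a * dist U W"
    proof (intro allI dist_bound)
      fix U W t
      let ?d = "\<lambda>s. f s (apply_bcontfun U s) - f s (apply_bcontfun W s)"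
      have sub: "{0..c t} \<subseteq> {0..a}" using c[of t] by auto
      have int: "(\<lambda>s. f s (apply_bcontfun U s)) integrable_on {0..c t}" for U
        by (intro integrable_continuous_interval continuous_on_subset[OF cont_f sub])
      have "norm (integral {0..c t} ?d) \<le> K * dist U W * (c t - 0)"
      proof (rule integral_bound)
        show "continuous_on {0..c t} ?d"
          by (intro continuous_intros continuous_on_subset[OF cont_f sub])
        fix s assume "s \<in> {0..c t}"
        then have "norm (?d s) \<le> K * norm (apply_bcontfun U s - apply_bcontfun W s)"
          using sub by (intro lipschitz) auto
        also have "\<dots> \<le> K * dist U W"
          using dist_bounded[of U s W] K(1) by (intro mult_left_mono) (auto simp: dist_norm)
        finally show "norm (?d s) \<le> K * dist U W" .
      qed (use c in auto)
      also have "\<dots> \<le> K * dist U W * a" using c[of t] K(1) by (intro mult_left_mono) auto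
      also have "integral {0..c t} ?d = g U (c t) - g W (c t)"
        by (simp add: g_def integral_diff[OF int int])
      finally show "dist (apply_bcontfun (T U) t) (apply_bcontfun (T W) t) \<le> K * a * dist U W"
        by (simp add: T dist_norm mult_ac)
    qed
  qed
  then obtain U where U: "T U = U" by blast
  have U_eq: "apply_bcontfun U t = g U t" if "t \<in> {0..a}" for t
    using fun_cong[OF T[of U], of t] c_id[OF that] by (simp add: U)
  show ?thesis
  proof (intro exI[of _ "apply_bcontfun U"] conjI ballI)
    show "apply_bcontfun U 0 = v0" using a by (subst U_eq) (auto simp: g_def)
    fix t assume t: "t \<in> {0..a}"
    have "(g U has_vector_derivative 0 + f t (apply_bcontfun U t)) (at t within {0..a})"
      unfolding g_def[abs_def]
      by (intro has_vector_derivative_add has_vector_derivative_const integral_has_vector_derivative cont_f t)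
    then show "(apply_bcontfun U has_vector_derivative f t (apply_bcontfun U t)) (at t within {0..a})"
      using has_vector_derivative_transform[OF t U_eq] by simp
  qed
qed

section \<open>Continuity of the Christoffel symbols\<close>

lemma continuous_on_det:
  fixes M :: "'a::topological_space \<Rightarrow> real^'n^'n"
  assumes "\<And>i j. continuous_on S (\<lambda>x. M x $ i $ j)"
  shows "continuous_on S (\<lambda>x. det (M x))"
  unfolding det_def by (intro continuous_intros assms)

text \<open>By Cramer's rule each entry of the inverse is a quotient of determinants, with non-zero
  denominator.\<close>

lemma continuous_on_matrix_inv:
  fixes M :: "'a::topological_space \<Rightarrow> real^'n^'n"
  assumes cont: "\<And>i j. continuous_on S (\<lambda>x. M x $ i $ j)" and inv: "\<And>x. x \<in> S \<Longrightarrow> invertible (M x)"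
  shows "continuous_on S (\<lambda>x. matrix_inv (M x) $ i $ l)"
proof -
  let ?N = "\<lambda>x. \<chi> i' j. if j = i then axis l 1 $ i' else M x $ i' $ j"
  have "matrix_inv (M x) $ i $ l = det (?N x) / det (M x)" if "x \<in> S" for x
  proof -
    have det: "det (M x) \<noteq> 0" using inv[OF that] invertible_det_nz by blast
    have "M x *v (matrix_inv (M x) *v axis l 1) = axis l 1"
      using inv[OF that] by (simp add: matrix_vector_mul_assoc matrix_inv_inverse)
    then have "matrix_inv (M x) *v axis l 1 =
        (\<chi> k. det (\<chi> i j. if j = k then axis l 1 $ i else M x $ i $ j) / det (M x))"
      using cramer[OF det] by blast
    then have "(matrix_inv (M x) *v axis l 1) $ i = det (?N x) / det (M x)" by simp
    then show ?thesis by (simp add: matrix_vector_mul_component inner_axis)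
  qed
  moreover have "continuous_on S (\<lambda>x. det (?N x) / det (M x))"
  proof (rule continuous_on_divide)
    show "continuous_on S (\<lambda>x. det (?N x))"
    proof (rule continuous_on_det)
      show "continuous_on S (\<lambda>x. ?N x $ i' $ j)" for i' j
        by (cases "j = i") (auto intro!: continuous_intros cont)
    qed
    show "continuous_on S (\<lambda>x. det (M x))" by (rule continuous_on_det[OF cont])
    show "\<forall>x\<in>S. det (M x) \<noteq> 0" using inv invertible_det_nz by blast
  qed
  ultimately show ?thesis by (simp cong: continuous_on_cong)
qed

lemma smooth_on_differentiable: "smooth_on S f \<Longrightarrow> x \<in> S \<Longrightarrow> f differentiable (at x)"
  and smooth_on_continuous: "smooth_on S f \<Longrightarrow> continuous_on S f"
  and smooth_on_derivative_continuous: "smooth_on S f \<Longrightarrow> continuous_on S (\<lambda>x. frechet_derivative f (at x) v)"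
  unfolding smooth_on_def by (metis Ck_on.simps)+

lemma continuous_on_partial_deriv:
  fixes G :: "real^'d::finite \<Rightarrow> real^'d^'d"
  assumes "smooth_on S G"
  shows "continuous_on S (partial_deriv (\<lambda>y. G y $ l $ k) j)"
proof -
  have "partial_deriv (\<lambda>y. G y $ l $ k) j x = frechet_derivative G (at x) (axis j 1) $ l $ k" if "x \<in> S" for x
  proof -
    have "(G has_derivative frechet_derivative G (at x)) (at x)"
      using smooth_on_differentiable[OF assms that] by (simp add: frechet_derivative_works)
    then have "((\<lambda>y. G y $ l $ k) has_derivative (\<lambda>v. frechet_derivative G (at x) v $ l $ k)) (at x)"
      by (intro bounded_linear.has_derivative[OF bounded_linear_vec_nth])
    from frechet_derivative_at[OF this] show ?thesis by (simp add: partial_deriv_def) (metis)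
  qed
  moreover have "continuous_on S (\<lambda>x. frechet_derivative G (at x) (axis j 1) $ l $ k)"
    by (intro continuous_intros smooth_on_derivative_continuous[OF assms])
  ultimately show ?thesis by (simp cong: continuous_on_cong)
qed

lemma continuous_on_christoffel:
  assumes R: "riemannian_manifold X A g" and C: "C \<in> A"
  shows "continuous_on (snd C ` fst C) (\<lambda>x. christoffel g C x i j k)"
proof -
  let ?S = "snd C ` fst C"
  have smooth: "smooth_on ?S (g C)" using R C by (auto simp: riemannian_manifold_def)
  have "invertible (g C x)" if "x \<in> ?S" for x
  proof -
    have pos: "0 < v \<bullet> (g C x *v v)" if "v \<noteq> 0" for v
      using R C \<open>x \<in> ?S\<close> that unfolding riemannian_manifold_def by blast
    then have "g C x *v v = 0 \<Longrightarrow> v = 0" for v by (metis inner_zero_right less_irrefl)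
    then have "\<exists>B. B ** g C x = mat 1" using matrix_left_invertible_ker by blast
    then show ?thesis using invertible_left_inverse by blast
  qed
  moreover have "continuous_on ?S (\<lambda>x. g C x $ i $ j)" for i j
    by (intro continuous_intros smooth_on_continuous[OF smooth])
  ultimately have "continuous_on ?S (\<lambda>x. matrix_inv (g C x) $ i $ l)" for i l
    by (intro continuous_on_matrix_inv)
  then show ?thesis
    unfolding christoffel_def
    by (intro continuous_on_mult continuous_on_const continuous_on_sum continuous_on_add continuous_on_diff
        continuous_on_partial_deriv[OF smooth])
qed

lemma chart_image_open:
  assumes "riemannian_manifold X A g" "C \<in> A"
  shows "open (snd C ` fst C)"
  using assms unfolding riemannian_manifold_def smooth_manifold_def by blast

text \<open>The base curve runs along a straight segment in the chart, over which parallelism is a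
  linear equation for the frame. Bounds for the Christoffel symbols on a closed ball give its
  Lipschitz constant K.\<close>

lemma horizontal_curve_exists:
  fixes C :: "('m, 'd::finite) chart" and U0 :: "('n::finite, 'd) frame_coords"
  assumes R: "riemannian_manifold X A g" and C: "C \<in> A" and x0: "x0 \<in> snd C ` fst C"
  shows "\<exists>x U. horizontal_curve g C x U \<and> x 0 = x0 \<and> U 0 = U0 \<and> (x has_vector_derivative w) (at 0 within {0..1})"
proof -
  let ?S = "snd C ` fst C"
  obtain r where r: "0 < r" "cball x0 r \<subseteq> ?S"
    using open_contains_cball[THEN iffD1, OF chart_image_open[OF R C]] x0 by blast
  note cont_S = continuous_on_christoffel[OF R C]
  have "\<exists>B. \<forall>x\<in>cball x0 r. \<bar>christoffel g C x i j k\<bar> \<le> B" for i j k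
  proof -
    have "bounded ((\<lambda>x. christoffel g C x i j k) ` cball x0 r)"
      by (intro compact_imp_bounded compact_continuous_image continuous_on_subset[OF cont_S r(2)] compact_cball)
    then show ?thesis by (auto simp: bounded_iff)
  qed
  then obtain B where B: "\<And>i j k x. x \<in> cball x0 r \<Longrightarrow> \<bar>christoffel g C x i j k\<bar> \<le> B i j k" by metis
  define F :: "real \<Rightarrow> ('n, 'd) frame_coords \<Rightarrow> ('n, 'd) frame_coords" where
    "F s V = (\<chi> i. - (\<Sum>j\<in>UNIV. \<Sum>k\<in>UNIV. (christoffel g C (x0 + s *\<^sub>R w) i j k * w $ j) *\<^sub>R V $ k))" for s V
  define K where "K = (\<Sum>i\<in>UNIV. \<Sum>j\<in>UNIV. \<Sum>k\<in>UNIV. \<bar>B i j k\<bar> * \<bar>w $ j\<bar>)"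
  have K: "0 \<le> K" unfolding K_def by (intro sum_nonneg) auto
  \<comment> \<open>The first bound keeps the segment in the ball, the second keeps K * a below 1;
    adding 1 to each denominator covers w = 0 and K = 0.\<close>
  define a where "a = min (r / (norm w + 1)) (1 / (K + 1) / 2)"
  have a: "0 < a" using r K by (auto simp: a_def intro!: divide_pos_pos add_nonneg_pos)
  have "K * a \<le> K * (1 / (K + 1) / 2)" using K by (intro mult_left_mono) (auto simp: a_def)
  also have "\<dots> < 1" using K by (simp add: field_simps)
  finally have Ka: "K * a < 1" .
  have in_ball: "x0 + s *\<^sub>R w \<in> cball x0 r" if "s \<in> {0..a}" for s
  proof -
    have "s * norm w \<le> r / (norm w + 1) * norm w" using that by (intro mult_right_mono) (auto simp: a_def)
    also have "\<dots> \<le> r" using r(1) by (simp add: pos_divide_le_eq add_nonneg_pos)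
    finally show ?thesis using that by (simp add: dist_norm)
  qed
  have "\<exists>V. V 0 = U0 \<and> (\<forall>t\<in>{0..a}. (V has_vector_derivative F t (V t)) (at t within {0..a}))"
  proof (rule linear_ode_exists[OF a _ _ K Ka])
    have *: "continuous_on ({0..a} \<times> (UNIV :: ('n, 'd) frame_coords set)) (\<lambda>p. christoffel g C (x0 + fst p *\<^sub>R w) i j k)" for i j k
      using in_ball r(2) by (intro continuous_on_compose2[OF cont_S]) (auto intro!: continuous_intros)
    show "continuous_on ({0..a} \<times> UNIV) (\<lambda>(t, v). F t v)"
      unfolding F_def case_prod_unfold by (intro continuous_intros *)
    fix t and v v' :: "('n, 'd) frame_coords" assume t: "t \<in> {0..a}"
    have "F t v - F t v' = F t (v - v')"
      by (simp add: F_def vec_eq_iff scaleR_right_diff_distrib sum_subtractf)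
    moreover have "norm (F t u) \<le> K * norm u" for u
    proof -
      have "norm (F t u) \<le> (\<Sum>i\<in>UNIV. norm (F t u $ i))" unfolding norm_vec_def by (rule L2_set_le_sum) auto
      also have "\<dots> \<le> (\<Sum>i\<in>UNIV. \<Sum>j\<in>UNIV. \<Sum>k\<in>UNIV. \<bar>B i j k\<bar> * \<bar>w $ j\<bar> * norm u)"
      proof (rule sum_mono)
        fix i
        have "norm (F t u $ i) \<le> (\<Sum>j\<in>UNIV. \<Sum>k\<in>UNIV. norm ((christoffel g C (x0 + t *\<^sub>R w) i j k * w $ j) *\<^sub>R u $ k))"
          unfolding F_def by (auto intro!: order_trans[OF norm_sum] sum_mono)
        also have "\<dots> \<le> (\<Sum>j\<in>UNIV. \<Sum>k\<in>UNIV. \<bar>B i j k\<bar> * \<bar>w $ j\<bar> * norm u)"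
        proof (intro sum_mono)
          fix j k
          have "\<bar>christoffel g C (x0 + t *\<^sub>R w) i j k\<bar> \<le> \<bar>B i j k\<bar>"
            using B[OF in_ball[OF t], of i j k] by linarith
          then show "norm ((christoffel g C (x0 + t *\<^sub>R w) i j k * w $ j) *\<^sub>R u $ k) \<le> \<bar>B i j k\<bar> * \<bar>w $ j\<bar> * norm u"
            by (simp add: abs_mult mult_mono Finite_Cartesian_Product.norm_nth_le)
        qed
        finally show "norm (F t u $ i) \<le> (\<Sum>j\<in>UNIV. \<Sum>k\<in>UNIV. \<bar>B i j k\<bar> * \<bar>w $ j\<bar> * norm u)" .
      qed
      also have "\<dots> = K * norm u" by (simp add: K_def sum_distrib_right)
      finally show ?thesis .
    qed
    ultimately show "norm (F t v - F t v') \<le> K * norm (v - v')" by simp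
  qed
  then obtain V where V: "V 0 = U0" "\<And>t. t \<in> {0..a} \<Longrightarrow> (V has_vector_derivative F t (V t)) (at t within {0..a})"
    by blast
  \<comment> \<open>\<open>\<phi>\<close> has slope \<open>1\<close> at \<open>0\<close> but stays below \<open>a\<close>, so the curve has velocity \<open>w\<close> and is short enough
    for the Picard operator to be a contraction.\<close>
  define \<phi> where "\<phi> t = a * t / (a + t)" for t
  define \<phi>' where "\<phi>' t = a * a / ((a + t) * (a + t))" for t
  have \<phi>: "(\<phi> has_vector_derivative \<phi>' t) (at t within {0..1})" if "t \<in> {0..1}" for t
  proof -
    have "a + t \<noteq> 0" using a that by auto
    then have "(\<phi> has_real_derivative \<phi>' t) (at t within {0..1})"
      unfolding \<phi>_def[abs_def] \<phi>'_def
      by (auto intro!: derivative_eq_intros simp: field_simps)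
    then show ?thesis by (simp add: has_real_derivative_iff_has_vector_derivative)
  qed
  have \<phi>_in: "\<phi> t \<in> {0..a}" if "t \<in> {0..1}" for t
    using a that by (auto simp: \<phi>_def field_simps)
  show ?thesis
  proof (intro exI conjI)
    let ?x = "\<lambda>t. x0 + \<phi> t *\<^sub>R w" and ?U = "V \<circ> \<phi>"
    have x: "(?x has_vector_derivative \<phi>' t *\<^sub>R w) (at t within {0..1})" if "t \<in> {0..1}" for t
      using \<phi>[OF that] unfolding has_vector_derivative_def
      by (auto intro!: derivative_eq_intros)
    show "horizontal_curve g C ?x ?U"
      unfolding horizontal_curve_def
    proof (intro exI[of _ "\<lambda>t. \<phi>' t *\<^sub>R w"] conjI ballI)
      have "continuous_on {0..1} \<phi>'"
        unfolding \<phi>'_def[abs_def] using a by (intro continuous_intros) auto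
      then show "continuous_on {0..1} (\<lambda>t. \<phi>' t *\<^sub>R w)" by (intro continuous_intros)
      fix t :: real assume t: "t \<in> {0..1}"
      show "?x t \<in> ?S" using in_ball[OF \<phi>_in[OF t]] r(2) by blast
      show "(?x has_vector_derivative \<phi>' t *\<^sub>R w) (at t within {0..1})" by (rule x[OF t])
      have "(V has_vector_derivative F (\<phi> t) (V (\<phi> t))) (at (\<phi> t) within \<phi> ` {0..1})"
        by (rule has_vector_derivative_within_subset[OF V(2)[OF \<phi>_in[OF t]]]) (use \<phi>_in in auto)
      from vector_diff_chain_within[OF \<phi>[OF t] this]
      have "(?U has_vector_derivative \<phi>' t *\<^sub>R F (\<phi> t) (V (\<phi> t))) (at t within {0..1})" .
      also have "\<phi>' t *\<^sub>R F (\<phi> t) (V (\<phi> t)) = (\<chi> i. - (\<Sum>j\<in>UNIV. \<Sum>k\<in>UNIV.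
          (christoffel g C (?x t) i j k * (\<phi>' t *\<^sub>R w) $ j) *\<^sub>R ?U t $ k))"
        by (simp add: F_def vec_eq_iff scaleR_sum_right mult_ac)
      finally show "(?U has_vector_derivative (\<chi> i. - (\<Sum>j\<in>UNIV. \<Sum>k\<in>UNIV.
          (christoffel g C (?x t) i j k * (\<phi>' t *\<^sub>R w) $ j) *\<^sub>R ?U t $ k))) (at t within {0..1})" .
    qed
    show "?x 0 = x0" "?U 0 = U0" by (simp_all add: \<phi>_def V(1))
    show "(?x has_vector_derivative w) (at 0 within {0..1})"
      using x[of 0] a by (simp add: \<phi>'_def)
  qed
qed

section \<open>Frames and covariant differentiation\<close>

context
  fixes X :: "'m topology" and A :: "('m, 'd::finite) chart set" and g :: "('m, 'd) metric"
  assumes riemannian: "riemannian_manifold X A g"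
begin

section \<open>Charts and Jacobians\<close>

lemma smooth_manifold: "smooth_manifold X A"
  using riemannian by (simp add: riemannian_manifold_def)

lemma chart_homeomorphic:
  "C \<in> A \<Longrightarrow> homeomorphic_map (subtopology X (fst C)) (top_of_set (snd C ` fst C)) (snd C)"
  and chart_openin: "C \<in> A \<Longrightarrow> openin X (fst C)"
  using smooth_manifold unfolding smooth_manifold_def by blast+

lemma chart_inj:
  assumes "C \<in> A"
  shows "inj_on (snd C) (fst C)"
  using homeomorphic_imp_injective_map[OF chart_homeomorphic[OF assms]] openin_subset[OF chart_openin[OF assms]]
  by (simp add: Int_absorb1)

lemma chart_inv_left: "C \<in> A \<Longrightarrow> p \<in> fst C \<Longrightarrow> chart_inv C (snd C p) = p"
  unfolding chart_inv_def using chart_inj by (rule inv_into_f_f)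

lemma chart_inv_right: "x \<in> snd C ` fst C \<Longrightarrow> snd C (chart_inv C x) = x"
  and chart_inv_in: "x \<in> snd C ` fst C \<Longrightarrow> chart_inv C x \<in> fst C"
  unfolding chart_inv_def by (rule f_inv_into_f inv_into_into; assumption)+

lemma chart_overlap_open:
  assumes C: "C \<in> A" and C': "C' \<in> A"
  shows "open (snd C ` (fst C \<inter> fst C'))"
proof -
  have "openin (subtopology X (fst C)) (fst C \<inter> fst C')"
    using chart_openin[OF C'] by (auto simp: openin_subtopology)
  then have "openin (top_of_set (snd C ` fst C)) (snd C ` (fst C \<inter> fst C'))"
    using homeomorphic_map_openness[OF chart_homeomorphic[OF C], of "fst C \<inter> fst C'"]
      openin_subset[OF chart_openin[OF C]] by auto
  then show ?thesis
    using openin_open_eq[OF chart_image_open[OF riemannian C]] by simp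
qed

lemma transition_has_derivative:
  assumes C: "C \<in> A" and C': "C' \<in> A" and p: "p \<in> fst C" "p \<in> fst C'"
  shows "((snd C' \<circ> chart_inv C) has_derivative ((*v) (jacobian C C' p))) (at (snd C p))"
proof -
  have "smooth_on (snd C ` (fst C \<inter> fst C')) (snd C' \<circ> chart_inv C)"
    using smooth_manifold C C' unfolding smooth_manifold_def by blast
  then have "(snd C' \<circ> chart_inv C) differentiable (at (snd C p))"
    using p by (intro smooth_on_differentiable) auto
  then have D: "((snd C' \<circ> chart_inv C) has_derivative frechet_derivative (snd C' \<circ> chart_inv C) (at (snd C p))) (at (snd C p))"
    by (simp add: frechet_derivative_works)
  then have "linear (frechet_derivative (snd C' \<circ> chart_inv C) (at (snd C p)))"
    by (rule has_derivative_linear)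
  then have "frechet_derivative (snd C' \<circ> chart_inv C) (at (snd C p)) = ((*v) (jacobian C C' p))"
    unfolding jacobian_def by (auto simp: matrix_works linear_def scalar_mult_eq_scaleR)
  with D show ?thesis by simp
qed

text \<open>The chain rule. The composite agrees with the direct transition map only on the overlap,
  which suffices because the overlap is open in coordinates.\<close>

lemma jacobian_cocycle:
  assumes C: "C \<in> A" "C' \<in> A" "C'' \<in> A" and p: "p \<in> fst C" "p \<in> fst C'" "p \<in> fst C''"
  shows "jacobian C C'' p = jacobian C' C'' p ** jacobian C C' p"
proof -
  note D1 = transition_has_derivative[OF C(1,2) p(1,2)]
  have "chart_inv C (snd C p) = p" by (rule chart_inv_left[OF C(1) p(1)])
  then have D2: "((snd C'' \<circ> chart_inv C') has_derivative ((*v) (jacobian C' C'' p))) (at ((snd C' \<circ> chart_inv C) (snd C p)))"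
    using transition_has_derivative[OF C(2,3) p(2,3)] by simp
  have "((snd C'' \<circ> chart_inv C') \<circ> (snd C' \<circ> chart_inv C) has_derivative
      ((*v) (jacobian C' C'' p)) \<circ> ((*v) (jacobian C C' p))) (at (snd C p))"
    by (rule diff_chain_at[OF D1 D2])
  then have "(snd C'' \<circ> chart_inv C has_derivative
      ((*v) (jacobian C' C'' p)) \<circ> ((*v) (jacobian C C' p))) (at (snd C p))"
  proof (rule has_derivative_transform_within_open[OF _ chart_overlap_open[OF C(1,2)]])
    show "snd C p \<in> snd C ` (fst C \<inter> fst C')" using p by blast
    fix x assume "x \<in> snd C ` (fst C \<inter> fst C')"
    then obtain q where "q \<in> fst C" "q \<in> fst C'" "x = snd C q" by blast
    then show "((snd C'' \<circ> chart_inv C') \<circ> (snd C' \<circ> chart_inv C)) x = (snd C'' \<circ> chart_inv C) x"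
      using C by (simp add: chart_inv_left)
  qed
  from has_derivative_unique[OF this transition_has_derivative[OF C(1,3) p(1,3)]]
  have "(jacobian C' C'' p ** jacobian C C' p) *v v = jacobian C C'' p *v v" for v
    by (metis comp_apply matrix_vector_mul_assoc)
  then show ?thesis by (simp add: matrix_eq)
qed

lemma jacobian_self:
  assumes C: "C \<in> A" and p: "p \<in> fst C"
  shows "jacobian C C p = mat 1"
proof -
  have "(snd C \<circ> chart_inv C has_derivative id) (at (snd C p))"
  proof (rule has_derivative_transform_within_open[OF has_derivative_id chart_image_open[OF riemannian C]])
    show "snd C p \<in> snd C ` fst C" using p by blast
    show "id x = (snd C \<circ> chart_inv C) x" if "x \<in> snd C ` fst C" for x
      using chart_inv_right[OF that] by simp
  qed
  from has_derivative_unique[OF this transition_has_derivative[OF C C p p]]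
  have "jacobian C C p *v v = mat 1 *v v" for v by (metis id_apply matrix_vector_mul_lid)
  then show ?thesis by (simp add: matrix_eq)
qed

section \<open>Frames in all charts at a point\<close>

lemma coord_change_mult: "coord_change (M ** N) U = coord_change M (coord_change N U)"
proof -
  have "(\<Sum>j\<in>UNIV. (\<Sum>k\<in>UNIV. M $ i $ k * N $ k $ j) *\<^sub>R U $ j) =
      (\<Sum>k\<in>UNIV. M $ i $ k *\<^sub>R (\<Sum>j\<in>UNIV. N $ k $ j *\<^sub>R U $ j))" for i
    by (simp add: scaleR_sum_left scaleR_sum_right) (rule sum.swap)
  then show ?thesis by (simp add: coord_change_def matrix_matrix_mult_def vec_eq_iff)
qed

lemma coord_change_1: "coord_change (mat 1) U = U"
  by (simp add: coord_change_def mat_def vec_eq_iff if_distrib[of "\<lambda>c. c *\<^sub>R _"] cong: if_cong)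

lemma charts_at_iff: "C \<in> charts_at A p \<longleftrightarrow> C \<in> A \<and> p \<in> fst C"
  by (simp add: charts_at_def)

text \<open>The cocycle rule makes coordinates transported from C consistent among all charts, and
  the trivial Jacobian of C to itself returns the given coordinates.\<close>

lemma
  assumes C: "C \<in> A" and x: "x \<in> snd C ` fst C"
  shows is_frame_frame_at: "is_frame A (frame_at A C x U)"
    and fst_frame_at: "fst (frame_at A C x U) \<in> fst C"
    and snd_chart_frame_at: "snd C (fst (frame_at A C x U)) = x"
    and snd_frame_at: "snd (frame_at A C x U) C = U"
proof -
  let ?p = "chart_inv C x"
  have p: "?p \<in> fst C" "snd C ?p = x" using chart_inv_in[OF x] chart_inv_right[OF x] by auto
  show "fst (frame_at A C x U) \<in> fst C" "snd C (fst (frame_at A C x U)) = x"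
    using p by (simp_all add: frame_at_def Let_def)
  show "snd (frame_at A C x U) C = U"
    using C p by (simp add: frame_at_def Let_def charts_at_iff jacobian_self coord_change_1)
  show "is_frame A (frame_at A C x U)"
    unfolding is_frame_def
  proof (intro conjI ballI allI impI)
    fix C' C'' assume "C' \<in> charts_at A (fst (frame_at A C x U))" "C'' \<in> charts_at A (fst (frame_at A C x U))"
    then have *: "C' \<in> A" "?p \<in> fst C'" "C'' \<in> A" "?p \<in> fst C''"
      by (simp_all add: frame_at_def Let_def charts_at_iff)
    then show "snd (frame_at A C x U) C'' =
        coord_change (jacobian C' C'' (fst (frame_at A C x U))) (snd (frame_at A C x U) C')"
      using jacobian_cocycle[OF C *(1,3) p(1) *(2,4)]
      by (simp add: frame_at_def Let_def charts_at_iff coord_change_mult)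
  qed (simp add: frame_at_def Let_def)
qed

text \<open>The group acts on the indices of H and E and a change of chart on the tangent index, so
  the two commute.\<close>

lemma is_frame_frame_right:
  fixes u :: "('m, 'n::finite, 'd) frame"
  assumes "is_frame A u"
  shows "is_frame A (frame_right a b u)"
proof -
  have lin: "frame_act a b (coord_change J U) = coord_change J (frame_act a b U)" for J and U :: "('n, 'd) frame_coords"
  proof -
    have sc: "transpose a ** (c *\<^sub>R M) ** b = c *\<^sub>R (transpose a ** M ** b)" for c :: real and M :: "complex^('n+'n)^(unit+unit)"
      by (simp add: matrix_matrix_mult_def vec_eq_iff flip: scaleR_sum_right)
    have add: "transpose a ** (M + N) ** b = transpose a ** M ** b + transpose a ** N ** b"
      for M N :: "complex^('n+'n)^(unit+unit)"
      unfolding matrix_add_ldistrib by (simp add: matrix_matrix_mult_def vec_eq_iff distrib_right sum.distrib)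
    have zero: "transpose a ** (0 :: complex^('n+'n)^(unit+unit)) ** b = 0"
      by (simp add: matrix_matrix_mult_def vec_eq_iff)
    have "transpose a ** (\<Sum>j\<in>I. J $ i $ j *\<^sub>R U $ j) ** b = (\<Sum>j\<in>I. J $ i $ j *\<^sub>R (transpose a ** (U $ j) ** b))" for i I
      by (induction I rule: infinite_finite_induct) (simp_all add: add sc zero)
    then show ?thesis by (simp add: frame_act_def coord_change_def vec_eq_iff)
  qed
  have 0: "frame_act a b (0 :: ('n, 'd) frame_coords) = 0" by (simp add: frame_act_def matrix_matrix_mult_def vec_eq_iff)
  show ?thesis
    unfolding is_frame_def
  proof (intro conjI ballI allI impI)
    fix C assume "C \<notin> charts_at A (fst (frame_right a b u))"
    then have "snd u C = 0"
      using assms[unfolded is_frame_def, THEN conjunct1, THEN spec, of C] by (simp add: frame_right_def)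
    then show "snd (frame_right a b u) C = 0" by (simp add: frame_right_def 0)
  next
    fix C C' assume "C \<in> charts_at A (fst (frame_right a b u))" "C' \<in> charts_at A (fst (frame_right a b u))"
    then have *: "C \<in> charts_at A (fst u)" "C' \<in> charts_at A (fst u)" by (simp_all add: frame_right_def)
    have "snd u C' = coord_change (jacobian C C' (fst u)) (snd u C)"
      by (rule assms[unfolded is_frame_def, THEN conjunct2, THEN bspec, OF *(1), THEN bspec, OF *(2)])
    then show "snd (frame_right a b u) C' =
        coord_change (jacobian C C' (fst (frame_right a b u))) (snd (frame_right a b u) C)"
      by (simp add: frame_right_def lin)
  qed
qed

section \<open>Derivatives along horizontal curves in the reduced frame bundle\<close>

context
  fixes u0 :: "('m, 'n::finite, 'd) frame"
  assumes u0: "is_frame A u0" "fst u0 \<in> topspace X"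
begin

text \<open>Only the last transport step matters, since it records both facts about its endpoint.
  Without any step the frame is a translate of the reference frame.\<close>

lemma frame_reduction_is_frame:
  assumes u: "u \<in> frame_reduction A g u0"
  shows "is_frame A u" "charts_at A (fst u) \<noteq> {}"
proof -
  obtain a b where "(transport_step A g)\<^sup>*\<^sup>* (frame_right a b u0) u"
    using u by (auto simp: frame_reduction_def parallel_transport_def)
  then have "is_frame A u \<and> charts_at A (fst u) \<noteq> {}"
  proof (cases rule: rtranclp.cases)
    case rtrancl_refl
    have "topspace X = (\<Union>C\<in>A. fst C)" using smooth_manifold by (simp add: smooth_manifold_def)
    then have "charts_at A (fst u) \<noteq> {}" using rtrancl_refl u0(2) by (auto simp: frame_right_def charts_at_def)
    then show ?thesis using rtrancl_refl is_frame_frame_right[OF u0(1), of a b] by simp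
  next
    case (rtrancl_into_rtrancl v)
    then show ?thesis by (auto simp: transport_step_def charts_at_def)
  qed
  then show "is_frame A u" "charts_at A (fst u) \<noteq> {}" by auto
qed

text \<open>A transport step is parametrised by {0..1} and ends at the new frame, so the initial
  piece up to t is rescaled by s \<mapsto> t * s; the equation of parallelism is invariant under
  this.\<close>

lemma horizontal_curve_in_reduction:
  assumes u: "u \<in> frame_reduction A g u0" and C: "C \<in> charts_at A (fst u)"
    and h: "horizontal_curve g C x U" and init: "x 0 = snd C (fst u)" "U 0 = snd u C" and t: "t \<in> {0..1}"
  shows "frame_at A C (x t) (U t) \<in> frame_reduction A g u0"
proof -
  have CA: "C \<in> A" "fst u \<in> fst C" using C by (auto simp: charts_at_iff)
  obtain x' where x': "continuous_on {0..1} x'"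
    "\<And>t. t \<in> {0..1} \<Longrightarrow> x t \<in> snd C ` fst C"
    "\<And>t. t \<in> {0..1} \<Longrightarrow> (x has_vector_derivative x' t) (at t within {0..1})"
    "\<And>t. t \<in> {0..1} \<Longrightarrow> (U has_vector_derivative
           (\<chi> i. - (\<Sum>j\<in>UNIV. \<Sum>k\<in>UNIV. (christoffel g C (x t) i j k * x' t $ j) *\<^sub>R U t $ k)))
          (at t within {0..1})"
    using h unfolding horizontal_curve_def by blast
  let ?s = "\<lambda>s. t * s"
  have s: "t * s \<in> {0..1}" if "s \<in> {0..1}" for s
    using t that by (auto simp: mult_le_one)
  have ds: "(?s has_vector_derivative t) (at s within {0..1})" for s
    unfolding has_vector_derivative_def by (auto intro!: derivative_eq_intros)
  have sub: "?s ` {0..1} \<subseteq> {0..1}" using s by blast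
  have "horizontal_curve g C (x \<circ> ?s) (U \<circ> ?s)"
    unfolding horizontal_curve_def
  proof (intro exI[of _ "\<lambda>s. t *\<^sub>R x' (t * s)"] conjI ballI)
    have "continuous_on {0..1} (\<lambda>s. x' (t * s))"
      by (rule continuous_on_compose2[OF x'(1) _ sub]) (intro continuous_intros)
    then show "continuous_on {0..1} (\<lambda>s. t *\<^sub>R x' (t * s))" by (intro continuous_intros)
    fix r :: real assume r: "r \<in> {0..1}"
    show "(x \<circ> ?s) r \<in> snd C ` fst C" using x'(2)[OF s[OF r]] by simp
    show "(x \<circ> ?s has_vector_derivative t *\<^sub>R x' (t * r)) (at r within {0..1})"
      by (rule vector_diff_chain_within[OF ds has_vector_derivative_within_subset[OF x'(3)[OF s[OF r]] sub]])
    have "(U \<circ> ?s has_vector_derivative t *\<^sub>R (\<chi> i. - (\<Sum>j\<in>UNIV. \<Sum>k\<in>UNIV.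
        (christoffel g C (x (t * r)) i j k * x' (t * r) $ j) *\<^sub>R U (t * r) $ k))) (at r within {0..1})"
      by (rule vector_diff_chain_within[OF ds has_vector_derivative_within_subset[OF x'(4)[OF s[OF r]] sub]])
    also have "t *\<^sub>R (\<chi> i. - (\<Sum>j\<in>UNIV. \<Sum>k\<in>UNIV.
        (christoffel g C (x (t * r)) i j k * x' (t * r) $ j) *\<^sub>R U (t * r) $ k)) =
      (\<chi> i. - (\<Sum>j\<in>UNIV. \<Sum>k\<in>UNIV. (christoffel g C ((x \<circ> ?s) r) i j k * (t *\<^sub>R x' (t * r)) $ j) *\<^sub>R (U \<circ> ?s) r $ k))"
      by (simp add: vec_eq_iff scaleR_sum_right mult_ac)
    finally show "(U \<circ> ?s has_vector_derivative
      (\<chi> i. - (\<Sum>j\<in>UNIV. \<Sum>k\<in>UNIV. (christoffel g C ((x \<circ> ?s) r) i j k * (t *\<^sub>R x' (t * r)) $ j) *\<^sub>R (U \<circ> ?s) r $ k)))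
      (at r within {0..1})" .
  qed
  note h' = this
  note f = is_frame_frame_at[OF CA(1) x'(2)[OF t], of "U t"] fst_frame_at[OF CA(1) x'(2)[OF t], of "U t"]
    snd_chart_frame_at[OF CA(1) x'(2)[OF t], of "U t"] snd_frame_at[OF CA(1) x'(2)[OF t], of "U t"]
  have "transport_step A g u (frame_at A C (x t) (U t))"
    unfolding transport_step_def using frame_reduction_is_frame(1)[OF u] f CA
    by (intro conjI bexI[of _ C] exI[of _ "x \<circ> ?s"] exI[of _ "U \<circ> ?s"] h') (auto simp: init)
  then show ?thesis using u
    by (auto simp: frame_reduction_def parallel_transport_def intro: rtranclp.rtrancl_into_rtrancl)
qed

text \<open>The curve picked by \<open>SOME\<close> does not mention the function, so a single c
  serves all f. This order of quantifiers is what makes the covariant derivative linear in the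
  section.\<close>

lemma covariant_derivative_along_curve:
  assumes u: "u \<in> frame_reduction A g u0" and C: "C \<in> charts_at A (fst u)"
  obtains c :: "real \<Rightarrow> ('m, 'n, 'd) frame" where "\<And>t. t \<in> {0..1} \<Longrightarrow> c t \<in> frame_reduction A g u0"
    "\<And>f. cov_deriv_in_chart A g f u C w = vector_derivative (\<lambda>t. f (c t)) (at 0 within {0..1})"
    "\<And>f. smooth_on_frames A (frame_reduction A g u0) f \<Longrightarrow> (\<lambda>t. f (c t)) differentiable (at 0 within {0..1})"
proof -
  have CA: "C \<in> A" "fst u \<in> fst C" using C by (auto simp: charts_at_iff)
  let ?Q = "\<lambda>(x, U). horizontal_curve g C x U \<and> x 0 = snd C (fst u) \<and> U 0 = snd u C \<and>
      (x has_vector_derivative w) (at 0 within {0..1})"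
  obtain x U where xU: "(SOME xU. ?Q xU) = (x, U)" by (cases "SOME xU. ?Q xU") auto
  have "\<exists>xU. ?Q xU"
    using horizontal_curve_exists[OF riemannian CA(1), of "snd C (fst u)" "snd u C" w] CA(2) by auto
  from someI_ex[OF this] have h: "horizontal_curve g C x U" "x 0 = snd C (fst u)" "U 0 = snd u C"
    unfolding xU by auto
  obtain x' U' where x': "\<And>t. t \<in> {0..1} \<Longrightarrow> x t \<in> snd C ` fst C"
    "(x has_vector_derivative x') (at 0 within {0..1})" "(U has_vector_derivative U') (at 0 within {0..1})"
  proof -
    obtain x' where *: "\<forall>t\<in>{0..1}. x t \<in> snd C ` fst C \<and> (x has_vector_derivative x' t) (at t within {0..1}) \<and>
        (U has_vector_derivative (\<chi> i. - (\<Sum>j\<in>UNIV. \<Sum>k\<in>UNIV. (christoffel g C (x t) i j k * x' t $ j) *\<^sub>R U t $ k)))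
          (at t within {0..1})"
      using h(1) unfolding horizontal_curve_def by blast
    have "0 \<in> {0..1 :: real}" by simp
    from bspec[OF * this] that[of "x' 0"] * show thesis by blast
  qed
  show thesis
  proof (rule that)
    show P: "frame_at A C (x t) (U t) \<in> frame_reduction A g u0" if "t \<in> {0..1}" for t
      by (rule horizontal_curve_in_reduction[OF u C h that])
    show "cov_deriv_in_chart A g f u C w = vector_derivative (\<lambda>t. f (frame_at A C (x t) (U t))) (at 0 within {0..1})" for f
      by (simp add: cov_deriv_in_chart_def xU)
    fix f assume "smooth_on_frames A (frame_reduction A g u0) f"
    from this[unfolded smooth_on_frames_def, THEN bspec, OF u, THEN bspec, OF C]
    obtain W F where *: "open W \<and> (snd C (fst u), snd u C) \<in> W \<and> smooth_on W F \<and>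
       (\<forall>v\<in>frame_reduction A g u0. fst v \<in> fst C \<and> (snd C (fst v), snd v C) \<in> W \<longrightarrow> F (snd C (fst v), snd v C) = f v)"
      by (elim exE)
    then have W: "open W" "(snd C (fst u), snd u C) \<in> W" "smooth_on W F" by simp_all
    have F: "F (snd C (fst v), snd v C) = f v"
      if "v \<in> frame_reduction A g u0" "fst v \<in> fst C" "(snd C (fst v), snd v C) \<in> W" for v
      using * that by simp
    let ?k = "\<lambda>t. (x t, U t)"
    have k: "?k differentiable (at 0 within {0..1})"
      using x'(2,3) unfolding has_vector_derivative_def differentiable_def
      by (blast intro: has_derivative_Pair)
    have "F differentiable (at (?k 0) within ?k ` {0..1})"
      using smooth_on_differentiable[OF W(3,2)] h(2,3) by (simp add: differentiable_at_withinI)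
    from differentiable_chain_within[OF k this]
    have D: "(\<lambda>t. F (x t, U t)) differentiable (at 0 within {0..1})" by (simp add: o_def)
    have "continuous (at 0 within {0..1}) ?k" by (rule differentiable_imp_continuous_within[OF k])
    then have "\<forall>\<^sub>F t in at 0 within {0..1}. ?k t \<in> W"
      using W(1,2) h(2,3) unfolding continuous_within by (intro topological_tendstoD) auto
    then obtain d where d: "0 < d" "\<And>t. t \<in> {0..1} \<Longrightarrow> t \<noteq> 0 \<Longrightarrow> dist t 0 < d \<Longrightarrow> ?k t \<in> W"
      unfolding eventually_at by blast
    \<comment> \<open>The section agrees with its smooth extension F only while the lifted curve
      stays in W, which holds for small t and suffices at 0.\<close>
    show "(\<lambda>t. f (frame_at A C (x t) (U t))) differentiable (at 0 within {0..1})"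
    proof (rule differentiable_transform_within[OF D d(1)])
      fix t :: real assume t: "t \<in> {0..1}" "dist t 0 < d"
      have "?k t \<in> W" using d(2)[OF t(1) _ t(2)] W(2) h(2,3) by (cases "t = 0") auto
      with F[OF P[OF t(1)]] show "F (x t, U t) = f (frame_at A C (x t) (U t))"
        using snd_chart_frame_at[OF CA(1) x'(1)[OF t(1)], of "U t"] snd_frame_at[OF CA(1) x'(1)[OF t(1)], of "U t"]
          fst_frame_at[OF CA(1) x'(1)[OF t(1)], of "U t"] by simp
    qed simp
  qed
qed

lemma vector_derivative_sum_scale:
  fixes f :: "'i \<Rightarrow> real \<Rightarrow> complex"
  assumes "finite I" "\<And>i. i \<in> I \<Longrightarrow> f i differentiable (at 0 within {0..1})"
    and "\<And>t. t \<in> {0..1} \<Longrightarrow> h t = (\<Sum>i\<in>I. f i t * a i)"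
  shows "vector_derivative h (at 0 within {0..1}) = (\<Sum>i\<in>I. vector_derivative (f i) (at 0 within {0..1}) * a i)"
proof (rule vector_derivative_within_closed_interval)
  have "((\<lambda>t. \<Sum>i\<in>I. f i t * a i) has_vector_derivative (\<Sum>i\<in>I. vector_derivative (f i) (at 0 within {0..1}) * a i))
      (at 0 within {0..1})"
    using assms(2) by (intro has_vector_derivative_sum has_vector_derivative_mult_left)
      (simp add: vector_derivative_works)
  then show "(h has_vector_derivative (\<Sum>i\<in>I. vector_derivative (f i) (at 0 within {0..1}) * a i)) (at 0 within {0..1})"
    by (rule has_vector_derivative_transform[rotated 2]) (use assms(3) in auto)
qed auto

text \<open>Expanding \<open>f\<close> in the basis dual to finitely many evaluations reduces both claims to the
  linearity of the derivative of scalar functions.\<close>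

lemma
  fixes f :: "('m, 'n, 'd) frame \<Rightarrow> 'i \<Rightarrow> complex"
  assumes V: "function_subspace V" "finitely_determined V" and u: "u \<in> frame_reduction A g u0"
    and f: "\<And>v. v \<in> frame_reduction A g u0 \<Longrightarrow> f v \<in> V"
      "\<And>i. smooth_on_frames A (frame_reduction A g u0) (\<lambda>v. f v i)"
  shows nabla_in: "nabla A g f u h e \<in> V"
    and nabla_linear_map: "linear_between V W F \<Longrightarrow> nabla A g (\<lambda>v. F (f v)) u h e = F (nabla A g f u h e)"
proof -
  obtain Z b where Z: "finite Z" "\<And>z. z \<in> Z \<Longrightarrow> b z \<in> V"
      and expand: "\<And>\<phi>. \<phi> \<in> V \<Longrightarrow> \<phi> = (\<lambda>x. \<Sum>z\<in>Z. \<phi> z * b z x)"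
    using finitely_determined_basis[OF V] by blast
  define C where "C = (SOME C. C \<in> charts_at A (fst u))"
  have C: "C \<in> charts_at A (fst u)"
    unfolding C_def using frame_reduction_is_frame(2)[OF u] by (simp add: some_in_eq)
  have cov: "cov_deriv_in_chart A g (\<lambda>v. F (f v) i) u C w =
      (\<Sum>z\<in>Z. cov_deriv_in_chart A g (\<lambda>v. f v z) u C w * F (b z) i)"
    if F: "linear_between V W F" for F :: "('i \<Rightarrow> complex) \<Rightarrow> 'j \<Rightarrow> complex" and W i w
  proof -
    obtain c where c: "\<And>t. t \<in> {0..1} \<Longrightarrow> c t \<in> frame_reduction A g u0"
      "\<And>f. cov_deriv_in_chart A g f u C w = vector_derivative (\<lambda>t. f (c t)) (at 0 within {0..1})"
      "\<And>f. smooth_on_frames A (frame_reduction A g u0) f \<Longrightarrow> (\<lambda>t. f (c t)) differentiable (at 0 within {0..1})"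
      using covariant_derivative_along_curve[OF u C, of w] by blast
    show ?thesis
      unfolding c(2)
    proof (rule vector_derivative_sum_scale[OF Z(1) c(3)[OF f(2)]])
      fix t :: real assume "t \<in> {0..1}"
      then have fV: "f (c t) \<in> V" using c(1) f(1) by blast
      have "F (f (c t)) = F (\<lambda>x. \<Sum>z\<in>Z. f (c t) z * b z x)" by (rule arg_cong[OF expand[OF fV]])
      also have "\<dots> = (\<lambda>y. \<Sum>z\<in>Z. f (c t) z * F (b z) y)" by (rule linear_between_sum[OF F V(1) Z])
      finally show "F (f (c t)) i = (\<Sum>z\<in>Z. f (c t) z * F (b z) i)" by (rule fun_cong)
    qed
  qed
  let ?n = "nabla A g f u h e"
  have nabla_expand: "nabla A g (\<lambda>v. F (f v)) u h e = (\<lambda>i. \<Sum>z\<in>Z. ?n z * F (b z) i)"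
    if F: "linear_between V W F" for F :: "('i \<Rightarrow> complex) \<Rightarrow> 'j \<Rightarrow> complex" and W
    unfolding nabla_def C_def[symmetric] Let_def cov[OF F]
    by (auto simp: sum_distrib_left sum.distrib algebra_simps)
  \<comment> \<open>With the identity as F the expansion describes \<nabla>f itself. Membership
    follows at once, and applying a general F to this expansion gives the commutation.\<close>
  have "linear_between V V (\<lambda>\<phi>. \<phi>)" by (simp add: linear_between_def)
  from nabla_expand[OF this] have n: "?n = (\<lambda>i. \<Sum>z\<in>Z. ?n z * b z i)" .
  show "?n \<in> V"
    by (subst n) (rule function_subspace_sum[OF V(1) Z(2)])
  assume F: "linear_between V W F"
  have "F ?n = F (\<lambda>i. \<Sum>z\<in>Z. ?n z * b z i)" by (rule arg_cong[OF n])
  also have "\<dots> = (\<lambda>i. \<Sum>z\<in>Z. ?n z * F (b z) i)" by (rule linear_between_sum[OF F V(1) Z])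
  finally show "nabla A g (\<lambda>v. F (f v)) u h e = F ?n" using nabla_expand[OF F] by simp
qed

end

end

section \<open>The twisted Dirac operator\<close>

lemma quaternionic_kaehlerD:
  assumes "quaternionic_kaehler X A g u\<^sub>0"
  shows "riemannian_manifold X A g" "is_frame A u\<^sub>0" "fst u\<^sub>0 \<in> topspace X"
  using assms by (simp_all add: quaternionic_kaehler_def adapted_frame_def)

lemma linear_between_degree_part:
  assumes "q \<le> 2 * CARD('n)"
  shows "linear_between (forms_space k) (form_space k q) (degree_part q :: 'n::finite forms \<Rightarrow> 'n form)"
  unfolding linear_between_def using degree_part_in_form_space[OF _ assms] by (auto simp: degree_part_def)

text \<open>In the d-part, taking degrees is a selection of coordinates and commutes with \<nabla>
  by definition. In the \<delta>-part \<nabla> is moved past \<gamma>, and the inverse of \<gamma>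
  past the sum over the dual bases; the fibrewise symbol identity does the rest.\<close>

lemma D_op_eq_dirac_op:
  fixes u\<^sub>0 :: "('m, 'n::finite, 'd::finite) frame" and f :: "('m, 'n, 'd) frame \<Rightarrow> 'n forms"
  assumes qk: "quaternionic_kaehler X A g u\<^sub>0" and \<gamma>: "is_gamma k \<gamma>"
    and f: "smooth_section A (frame_reduction A g u\<^sub>0) k f" and u: "u \<in> frame_reduction A g u\<^sub>0"
  shows "D_op A g k \<gamma> f u = dirac_op A g k f u"
proof
  fix qi :: "nat \<times> H list \<times> 'n E list"
  obtain q i where qi: "qi = (q, i)" by (cases qi)
  let ?n = "CARD('n)"
  define N where "N B b = nabla A g f u (axis B 1) (axis b 1)" for B b
  note fP = f[unfolded smooth_section_def, THEN conjunct1, THEN bspec]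
    f[unfolded smooth_section_def, THEN conjunct2, THEN conjunct2, THEN spec]
  note nabla = quaternionic_kaehlerD[OF qk] function_subspace_forms_space finitely_determined_forms_space u fP
  have N: "N B b \<in> forms_space k" for B b
    unfolding N_def by (rule nabla_in[OF nabla])
  have d: "first_order_op A g (symbol_d k (q - 1)) (\<lambda>v. degree_part (q - 1) (f v)) u i =
      (\<Sum>B\<in>UNIV. \<Sum>b\<in>UNIV. symbol_d k (q - 1) (axis B 1) (axis b 1) (degree_part (q - 1) (N B b)) i)"
    unfolding first_order_op_def N_def by (simp add: nabla_def degree_part_def)
  define inv where "inv = inv_into (form_space k q) (\<gamma> q)"
  have \<delta>: "inv (first_order_op A g (symbol_delta (q + 1)) (\<lambda>v. \<gamma> (q + 1) (degree_part (q + 1) (f v))) u) i =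
      (\<Sum>B\<in>UNIV. \<Sum>b\<in>UNIV. inv (symbol_delta (q + 1) (axis B 1) (axis b 1)
         (\<gamma> (q + 1) (degree_part (q + 1) (N B b)))) i)"
    if q: "q + 1 \<le> 2 * ?n"
  proof -
    let ?s = "\<lambda>B b. symbol_delta (q + 1) (axis B 1) (axis b 1) (\<gamma> (q + 1) (degree_part (q + 1) (N B b)))"
    have q': "q \<le> 2 * ?n" using q by simp
    have "nabla A g (\<lambda>v. \<gamma> (q + 1) (degree_part (q + 1) (f v))) u h e =
        \<gamma> (q + 1) (degree_part (q + 1) (nabla A g f u h e))" for h e
      using nabla_linear_map[OF nabla linear_between_comp[OF linear_between_degree_part[OF q] is_gammaD(2)[OF \<gamma> q]]]
      by (simp add: o_def)
    then have op: "first_order_op A g (symbol_delta (q + 1)) (\<lambda>v. \<gamma> (q + 1) (degree_part (q + 1) (f v))) u =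
        (\<lambda>j. \<Sum>B\<in>UNIV. \<Sum>b\<in>UNIV. ?s B b j)"
      by (simp add: first_order_op_def N_def)
    have inv: "linear_between (dual_form_space k q) (form_space k q) inv"
      unfolding inv_def
      by (rule linear_between_inv_into[OF is_gammaD(2)[OF \<gamma> q'] function_subspace_form_space is_gammaD(1)[OF \<gamma> q']])
    \<comment> \<open>The inverse of \<gamma> is linear only on its fibre, so each summand must lie
      there before the sum is pulled out.\<close>
    have s: "?s B b \<in> dual_form_space k q" for B b by (rule symbol_delta_in[OF \<gamma> N q])
    have "inv (\<lambda>j. \<Sum>B\<in>UNIV. \<Sum>b\<in>UNIV. ?s B b j) = (\<lambda>j. \<Sum>B\<in>UNIV. inv (\<lambda>j. \<Sum>b\<in>UNIV. ?s B b j) j)"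
      by (intro linear_between_sum_plain[OF inv function_subspace_dual_form_space]
          function_subspace_sum_plain[OF function_subspace_dual_form_space] s finite)
    also have "\<dots> = (\<lambda>j. \<Sum>B\<in>UNIV. \<Sum>b\<in>UNIV. inv (?s B b) j)"
      by (subst linear_between_sum_plain[OF inv function_subspace_dual_form_space finite s]) (rule refl)
    finally show ?thesis unfolding op by (rule fun_cong)
  qed
  have "dirac_op A g k f u qi = (\<Sum>B\<in>UNIV. \<Sum>b\<in>UNIV. of_real (sqrt 2) *
     ((if 1 \<le> q \<and> q \<le> 2 * ?n then symbol_d k (q - 1) (axis B 1) (axis b 1) (degree_part (q - 1) (N B b)) i else 0)
    + (if q + 1 \<le> 2 * ?n then inv (symbol_delta (q + 1) (axis B 1) (axis b 1)
         (\<gamma> (q + 1) (degree_part (q + 1) (N B b)))) i else 0)))"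
    unfolding dirac_op_def first_order_op_def qi inv_def N_def[symmetric] cliff_eq[OF \<gamma> N] ..
  also have "\<dots> = D_op A g k \<gamma> f u qi"
  proof -
    have if_sum: "(if P then x else 0) = (\<Sum>B\<in>UNIV. \<Sum>b\<in>UNIV. if P then F B b else 0)"
      if "P \<Longrightarrow> x = (\<Sum>B\<in>UNIV. \<Sum>b\<in>UNIV. F B b)" for P and x :: complex
        and F :: "unit + unit \<Rightarrow> 'n + 'n \<Rightarrow> complex"
      using that by simp
    have "(if q + 1 \<le> 2 * ?n then inv (first_order_op A g (symbol_delta (q + 1))
          (\<lambda>v. \<gamma> (q + 1) (degree_part (q + 1) (f v))) u) i else 0) =
      (\<Sum>B\<in>UNIV. \<Sum>b\<in>UNIV. if q + 1 \<le> 2 * ?n then inv (symbol_delta (q + 1) (axis B 1) (axis b 1)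
         (\<gamma> (q + 1) (degree_part (q + 1) (N B b)))) i else 0)"
      by (rule if_sum) (rule \<delta>)
    then show ?thesis
      unfolding D_op_def qi split inv_def[symmetric] if_sum[OF d]
      by (simp only: sum.distrib sum_distrib_left[symmetric] distrib_left[symmetric])
  qed
  finally show "D_op A g k \<gamma> f u qi = dirac_op A g k f u qi" by simp
qed

text \<open>A linear map of fibres with constant coefficients commutes with \<nabla> and with the
  sum over the dual bases, and \<Psi> intertwines the two Clifford multiplications by
  assumption.\<close>

lemma spinor_iso_dirac_op:
  fixes u\<^sub>0 :: "('m, 'n::finite, 'd::finite) frame" and f :: "('m, 'n, 'd) frame \<Rightarrow> 'n forms"
  assumes qk: "quaternionic_kaehler X A g u\<^sub>0"
    and f: "smooth_section A (frame_reduction A g u\<^sub>0) k f" and u: "u \<in> frame_reduction A g u\<^sub>0"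
    and \<Psi>: "is_spinor_iso k c \<Psi>"
  shows "\<Psi> (dirac_op A g k f u) = twisted_dirac_op A g c (\<lambda>v. \<Psi> (f v)) u"
proof -
  \<comment> \<open>Some \<gamma> is fixed because \<open>cliff_in\<close> derives from the symbol
    identity that Clifford multiplication preserves the fibre, where \<Psi> is linear.\<close>
  obtain \<gamma> :: "nat \<Rightarrow> 'n form \<Rightarrow> 'n dual_form" where \<gamma>: "is_gamma k \<gamma>" using is_gamma_exists by blast
  have lin: "linear_between (forms_space k) (twisted_spinor_space k) \<Psi>"
    and cliff: "\<And>h e \<phi>. \<phi> \<in> forms_space k \<Longrightarrow> \<Psi> (cliff k h e \<phi>) = tensor_op (c h e) id (\<Psi> \<phi>)"
    using \<Psi> by (simp_all add: is_spinor_iso_def)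
  note fP = f[unfolded smooth_section_def, THEN conjunct1, THEN bspec]
    f[unfolded smooth_section_def, THEN conjunct2, THEN conjunct2, THEN spec]
  note nabla = quaternionic_kaehlerD[OF qk] function_subspace_forms_space finitely_determined_forms_space u fP
  define N where "N B b = nabla A g f u (axis B 1) (axis b 1)" for B b
  have N: "N B b \<in> forms_space k" for B b
    unfolding N_def by (rule nabla_in[OF nabla])
  let ?s = "\<lambda>B b. cliff k (flat (axis B 1)) (flat (axis b 1)) (N B b)"
  have s: "?s B b \<in> forms_space k" for B b by (rule cliff_in[OF \<gamma> N])
  have nabla_\<Psi>: "nabla A g (\<lambda>v. \<Psi> (f v)) u h e = \<Psi> (nabla A g f u h e)" for h e
    by (rule nabla_linear_map[OF nabla lin])
  have "\<Psi> (dirac_op A g k f u) = \<Psi> (\<lambda>j. \<Sum>B\<in>UNIV. \<Sum>b\<in>UNIV. ?s B b j)"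
    by (simp add: dirac_op_def first_order_op_def N_def)
  also have "\<dots> = (\<lambda>j. \<Sum>B\<in>UNIV. \<Psi> (\<lambda>j. \<Sum>b\<in>UNIV. ?s B b j) j)"
    by (intro linear_between_sum_plain[OF lin function_subspace_forms_space]
        function_subspace_sum_plain[OF function_subspace_forms_space] s finite)
  also have "\<dots> = (\<lambda>j. \<Sum>B\<in>UNIV. \<Sum>b\<in>UNIV. \<Psi> (?s B b) j)"
    by (subst linear_between_sum_plain[OF lin function_subspace_forms_space finite s]) (rule refl)
  also have "\<dots> = (\<lambda>j. \<Sum>B\<in>UNIV. \<Sum>b\<in>UNIV.
      tensor_op (c (flat (axis B 1)) (flat (axis b 1))) id (\<Psi> (N B b)) j)"
    by (simp only: cliff[OF N])
  also have "\<dots> = twisted_dirac_op A g c (\<lambda>v. \<Psi> (f v)) u"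
    unfolding twisted_dirac_op_def first_order_op_def nabla_\<Psi> N_def ..
  finally show ?thesis .
qed

text \<open>The existence of \<gamma> keeps the universal statement from being vacuous. The operator
  identity is proved on forms and then carried by \<Psi> to spinors.\<close>

theorem proposition2p2:
  fixes X :: "'m topology" and A :: "('m, 'd::finite) chart set" and g :: "('m, 'd) metric"
    and u\<^sub>0 :: "('m, 'n::finite, 'd) frame" and k :: nat
  assumes "quaternionic_kaehler X A g u\<^sub>0"
    and "even k"
  shows "(\<exists>\<gamma> :: nat \<Rightarrow> 'n form \<Rightarrow> 'n dual_form. is_gamma k \<gamma>) \<and>
    (\<forall>\<gamma> f. is_gamma k \<gamma> \<and> smooth_section A (frame_reduction A g u\<^sub>0) k f \<longrightarrow>
       (\<forall>u\<in>frame_reduction A g u\<^sub>0.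
          D_op A g k \<gamma> f u = dirac_op A g k f u \<and>
          (\<forall>c \<Psi>. spinor_clifford c \<and> is_spinor_iso k c \<Psi> \<longrightarrow>
             \<Psi> (D_op A g k \<gamma> f u) = twisted_dirac_op A g c (\<lambda>v. \<Psi> (f v)) u)))"
proof (intro conjI allI impI ballI)
  show "\<exists>\<gamma> :: nat \<Rightarrow> 'n form \<Rightarrow> 'n dual_form. is_gamma k \<gamma>" by (rule is_gamma_exists)
  fix \<gamma> :: "nat \<Rightarrow> 'n form \<Rightarrow> 'n dual_form" and f u
  assume "is_gamma k \<gamma> \<and> smooth_section A (frame_reduction A g u\<^sub>0) k f" and u: "u \<in> frame_reduction A g u\<^sub>0"
  then have \<gamma>: "is_gamma k \<gamma>" and f: "smooth_section A (frame_reduction A g u\<^sub>0) k f" by simp_all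
  show eq: "D_op A g k \<gamma> f u = dirac_op A g k f u" by (rule D_op_eq_dirac_op[OF assms(1) \<gamma> f u])
  fix c and \<Psi> :: "'n forms \<Rightarrow> 'n twisted_spinor"
  assume "spinor_clifford c \<and> is_spinor_iso k c \<Psi>"
  then show "\<Psi> (D_op A g k \<gamma> f u) = twisted_dirac_op A g c (\<lambda>v. \<Psi> (f v)) u"
    unfolding eq using spinor_iso_dirac_op[OF assms(1) f u] by blast
qed

end
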